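(* Let $E$ be a complete, co-nuclear locally convex space in which each convergent sequence converges locally. Then the domain of sums of each convergent series $\sum(u_k)$ in $E$ is an affine subspace, namely $$S\bigl(\textstyle\sum(u_k)\bigr)=\sum_{k=1}^\infty u_k+\Gamma^{\bot}_{\mathrm{loc}}\bigl(\textstyle\sum(u_k)\bigr).$$
   Context: All locally convex spaces are real and Hausdorff. $\mathcal B(E)$ is the collection of all absolutely convex, closed and bounded subsets of $E$. For an absolutely convex bounded set $B\subset E$, $E_B$ denotes $\operatorname{span}B$ normed by the Minkowski gauge functional $m_B$ of $B$. $E$ is co-nuclear if its dual (with the topology of uniform convergence on bounded sets) is nuclear or, equivalently, if for each $B\in\mathcal B(E)$ there is $C\in\mathcal B(E)$ with $B\subset C$ such that the embedding $E_B\hookrightarrow E_C$ is nuclear. A sequence in $E$ converges locally if it is contained and converges in some $E_B$, $B\in\mathcal B(E)$. For a convergent series $\sum(u_k)$ in $E$ the domain of sums $S(\sum(u_k))$ is the set of all $x\in E$ for which there is a permutation $\pi$ of $\mathbb N$ with $x=\sum_{k=1}^\infty u_{\pi(k)}$ (convergence in $E$). If each convergent sequence in $E$ converges locally, then a convergent series $\sum(u_k)$ converges in $E_{B_0}$ for some $B_0\in\mathcal B(E)$. For absolutely convex bounded $B\supset B_0$ put $$\Gamma^{\bot}_{B}\bigl(\textstyle\sum(u_k)\bigr):=\{x\in E_{B}: x'(x)=0\text{ for all }x'\in(E_{B})'\text{ with }\sum_k|x'(u_k)|<\infty\},$$ $$\Gamma^{\bot}_{\mathrm{loc}}\bigl(\textstyle\sum(u_k)\bigr):=\bigcup_{B}\Gamma^{\bot}_{B}\bigl(\textstyle\sum(u_k)\bigr),$$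 the union being taken over all absolutely convex bounded sets $B\supset B_0$. This set is a subspace of $E$ and is independent of the choice of $B_0$. *)

theory Defs
  imports "HOL-Analysis.Analysis"
begin

text \<open>The uniformity of a \<open>uniform_topological_group_add\<close> is the translation-invariant
  one, so \<open>complete UNIV\<close> is completeness in the sense of Cauchy filters (equivalently,
  Cauchy nets). The second axiom spells out \<open>convex V\<close>, which cannot be used inside the
  class specification.\<close>

class locally_convex_space = real_vector + t2_space +
  topological_ab_group_add + uniform_topological_group_add +
  assumes tendsto_scaleR_nhds:
    "filterlim (\<lambda>(r, x). r *\<^sub>R x) (nhds (a *\<^sub>R b)) (nhds (a::real) \<times>\<^sub>F nhds b)"
  and locally_convex:
    "open U \<Longrightarrow> 0 \<in> U \<Longrightarrow> \<exists>V. open V \<and> 0 \<in> V \<and> V \<subseteq> U \<and>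
      (\<forall>x\<in>V. \<forall>y\<in>V. \<forall>u\<ge>0. \<forall>v\<ge>0. u + v = 1 \<longrightarrow> u *\<^sub>R x + v *\<^sub>R y \<in> V)"

lemma locally_convex_nhds:
  fixes U :: "'a::locally_convex_space set"
  assumes "open U" "0 \<in> U"
  shows "\<exists>V. open V \<and> 0 \<in> V \<and> convex V \<and> V \<subseteq> U"
  using locally_convex[OF assms] unfolding convex_def by blast

definition absolutely_convex :: "'a::real_vector set \<Rightarrow> bool" where
  "absolutely_convex B \<longleftrightarrow> B \<noteq> {} \<and>
     (\<forall>x\<in>B. \<forall>y\<in>B. \<forall>a b. \<bar>a\<bar> + \<bar>b\<bar> \<le> 1 \<longrightarrow> a *\<^sub>R x + b *\<^sub>R y \<in> B)"

text \<open>The library's \<open>bounded\<close> is metric; this is von Neumann boundedness.\<close>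

definition tvs_bounded :: "'a::locally_convex_space set \<Rightarrow> bool" where
  "tvs_bounded B \<longleftrightarrow>
     (\<forall>U. open U \<and> 0 \<in> U \<longrightarrow> (\<exists>s>0. \<forall>t>s. B \<subseteq> scaleR t ` U))"

text \<open>The collection written \<open>\<B>(E)\<close>.\<close>

definition closed_disks :: "'a::locally_convex_space set set" where
  "closed_disks = {B. absolutely_convex B \<and> closed B \<and> tvs_bounded B}"

text \<open>The normed space \<open>E\<^sub>B\<close> is represented by its carrier \<open>span B\<close> together with
  the norm \<open>minkowski_gauge B\<close>.\<close>

definition minkowski_gauge :: "'a::real_vector set \<Rightarrow> 'a \<Rightarrow> real" where
  "minkowski_gauge B x = Inf {t. 0 < t \<and> x \<in> scaleR t ` B}"

definition converges_in_disk_to :: "'a::real_vector set \<Rightarrow> (nat \<Rightarrow> 'a) \<Rightarrow> 'a \<Rightarrow> bool" where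
  "converges_in_disk_to B s x \<longleftrightarrow> range s \<subseteq> span B \<and> x \<in> span B \<and>
     (\<lambda>n. minkowski_gauge B (s n - x)) \<longlonglongrightarrow> 0"

definition series_converges_in_disk :: "'a::real_vector set \<Rightarrow> (nat \<Rightarrow> 'a) \<Rightarrow> bool" where
  "series_converges_in_disk B u \<longleftrightarrow> (\<exists>x. converges_in_disk_to B (\<lambda>n. \<Sum>k<n. u k) x)"

text \<open>The continuous dual of \<open>E\<^sub>B\<close>. Functionals are total functions of which only the
  values on \<open>span B\<close> matter.\<close>

definition disk_dual :: "'a::real_vector set \<Rightarrow> ('a \<Rightarrow> real) set" where
  "disk_dual B = {f.
     (\<forall>x\<in>span B. \<forall>y\<in>span B. f (x + y) = f x + f y) \<and>
     (\<forall>c. \<forall>x\<in>span B. f (c *\<^sub>R x) = c * f x) \<and>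
     (\<exists>K. \<forall>x\<in>span B. \<bar>f x\<bar> \<le> K * minkowski_gauge B x)}"

definition disk_dual_norm :: "'a::real_vector set \<Rightarrow> ('a \<Rightarrow> real) \<Rightarrow> real" where
  "disk_dual_norm B f = (SUP x\<in>{x \<in> span B. minkowski_gauge B x \<le> 1}. \<bar>f x\<bar>)"

text \<open>Nuclearity of a map \<open>E\<^sub>B \<rightarrow> E\<^sub>C\<close>: \<open>T x = \<Sum>n. f\<^sub>n(x) y\<^sub>n\<close> with convergence in \<open>E\<^sub>C\<close>
  and \<open>\<Sum>n. \<parallel>f\<^sub>n\<parallel> \<parallel>y\<^sub>n\<parallel> < \<infinity>\<close>.\<close>

definition nuclear_between_disks ::
    "'a::real_vector set \<Rightarrow> 'a set \<Rightarrow> ('a \<Rightarrow> 'a) \<Rightarrow> bool" where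
  "nuclear_between_disks B C T \<longleftrightarrow>
     (\<exists>f y. (\<forall>n. f n \<in> disk_dual B) \<and> (\<forall>n. y n \<in> span C) \<and>
        summable (\<lambda>n::nat. disk_dual_norm B (f n) * minkowski_gauge C (y n)) \<and>
        (\<forall>x\<in>span B. converges_in_disk_to C (\<lambda>N. \<Sum>n<N. f n x *\<^sub>R y n) (T x)))"

definition co_nuclear :: "'a::locally_convex_space itself \<Rightarrow> bool" where
  "co_nuclear _ \<longleftrightarrow>
     (\<forall>B\<in>closed_disks :: 'a set set. \<exists>C\<in>closed_disks.
        B \<subseteq> C \<and> nuclear_between_disks B C (\<lambda>x. x))"

definition converges_locally :: "(nat \<Rightarrow> 'a::locally_convex_space) \<Rightarrow> bool" where
  "converges_locally s \<longleftrightarrow> (\<exists>B\<in>closed_disks. \<exists>x. converges_in_disk_to B s x)"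

definition domain_of_sums :: "(nat \<Rightarrow> 'a::locally_convex_space) \<Rightarrow> 'a set" where
  "domain_of_sums u = {x. \<exists>\<pi>::nat \<Rightarrow> nat. bij \<pi> \<and> (\<lambda>k. u (\<pi> k)) sums x}"

definition Gamma_perp :: "'a::real_vector set \<Rightarrow> (nat \<Rightarrow> 'a) \<Rightarrow> 'a set" where
  "Gamma_perp B u =
     {x \<in> span B. \<forall>f\<in>disk_dual B. summable (\<lambda>k. \<bar>f (u k)\<bar>) \<longrightarrow> f x = 0}"

text \<open>Here \<open>B0\<close> is meant to be a closed disk in whose normed space the series converges.\<close>

definition Gamma_perp_loc ::
    "'a::locally_convex_space set \<Rightarrow> (nat \<Rightarrow> 'a) \<Rightarrow> 'a set" where
  "Gamma_perp_loc B0 u =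
     (\<Union>B\<in>{B. absolutely_convex B \<and> tvs_bounded B \<and> B0 \<subseteq> B}. Gamma_perp B u)"

text \<open>Such a \<open>B0\<close> exists under the assumptions of the theorem, so quantifying over all of
  them there is not vacuous.\<close>

lemma ex_disk_series_converges:
  fixes u :: "nat \<Rightarrow> 'a::locally_convex_space"
  assumes "\<forall>s::nat \<Rightarrow> 'a. convergent s \<longrightarrow> converges_locally s" and "summable u"
  shows "\<exists>B0\<in>closed_disks. series_converges_in_disk B0 u"
  using assms unfolding summable_iff_convergent converges_locally_def series_converges_in_disk_def
  by blast

end

theory Submission
  imports Defs
begin

text \<open>Let \<open>S\<close> be the sum and \<open>x\<close> in the annihilator. By Hahn--Banach, \<open>2x\<close> is approximated in some
  \<open>E\<^sub>B\<close> by \<open>\<Sum>t\<^sub>k u\<^sub>k\<close> with \<open>\<bar>t\<^sub>k\<bar> \<le> 1\<close> over blocks of arbitrarily late indices. Rounding the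
  coefficients \<open>(1 + t\<^sub>k)/2\<close> to \<open>0\<close> or \<open>1\<close> gives an increasing sequence of finite index sets over
  which the sums tend to \<open>S + x\<close>, and the differences of consecutive sets are then ordered so that
  all partial sums stay small.

  Rounding and ordering both reduce to one statement: there is a larger disk \<open>D\<close> and a constant \<open>R\<close>
  such that every finite sequence in the unit ball of \<open>E\<^sub>B\<close>, of any length, has signs for which all
  prefix sums have gauge at most \<open>R\<close> in \<open>E\<^sub>D\<close>. Binary expansion of the coefficients yields the
  rounding; Chobanyan's argument (list the vectors of sign \<open>+\<close> in order, then those of sign \<open>-\<close>
  backwards) yields the ordering.

  The signs come from iterated pigeonhole. A composition of two nuclear embeddings passes through a
  Hilbert seminorm, which shows that the unit ball is covered by \<open>2 ^ O(k\<^sup>3)\<close> sets of diameter \<open>1/k\<close>;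
  composing further improves the diameter to any negative power of \<open>k\<close>. Hence among any \<open>O(k\<^sup>3)\<close>
  vectors some signed subset has a very small sum, and may be treated as a single new vector. Doing
  this in stages with \<open>k\<close> squared from one stage to the next produces a convergent series of
  errors.\<close>

subsection \<open>Seminorms\<close>

text \<open>The bound \<open>R\<close> must not depend on the number of vectors, and inside a single
  norm this fails: every signed sum of \<open>t\<close> orthonormal vectors has length
  \<open>sqrt t\<close>. Hence the passage to a larger disk, whose weaker gauge absorbs the loss.

  The factor in \<open>2x\<close> is undone by the coefficients \<open>(1 + t k) / 2\<close>: the
  first \<open>m\<close> terms plus half of the block \<open>{m..<n}\<close> give the mean of two
  late partial sums, which is close to \<open>S\<close>, and half of the combination with
  coefficients \<open>t k\<close> is close to \<open>x\<close>. Blocks may start as late as desired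
  because summability of \<open>\<bar>f (u k)\<bar>\<close> ignores finitely many terms.

  A gauge is a seminorm only on the span of its disk, whereas the combinatorial part works with
  seminorms on the whole space. Therefore one linear projection \<open>P\<close> onto
  \<open>span B\<close> is fixed, and \<open>B\<close> as well as every larger disk \<open>D\<close>
  enters through \<open>minkowski_gauge D (P x)\<close>.\<close>

definition seminorm :: "('a::real_vector \<Rightarrow> real) \<Rightarrow> bool" where
  "seminorm N \<longleftrightarrow> (\<forall>x y. N (x + y) \<le> N x + N y) \<and> (\<forall>c x. N (c *\<^sub>R x) = \<bar>c\<bar> * N x)"

lemma seminorm_add: "seminorm N \<Longrightarrow> N (x + y) \<le> N x + N y"
  and seminorm_scaleR: "seminorm N \<Longrightarrow> N (c *\<^sub>R x) = \<bar>c\<bar> * N x"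
  by (auto simp: seminorm_def)

lemma seminorm_zero: "seminorm N \<Longrightarrow> N 0 = 0"
  using seminorm_scaleR[of N 0 0] by simp

lemma seminorm_minus: "seminorm N \<Longrightarrow> N (- x) = N x"
  using seminorm_scaleR[of N "-1" x] by simp

lemma seminorm_diff: "seminorm N \<Longrightarrow> N (x - y) \<le> N x + N y"
  using seminorm_add[of N x "- y"] seminorm_minus[of N y] by simp

lemma seminorm_minus_commute: "seminorm N \<Longrightarrow> N (x - y) = N (y - x)"
  using seminorm_minus[of N "x - y"] by simp

lemma seminorm_nonneg: "seminorm N \<Longrightarrow> 0 \<le> N x"
  using seminorm_diff[of N x x] by (simp add: seminorm_zero)

lemma seminorm_sum:
  assumes "seminorm N"
  shows "N (\<Sum>i\<in>A. f i) \<le> (\<Sum>i\<in>A. N (f i))"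
proof (induction A rule: infinite_finite_induct)
  case (insert a A)
  then show ?case using seminorm_add[OF assms, of "f a" "sum f A"] by simp
qed (simp_all add: seminorm_zero[OF assms])

lemma seminorm_sum_le:
  assumes "seminorm N" "\<And>i. i \<in> A \<Longrightarrow> N (f i) \<le> b"
  shows "N (\<Sum>i\<in>A. f i) \<le> real (card A) * b"
proof -
  have "N (\<Sum>i\<in>A. f i) \<le> (\<Sum>i\<in>A. N (f i))" by (rule seminorm_sum[OF assms(1)])
  also have "\<dots> \<le> real (card A) * b" using assms(2) by (intro sum_bounded_above) auto
  finally show ?thesis .
qed

subsection \<open>Hahn--Banach\<close>

definition sublinear :: "('a::real_vector \<Rightarrow> real) \<Rightarrow> bool" where
  "sublinear p \<longleftrightarrow> (\<forall>x y. p (x + y) \<le> p x + p y) \<and> (\<forall>c x. c \<ge> 0 \<longrightarrow> p (c *\<^sub>R x) = c * p x)"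

lemma sublinear_add: "sublinear p \<Longrightarrow> p (x + y) \<le> p x + p y"
  and sublinear_scaleR: "sublinear p \<Longrightarrow> c \<ge> 0 \<Longrightarrow> p (c *\<^sub>R x) = c * p x"
  by (auto simp: sublinear_def)

lemma sublinear_zero: "sublinear p \<Longrightarrow> p 0 = 0"
  using sublinear_scaleR[of p 0 0] by simp

lemma sublinear_minus: "sublinear p \<Longrightarrow> - p (- x) \<le> p x"
  using sublinear_add[of p x "- x"] by (simp add: sublinear_zero)

text \<open>Lowers \<open>p\<close> as far as needed in the direction \<open>- a\<close>. A minimal
  sublinear function equals all its own shifts and is therefore odd, hence linear. Conversely, any
  linear function below the shift of \<open>p\<close> is forced to take the value \<open>p a\<close>
  at \<open>a\<close>.\<close>

lemma sublinear_INF_shift: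
  fixes p :: "'a::real_vector \<Rightarrow> real" and a y :: 'a
  assumes p: "sublinear p"
  defines "q \<equiv> \<lambda>y. INF t\<in>{0..}. p (y + t *\<^sub>R a) - t * p a"
  shows "sublinear q" and "q y \<le> p y" and "q (- a) \<le> - p a"
proof -
  \<comment> \<open>This bound makes the infimum genuine; the real infimum of a set unbounded below
    would be meaningless.\<close>
  have lower: "- p (- y) \<le> p (y + t *\<^sub>R a) - t * p a" if "t \<ge> 0" for y t
  proof -
    have "t * p a = p ((y + t *\<^sub>R a) + (- y))" using sublinear_scaleR[OF p that, of a] by simp
    also have "\<dots> \<le> p (y + t *\<^sub>R a) + p (- y)" by (rule sublinear_add[OF p])
    finally show ?thesis by simp
  qed
  have bdd: "bdd_below ((\<lambda>t. p (y + t *\<^sub>R a) - t * p a) ` {0..})" for y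
    using lower[of _ y] by (intro bdd_belowI2[of _ "- p (- y)"]) auto
  have le: "q y \<le> p (y + t *\<^sub>R a) - t * p a" if "t \<ge> 0" for y t
    unfolding q_def using that by (intro cINF_lower bdd) auto
  have ge: "b \<le> q y" if "\<And>t. t \<ge> 0 \<Longrightarrow> b \<le> p (y + t *\<^sub>R a) - t * p a" for b y
    unfolding q_def using that by (intro cINF_greatest) auto
  show "q y \<le> p y" using le[of 0 y] by simp
  show "q (- a) \<le> - p a" using le[of 1 "- a"] by (simp add: sublinear_zero[OF p])
  have scale: "c * q x \<le> q (c *\<^sub>R x)" if "c > 0" for c x
  proof (rule ge)
    fix t :: real assume "t \<ge> 0"
    have "c * q x \<le> c * (p (x + (t / c) *\<^sub>R a) - (t / c) * p a)"
      using le[of "t / c" x] \<open>t \<ge> 0\<close> that by (intro mult_left_mono) auto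
    also have "\<dots> = p (c *\<^sub>R (x + (t / c) *\<^sub>R a)) - t * p a"
      using that by (simp add: sublinear_scaleR[OF p] right_diff_distrib)
    also have "c *\<^sub>R (x + (t / c) *\<^sub>R a) = c *\<^sub>R x + t *\<^sub>R a"
      using that by (simp add: algebra_simps)
    finally show "c * q x \<le> p (c *\<^sub>R x + t *\<^sub>R a) - t * p a" .
  qed
  have q0: "q 0 = 0"
  proof (rule antisym)
    show "q 0 \<le> 0" using le[of 0 0] by (simp add: sublinear_zero[OF p])
    show "0 \<le> q 0" by (rule ge) (simp add: sublinear_scaleR[OF p])
  qed
  have "q (c *\<^sub>R x) = c * q x" if "c \<ge> 0" for c x
  proof (cases "c = 0")
    case False
    then have "c > 0" using that by simp
    with scale[of "1/c" "c *\<^sub>R x"] have "q (c *\<^sub>R x) \<le> c * q x" by (simp add: field_simps)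
    with scale[OF \<open>c > 0\<close>, of x] show ?thesis by simp
  qed (simp add: q0)
  moreover have "q (x + y) \<le> q x + q y" for x y
  proof -
    have 1: "q (x + y) \<le> (p (x + s *\<^sub>R a) - s * p a) + (p (y + t *\<^sub>R a) - t * p a)"
      if "s \<ge> 0" "t \<ge> 0" for s t
      using le[of "s + t" "x + y"] sublinear_add[OF p, of "x + s *\<^sub>R a" "y + t *\<^sub>R a"] that
      by (simp add: algebra_simps)
    have "q (x + y) - (p (x + s *\<^sub>R a) - s * p a) \<le> q y" if "s \<ge> 0" for s
      by (rule ge) (use 1[OF that] in force)
    then have "q (x + y) - q y \<le> q x" by (intro ge) force
    then show ?thesis by simp
  qed
  ultimately show "sublinear q" by (simp add: sublinear_def)
qed

text \<open>All members lie above \<open>- p (- y)\<close>, so the infimum is finite. Subadditivity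
  is where the chain enters: two members have a common lower one, to which the triangle inequality
  applies.\<close>

lemma sublinear_Inf_chain:
  fixes C :: "('a::real_vector \<Rightarrow> real) set"
  assumes "C \<noteq> {}" and sub: "\<And>q. q \<in> C \<Longrightarrow> sublinear q" and dom: "\<And>q y. q \<in> C \<Longrightarrow> q y \<le> p y"
    and chain: "\<And>q r. q \<in> C \<Longrightarrow> r \<in> C \<Longrightarrow> q \<le> r \<or> r \<le> q"
  defines "u \<equiv> \<lambda>y. INF q\<in>C. q y"
  shows "sublinear u" and "\<And>q. q \<in> C \<Longrightarrow> u \<le> q"
proof -
  have lower: "- p (- y) \<le> q y" if "q \<in> C" for q y
    using sublinear_minus[OF sub[OF that], of y] dom[OF that, of "- y"] by simp
  have bdd: "bdd_below ((\<lambda>q. q y) ` C)" for y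
    using lower[of _ y] by (intro bdd_belowI2[of _ "- p (- y)"]) auto
  have le: "u y \<le> q y" if "q \<in> C" for q y
    unfolding u_def by (intro cINF_lower bdd that)
  have ge: "b \<le> u y" if "\<And>q. q \<in> C \<Longrightarrow> b \<le> q y" for b y
    unfolding u_def by (intro cINF_greatest that \<open>C \<noteq> {}\<close>)
  show "u \<le> q" if "q \<in> C" for q using le[OF that] by (simp add: le_fun_def)
  have u0: "u 0 = 0"
    using \<open>C \<noteq> {}\<close> sub by (simp add: u_def sublinear_zero cong: INF_cong)
  have scale: "c * u x \<le> u (c *\<^sub>R x)" if "c \<ge> 0" for c x
    using le sub that by (intro ge) (auto simp: sublinear_scaleR intro!: mult_left_mono)
  have "u (c *\<^sub>R x) = c * u x" if "c \<ge> 0" for c x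
  proof (cases "c = 0")
    case False
    then have "c > 0" using that by simp
    with scale[of "1/c" "c *\<^sub>R x"] have "u (c *\<^sub>R x) \<le> c * u x" by (simp add: field_simps)
    with scale[OF that, of x] show ?thesis by simp
  qed (simp add: u0)
  moreover have "u (x + y) \<le> u x + u y" for x y
  proof -
    have 1: "u (x + y) \<le> q x + r y" if qr: "q \<in> C" "r \<in> C" for q r
    proof -
      obtain s where "s \<in> C" "s \<le> q" "s \<le> r" using chain[OF qr] qr by blast
      then have "u (x + y) \<le> s x + s y"
        using le[of s "x + y"] sublinear_add[OF sub, of s x y] by simp
      also have "\<dots> \<le> q x + r y" using \<open>s \<le> q\<close> \<open>s \<le> r\<close> by (simp add: add_mono le_fun_def)
      finally show ?thesis .
    qed
    have "u (x + y) - q x \<le> u y" if "q \<in> C" for q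
      by (rule ge) (use 1[OF that] in force)
    then have "u (x + y) - u y \<le> u x" by (intro ge) force
    then show ?thesis by simp
  qed
  ultimately show "sublinear u" by (simp add: sublinear_def)
qed

text \<open>Zorn's lemma is applied to the sublinear functions below \<open>p\<close> with the order
  reversed, rather than to partial linear extensions; linearity then comes from minimality.\<close>

lemma linear_below_sublinear:
  fixes p :: "'a::real_vector \<Rightarrow> real"
  assumes p: "sublinear p"
  shows "\<exists>f. linear f \<and> (\<forall>y. f y \<le> p y)"
proof -
  define A where "A = {q. sublinear q \<and> (\<forall>y. q y \<le> p y)}"
  have "\<exists>m\<in>A. \<forall>a\<in>A. a \<le> m \<longrightarrow> a = m"
  proof (rule predicate_Zorn)
    show "partial_order_on A (relation_of (\<lambda>x y. y \<le> x) A)"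
      by (rule partial_order_on_relation_ofI) auto
    fix C assume C: "C \<in> Chains (relation_of (\<lambda>x y. y \<le> x) A)"
    then have CA: "q \<in> A" if "q \<in> C" for q
      using that by (auto simp: Chains_def relation_of_def)
    show "\<exists>u\<in>A. \<forall>a\<in>C. u \<le> a"
    proof (cases "C = {}")
      case True
      then show ?thesis using p by (auto simp: A_def)
    next
      case False
      have ch: "q \<le> r \<or> r \<le> q" if "q \<in> C" "r \<in> C" for q r
        using C that by (auto simp: Chains_def relation_of_def)
      have sub: "\<And>q. q \<in> C \<Longrightarrow> sublinear q" and dom: "\<And>q y. q \<in> C \<Longrightarrow> q y \<le> p y"
        using CA by (auto simp: A_def)
      let ?u = "\<lambda>y. INF q\<in>C. q y"
      have u: "sublinear ?u" "\<And>q. q \<in> C \<Longrightarrow> ?u \<le> q"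
        using sublinear_Inf_chain[of C p] False sub dom ch by blast+
      obtain q where "q \<in> C" using False by blast
      then have "?u y \<le> p y" for y
        using u(2)[of q] dom[of q y] by (meson le_funD order_trans)
      then have "?u \<in> A" using u(1) by (simp add: A_def)
      then show ?thesis using u(2) by blast
    qed
  qed
  then obtain m where m: "m \<in> A" and min: "\<And>a. a \<in> A \<Longrightarrow> a \<le> m \<Longrightarrow> a = m" by blast
  have sm: "sublinear m" and mp: "\<And>y. m y \<le> p y" using m by (auto simp: A_def)
  have neg: "m (- a) = - m a" for a
  proof -
    let ?q = "\<lambda>y. INF t\<in>{0..}. m (y + t *\<^sub>R a) - t * m a"
    note q = sublinear_INF_shift[OF sm, where a = a]
    have "?q \<in> A" using q(1,2) mp by (force simp: A_def intro: order_trans)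
    then have "?q = m" by (rule min) (simp add: le_fun_def q(2))
    then have "?q (- a) = m (- a)" by (rule fun_cong)
    then have "m (- a) \<le> - m a" using q(3) by linarith
    then show ?thesis using sublinear_minus[OF sm, of a] by simp
  qed
  have "linear m"
  proof (rule linearI)
    show "m (x + y) = m x + m y" for x y
      using sublinear_add[OF sm, of x y] sublinear_add[OF sm, of "- x" "- y"] neg[of "x + y"] neg[of x] neg[of y]
      by simp
    show "m (c *\<^sub>R x) = c *\<^sub>R m x" for c x
      using sublinear_scaleR[OF sm, of c x] sublinear_scaleR[OF sm, of "- c" x] neg[of "c *\<^sub>R x"]
      by (cases "c \<ge> 0") auto
  qed
  then show ?thesis using mp by blast
qed

lemma hahn_banach_sublinear:
  fixes p :: "'a::real_vector \<Rightarrow> real"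
  assumes p: "sublinear p"
  shows "\<exists>f. linear f \<and> (\<forall>y. f y \<le> p y) \<and> f a = p a"
proof -
  note q = sublinear_INF_shift[OF p, where a = a]
  obtain f where f: "linear f" "\<And>y. f y \<le> (INF t\<in>{0..}. p (y + t *\<^sub>R a) - t * p a)"
    using linear_below_sublinear[OF q(1)] by blast
  have "f y \<le> p y" for y using f(2) q(2) by (rule order_trans)
  moreover have "p a \<le> f a" using f(2)[of "- a"] q(3) linear_neg[OF f(1), of a] by linarith
  ultimately show ?thesis using f(1) by (meson antisym)
qed

subsection \<open>Covering numbers\<close>

text \<open>Cells have bounded diameter and no centres: the pigeonhole argument only needs that two
  points share a cell.\<close>

definition covers_ball ::
    "('a::real_vector \<Rightarrow> real) \<Rightarrow> ('a \<Rightarrow> real) \<Rightarrow> nat \<Rightarrow> real \<Rightarrow> bool" where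
  "covers_ball N0 N1 n \<epsilon> \<longleftrightarrow> (\<exists>\<C>. finite \<C> \<and> card \<C> \<le> n \<and> {x. N0 x \<le> 1} \<subseteq> \<Union>\<C> \<and>
     (\<forall>C\<in>\<C>. \<forall>x\<in>C. \<forall>y\<in>C. N1 (x - y) \<le> \<epsilon>))"

text \<open>A cell translated by one of its points and divided by \<open>\<epsilon>\<close> lies in
  the unit ball of \<open>N1\<close>, which the second cover subdivides. Exponents of the cell
  counts add while diameters multiply, so a higher power of \<open>1 / k\<close> costs only a larger
  constant in \<open>2 ^ (C * k ^ 3)\<close>.\<close>

lemma covers_ball_comp:
  assumes N1: "seminorm N1" and N2: "seminorm N2"
    and 1: "covers_ball N0 N1 n \<epsilon>" and 2: "covers_ball N1 N2 m \<delta>" and "\<epsilon> > 0"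
  shows "covers_ball N0 N2 (n * m) (\<epsilon> * \<delta>)"
proof -
  obtain \<C> where C: "finite \<C>" "card \<C> \<le> n" "{x. N0 x \<le> 1} \<subseteq> \<Union>\<C>"
    and Cd: "\<And>C x y. C \<in> \<C> \<Longrightarrow> x \<in> C \<Longrightarrow> y \<in> C \<Longrightarrow> N1 (x - y) \<le> \<epsilon>"
    using 1 unfolding covers_ball_def by blast
  obtain \<D> where D: "finite \<D>" "card \<D> \<le> m" "{x. N1 x \<le> 1} \<subseteq> \<Union>\<D>"
    and Dd: "\<And>C x y. C \<in> \<D> \<Longrightarrow> x \<in> C \<Longrightarrow> y \<in> C \<Longrightarrow> N2 (x - y) \<le> \<delta>"
    using 2 unfolding covers_ball_def by blast
  \<comment> \<open>Arbitrary for an empty cell; it is used only for cells known to have a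
    point.\<close>
  define c where "c C = (SOME x. x \<in> C)" for C :: "'a set"
  have c: "c C \<in> C" if "x \<in> C" for x C using that unfolding c_def by (rule someI)
  define F where "F = (\<lambda>(C, D). {x \<in> C. (1 / \<epsilon>) *\<^sub>R (x - c C) \<in> D})"
  show ?thesis unfolding covers_ball_def
  proof (intro exI[of _ "F ` (\<C> \<times> \<D>)"] conjI)
    show "finite (F ` (\<C> \<times> \<D>))" using C(1) D(1) by blast
    have "card (F ` (\<C> \<times> \<D>)) \<le> card (\<C> \<times> \<D>)" using C(1) D(1) by (intro card_image_le) blast
    also have "\<dots> \<le> n * m" using C(2) D(2) by (simp add: card_cartesian_product mult_mono)
    finally show "card (F ` (\<C> \<times> \<D>)) \<le> n * m" .
    show "{x. N0 x \<le> 1} \<subseteq> \<Union> (F ` (\<C> \<times> \<D>))"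
    proof
      fix x assume "x \<in> {x. N0 x \<le> 1}"
      then obtain A where A: "A \<in> \<C>" "x \<in> A" using C(3) by blast
      have "N1 (x - c A) \<le> \<epsilon>" by (rule Cd[OF A c[OF A(2)]])
      then have "N1 ((1 / \<epsilon>) *\<^sub>R (x - c A)) \<le> 1"
        using \<open>\<epsilon> > 0\<close> by (simp add: seminorm_scaleR[OF N1])
      then obtain D where "D \<in> \<D>" "(1 / \<epsilon>) *\<^sub>R (x - c A) \<in> D" using D(3) by blast
      then show "x \<in> \<Union> (F ` (\<C> \<times> \<D>))" using A by (force simp: F_def)
    qed
    show "\<forall>C\<in>F ` (\<C> \<times> \<D>). \<forall>x\<in>C. \<forall>y\<in>C. N2 (x - y) \<le> \<epsilon> * \<delta>"
    proof (intro ballI)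
      fix E x y assume "E \<in> F ` (\<C> \<times> \<D>)" "x \<in> E" "y \<in> E"
      then obtain A D where D: "D \<in> \<D>" "(1 / \<epsilon>) *\<^sub>R (x - c A) \<in> D" "(1 / \<epsilon>) *\<^sub>R (y - c A) \<in> D"
        by (auto simp: F_def)
      have "N2 (\<epsilon> *\<^sub>R ((1 / \<epsilon>) *\<^sub>R (x - c A) - (1 / \<epsilon>) *\<^sub>R (y - c A))) \<le> \<epsilon> * \<delta>"
        using Dd[OF D] \<open>\<epsilon> > 0\<close> by (simp add: seminorm_scaleR[OF N2])
      also have "\<epsilon> *\<^sub>R ((1 / \<epsilon>) *\<^sub>R (x - c A) - (1 / \<epsilon>) *\<^sub>R (y - c A)) = x - y"
        using \<open>\<epsilon> > 0\<close> by (simp add: scaleR_right_diff_distrib)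
      finally show "N2 (x - y) \<le> \<epsilon> * \<delta>" .
    qed
  qed
qed

subsection \<open>Signs with bounded prefix sums\<close>

text \<open>Pigeonhole: two different subset sums fall into the same cell of the cover.\<close>

lemma small_signed_subset_sum:
  fixes x :: "nat \<Rightarrow> 'a::real_vector" and M \<epsilon> :: real
  assumes N0: "seminorm N0" and N1: "seminorm N1" and cov: "covers_ball N0 N1 n \<epsilon>"
    and "n < 2 ^ card I" "finite I" "I \<noteq> {}" "M > 0" and x: "\<And>i. i \<in> I \<Longrightarrow> N0 (x i) \<le> M"
  shows "\<exists>S \<eta>. S \<subseteq> I \<and> S \<noteq> {} \<and> (\<forall>i. \<bar>\<eta> i\<bar> = (1::real)) \<and>
    N0 (\<Sum>i\<in>S. \<eta> i *\<^sub>R x i) \<le> real (card I) * M \<and>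
    N1 (\<Sum>i\<in>S. \<eta> i *\<^sub>R x i) \<le> real (card I) * M * \<epsilon>"
proof -
  obtain \<C> where C: "finite \<C>" "card \<C> \<le> n" "{x. N0 x \<le> 1} \<subseteq> \<Union>\<C>"
    and Cd: "\<And>C x y. C \<in> \<C> \<Longrightarrow> x \<in> C \<Longrightarrow> y \<in> C \<Longrightarrow> N1 (x - y) \<le> \<epsilon>"
    using cov unfolding covers_ball_def by blast
  define q where "q = real (card I) * M"
  have q: "q > 0" unfolding q_def using assms by (simp add: card_gt_0_iff)
  have bound: "N0 (\<Sum>i\<in>S. \<eta> i *\<^sub>R x i) \<le> q" if "S \<subseteq> I" "\<And>i. \<bar>\<eta> i\<bar> = 1" for S and \<eta> :: "nat \<Rightarrow> real"
  proof -
    have "N0 (\<Sum>i\<in>S. \<eta> i *\<^sub>R x i) \<le> real (card S) * M"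
      using that x by (intro seminorm_sum_le[OF N0]) (auto simp: seminorm_scaleR[OF N0])
    also have "\<dots> \<le> q" unfolding q_def
      using \<open>M > 0\<close> card_mono[OF \<open>finite I\<close> that(1)] by (intro mult_right_mono) auto
    finally show ?thesis .
  qed
  \<comment> \<open>Division by \<open>q\<close> brings all subset sums into the unit ball of
    \<open>N0\<close>, the set that is covered.\<close>
  define y where "y S = (1 / q) *\<^sub>R (\<Sum>i\<in>S. x i)" for S
  have "N0 (y S) \<le> 1" if "S \<subseteq> I" for S
    using bound[OF that, of "\<lambda>_. 1"] q by (simp add: y_def seminorm_scaleR[OF N0])
  then have "\<forall>S\<in>Pow I. \<exists>C\<in>\<C>. y S \<in> C" using C(3) by blast
  then obtain cell where cell: "\<And>S. S \<subseteq> I \<Longrightarrow> cell S \<in> \<C> \<and> y S \<in> cell S"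
    by (metis PowI)
  have "card (cell ` Pow I) \<le> card \<C>" using cell C(1) by (intro card_mono) auto
  also have "\<dots> < card (Pow I)" using C(2) assms by (simp add: card_Pow)
  finally have "\<not> inj_on cell (Pow I)" by (rule pigeonhole)
  then obtain S T where ST: "S \<subseteq> I" "T \<subseteq> I" "S \<noteq> T" "cell S = cell T"
    by (auto simp: inj_on_def)
  have fin: "finite S" "finite T" using ST \<open>finite I\<close> finite_subset by blast+
  \<comment> \<open>Terms common to \<open>S\<close> and \<open>T\<close> cancel in the difference
    of the two subset sums. What survives is a signed sum over the symmetric difference, nonempty
    because \<open>S\<close> and \<open>T\<close> differ.\<close>
  define \<eta> :: "nat \<Rightarrow> real" where "\<eta> i = (if i \<in> S then 1 else - 1)" for i
  define U where "U = (S - T) \<union> (T - S)"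
  have "(\<Sum>i\<in>U. \<eta> i *\<^sub>R x i) = (\<Sum>i\<in>S - T. \<eta> i *\<^sub>R x i) + (\<Sum>i\<in>T - S. \<eta> i *\<^sub>R x i)"
    unfolding U_def using fin by (intro sum.union_disjoint) auto
  also have "\<dots> = (\<Sum>i\<in>S - T. x i) - (\<Sum>i\<in>T - S. x i)"
    by (simp add: \<eta>_def sum_negf)
  also have "\<dots> = (\<Sum>i\<in>S. x i) - (\<Sum>i\<in>T. x i)"
    using sum.Int_Diff[OF fin(1), of x T] sum.Int_Diff[OF fin(2), of x S] by (simp add: Int_commute)
  finally have eq: "(\<Sum>i\<in>U. \<eta> i *\<^sub>R x i) = q *\<^sub>R (y S - y T)"
    using q by (simp add: y_def scaleR_right_diff_distrib)
  have "N1 (y S - y T) \<le> \<epsilon>" using cell[OF ST(1)] cell[OF ST(2)] ST(4) by (intro Cd) auto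
  then have "N1 (\<Sum>i\<in>U. \<eta> i *\<^sub>R x i) \<le> q * \<epsilon>"
    using q by (simp add: eq seminorm_scaleR[OF N1])
  moreover have "U \<subseteq> I" "U \<noteq> {}" using ST by (auto simp: U_def)
  moreover have "\<bar>\<eta> i\<bar> = 1" for i by (simp add: \<eta>_def)
  ultimately show ?thesis using bound[of U \<eta>] unfolding q_def by blast
qed

text \<open>Reading the vectors one at a time, a set \<open>I\<close> of fewer than \<open>m\<close> of them is kept waiting;
  whenever it reaches size \<open>m\<close>, a signed subset with small sum is merged into a single vector
  \<open>z l\<close>. Signs for the merged vectors then induce signs for the original ones.\<close>

lemma group_signed_vectors:
  fixes x :: "nat \<Rightarrow> 'a::real_vector" and M d \<epsilon> :: real
  assumes N0: "seminorm N0" and N1: "seminorm N1" and cov: "covers_ball N0 N1 n \<epsilon>"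
    and "n < 2 ^ m" "m > 0" "M > 0" "d \<ge> 0"
    and x0: "\<forall>i<t. N0 (x i) \<le> M" and x1: "\<forall>i<t. N1 (x i) \<le> d"
  shows "\<exists>p z I. p \<le> t \<and> (\<forall>l<p. N0 (z l) \<le> m * M \<and> N1 (z l) \<le> m * M * \<epsilon>) \<and>
     I \<subseteq> {..<t} \<and> card I < m \<and>
     (\<forall>\<rho> \<tau>. (\<forall>i. \<bar>\<rho> i\<bar> = (1::real)) \<longrightarrow> (\<forall>i. \<bar>\<tau> i\<bar> = (1::real)) \<longrightarrow>
       (\<exists>\<sigma>. (\<forall>i. \<bar>\<sigma> i\<bar> = (1::real)) \<and>
          (\<forall>s\<le>t. \<exists>r\<le>p. N1 ((\<Sum>i<s. \<sigma> i *\<^sub>R x i) - (\<Sum>l<r. \<rho> l *\<^sub>R z l)) \<le> m * d) \<and>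
          (\<Sum>i<t. \<sigma> i *\<^sub>R x i) = (\<Sum>l<p. \<rho> l *\<^sub>R z l) + (\<Sum>i\<in>I. \<tau> i *\<^sub>R x i)))"
  using x0 x1
\<comment> \<open>The grouping is fixed before the signs: \<open>\<rho>\<close> is supplied only by
  the next stage, and a waiting vector may still be merged later. Hence both sign functions are
  quantified inside the induction statement.\<close>
proof (induction t)
  case 0
  show ?case
    by (rule exI[of _ 0], rule exI[of _ "\<lambda>_. 0"], rule exI[of _ "{}"])
      (use \<open>m > 0\<close> \<open>d \<ge> 0\<close> in \<open>auto simp: seminorm_zero[OF N1]\<close>)
next
  case (Suc t)
  have "\<exists>p z I. p \<le> t \<and> (\<forall>l<p. N0 (z l) \<le> m * M \<and> N1 (z l) \<le> m * M * \<epsilon>) \<and>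
     I \<subseteq> {..<t} \<and> card I < m \<and>
     (\<forall>\<rho> \<tau>. (\<forall>i. \<bar>\<rho> i\<bar> = (1::real)) \<longrightarrow> (\<forall>i. \<bar>\<tau> i\<bar> = (1::real)) \<longrightarrow>
       (\<exists>\<sigma>. (\<forall>i. \<bar>\<sigma> i\<bar> = (1::real)) \<and>
          (\<forall>s\<le>t. \<exists>r\<le>p. N1 ((\<Sum>i<s. \<sigma> i *\<^sub>R x i) - (\<Sum>l<r. \<rho> l *\<^sub>R z l)) \<le> m * d) \<and>
          (\<Sum>i<t. \<sigma> i *\<^sub>R x i) = (\<Sum>l<p. \<rho> l *\<^sub>R z l) + (\<Sum>i\<in>I. \<tau> i *\<^sub>R x i)))"
    by (rule Suc.IH) (use Suc.prems in auto)
  then obtain p z I where p: "p \<le> t"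
    and z: "\<forall>l<p. N0 (z l) \<le> m * M \<and> N1 (z l) \<le> m * M * \<epsilon>"
    and I: "I \<subseteq> {..<t}" "card I < m"
    and sgn: "\<forall>\<rho> \<tau>. (\<forall>i. \<bar>\<rho> i\<bar> = (1::real)) \<longrightarrow> (\<forall>i. \<bar>\<tau> i\<bar> = (1::real)) \<longrightarrow>
       (\<exists>\<sigma>. (\<forall>i. \<bar>\<sigma> i\<bar> = (1::real)) \<and>
          (\<forall>s\<le>t. \<exists>r\<le>p. N1 ((\<Sum>i<s. \<sigma> i *\<^sub>R x i) - (\<Sum>l<r. \<rho> l *\<^sub>R z l)) \<le> m * d) \<and>
          (\<Sum>i<t. \<sigma> i *\<^sub>R x i) = (\<Sum>l<p. \<rho> l *\<^sub>R z l) + (\<Sum>i\<in>I. \<tau> i *\<^sub>R x i))"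
    by (elim exE conjE) (rule that; assumption)
  have finI: "finite I" using I(1) finite_subset by blast
  define J where "J = insert t I"
  have tI: "t \<notin> I" using I(1) by auto
  have J: "J \<subseteq> {..<Suc t}" "finite J" "card J = Suc (card I)" "J \<noteq> {}"
    unfolding J_def using I(1) finI tI by auto
  have small: "N1 (\<Sum>i\<in>I'. \<tau> i *\<^sub>R x i) \<le> m * d"
    if "I' \<subseteq> J" "\<And>i. \<bar>\<tau> i\<bar> = 1" for I' and \<tau> :: "nat \<Rightarrow> real"
  proof -
    have "N1 (\<Sum>i\<in>I'. \<tau> i *\<^sub>R x i) \<le> real (card I') * d"
      using that J(1) Suc.prems(2)
      by (intro seminorm_sum_le[OF N1]) (auto simp: seminorm_scaleR[OF N1])
    also have "card I' \<le> m" using card_mono[OF J(2) that(1)] J(3) I(2) by simp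
    finally show ?thesis using \<open>d \<ge> 0\<close> by (simp add: mult_right_mono)
  qed
  have extend: "\<exists>\<sigma>. (\<forall>i. \<bar>\<sigma> i\<bar> = (1::real)) \<and>
      (\<forall>s\<le>t. \<exists>r\<le>p. N1 ((\<Sum>i<s. \<sigma> i *\<^sub>R x i) - (\<Sum>l<r. \<rho> l *\<^sub>R z l)) \<le> m * d) \<and>
      (\<Sum>i<Suc t. \<sigma> i *\<^sub>R x i) = (\<Sum>l<p. \<rho> l *\<^sub>R z l) + (\<Sum>i\<in>J. \<tau> i *\<^sub>R x i)"
    if signs: "\<forall>i. \<bar>\<rho> i\<bar> = (1::real)" "\<forall>i. \<bar>\<tau> i\<bar> = (1::real)" for \<rho> \<tau>
  proof -
    obtain \<sigma> where \<sigma>: "\<forall>i. \<bar>\<sigma> i\<bar> = (1::real)"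
      "\<forall>s\<le>t. \<exists>r\<le>p. N1 ((\<Sum>i<s. \<sigma> i *\<^sub>R x i) - (\<Sum>l<r. \<rho> l *\<^sub>R z l)) \<le> m * d"
      "(\<Sum>i<t. \<sigma> i *\<^sub>R x i) = (\<Sum>l<p. \<rho> l *\<^sub>R z l) + (\<Sum>i\<in>I. \<tau> i *\<^sub>R x i)"
      using sgn signs by blast
    have eq: "(\<Sum>i<s. (\<sigma>(t := \<tau> t)) i *\<^sub>R x i) = (\<Sum>i<s. \<sigma> i *\<^sub>R x i)" if "s \<le> t" for s
      using that by (intro sum.cong) auto
    show ?thesis
    proof (intro exI[of _ "\<sigma>(t := \<tau> t)"] conjI)
      show "\<forall>i. \<bar>(\<sigma>(t := \<tau> t)) i\<bar> = 1" using \<sigma>(1) signs by simp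
      show "\<forall>s\<le>t. \<exists>r\<le>p. N1 ((\<Sum>i<s. (\<sigma>(t := \<tau> t)) i *\<^sub>R x i) - (\<Sum>l<r. \<rho> l *\<^sub>R z l)) \<le> m * d"
        using \<sigma>(2) eq by simp
      show "(\<Sum>i<Suc t. (\<sigma>(t := \<tau> t)) i *\<^sub>R x i) = (\<Sum>l<p. \<rho> l *\<^sub>R z l) + (\<Sum>i\<in>J. \<tau> i *\<^sub>R x i)"
        unfolding sum.lessThan_Suc eq[OF order_refl] \<sigma>(3) J_def
        using tI finI by simp
    qed
  qed
  show ?case
  proof (cases "card J < m")
    case True
    show ?thesis
    proof (intro exI[of _ p] exI[of _ z] exI[of _ J] conjI allI impI)
      fix \<rho> \<tau> :: "nat \<Rightarrow> real" assume *: "\<forall>i. \<bar>\<rho> i\<bar> = 1" "\<forall>i. \<bar>\<tau> i\<bar> = 1"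
      then obtain \<sigma> where \<sigma>: "\<forall>i. \<bar>\<sigma> i\<bar> = (1::real)"
        "\<forall>s\<le>t. \<exists>r\<le>p. N1 ((\<Sum>i<s. \<sigma> i *\<^sub>R x i) - (\<Sum>l<r. \<rho> l *\<^sub>R z l)) \<le> m * d"
        "(\<Sum>i<Suc t. \<sigma> i *\<^sub>R x i) = (\<Sum>l<p. \<rho> l *\<^sub>R z l) + (\<Sum>i\<in>J. \<tau> i *\<^sub>R x i)"
        using extend[OF *] by blast
      \<comment> \<open>A prefix differs from a prefix of merged vectors only by the vectors then
        waiting, at most \<open>m\<close> of them, each of \<open>N1\<close> at most
        \<open>d\<close>.\<close>
      have "N1 ((\<Sum>i<Suc t. \<sigma> i *\<^sub>R x i) - (\<Sum>l<p. \<rho> l *\<^sub>R z l)) \<le> m * d"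
        unfolding \<sigma>(3) using small[of J \<tau>] * by simp
      then have "\<forall>s\<le>Suc t. \<exists>r\<le>p. N1 ((\<Sum>i<s. \<sigma> i *\<^sub>R x i) - (\<Sum>l<r. \<rho> l *\<^sub>R z l)) \<le> m * d"
        using \<sigma>(2) by (metis le_Suc_eq order_refl)
      then show "\<exists>\<sigma>. (\<forall>i. \<bar>\<sigma> i\<bar> = (1::real)) \<and>
          (\<forall>s\<le>Suc t. \<exists>r\<le>p. N1 ((\<Sum>i<s. \<sigma> i *\<^sub>R x i) - (\<Sum>l<r. \<rho> l *\<^sub>R z l)) \<le> m * d) \<and>
          (\<Sum>i<Suc t. \<sigma> i *\<^sub>R x i) = (\<Sum>l<p. \<rho> l *\<^sub>R z l) + (\<Sum>i\<in>J. \<tau> i *\<^sub>R x i)"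
        using \<sigma>(1,3) by blast
    qed (use p z J True in auto)
  next
    case False
    then have Jm: "card J = m" using J(3) I(2) by simp
    obtain S \<eta> where S: "S \<subseteq> J" "S \<noteq> {}" and \<eta>: "\<forall>i. \<bar>\<eta> i\<bar> = (1::real)"
      and zp: "N0 (\<Sum>i\<in>S. \<eta> i *\<^sub>R x i) \<le> m * M" "N1 (\<Sum>i\<in>S. \<eta> i *\<^sub>R x i) \<le> m * M * \<epsilon>"
      using small_signed_subset_sum[OF N0 N1 cov, of J M x] Jm J Suc.prems(1) assms by blast
    define z' where "z' = z(p := \<Sum>i\<in>S. \<eta> i *\<^sub>R x i)"
    have z': "N0 (z' l) \<le> m * M \<and> N1 (z' l) \<le> m * M * \<epsilon>" if "l < Suc p" for l
      using that z zp by (auto simp: z'_def less_Suc_eq)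
    have zz: "(\<Sum>l<r. \<rho> l *\<^sub>R z' l) = (\<Sum>l<r. \<rho> l *\<^sub>R z l)" if "r \<le> p" for r and \<rho> :: "nat \<Rightarrow> real"
      using that by (intro sum.cong) (auto simp: z'_def)
    have "card (J - S) < m"
      using S Jm J(2) by (metis Diff_subset card_seteq finite_Diff leI psubset_imp_ex_mem Diff_iff equals0I subsetD)
    moreover have "\<exists>\<sigma>. (\<forall>i. \<bar>\<sigma> i\<bar> = (1::real)) \<and>
          (\<forall>s\<le>Suc t. \<exists>r\<le>Suc p. N1 ((\<Sum>i<s. \<sigma> i *\<^sub>R x i) - (\<Sum>l<r. \<rho> l *\<^sub>R z' l)) \<le> m * d) \<and>
          (\<Sum>i<Suc t. \<sigma> i *\<^sub>R x i) = (\<Sum>l<Suc p. \<rho> l *\<^sub>R z' l) + (\<Sum>i\<in>J - S. \<tau> i *\<^sub>R x i)"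
      if *: "\<forall>i. \<bar>\<rho> i\<bar> = 1" "\<forall>i. \<bar>\<tau> i\<bar> = 1" for \<rho> \<tau> :: "nat \<Rightarrow> real"
    proof -
      \<comment> \<open>Members of \<open>S\<close> receive the sign of the new merged vector times
        their sign within it, so that together they contribute exactly \<open>\<rho> p\<close> times
        that vector.\<close>
      define \<tau>' where "\<tau>' i = (if i \<in> S then \<rho> p * \<eta> i else \<tau> i)" for i
      have "\<forall>i. \<bar>\<tau>' i\<bar> = 1" using * \<eta> by (simp add: \<tau>'_def abs_mult)
      then obtain \<sigma> where \<sigma>: "\<forall>i. \<bar>\<sigma> i\<bar> = (1::real)"
        "\<forall>s\<le>t. \<exists>r\<le>p. N1 ((\<Sum>i<s. \<sigma> i *\<^sub>R x i) - (\<Sum>l<r. \<rho> l *\<^sub>R z l)) \<le> m * d"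
        "(\<Sum>i<Suc t. \<sigma> i *\<^sub>R x i) = (\<Sum>l<p. \<rho> l *\<^sub>R z l) + (\<Sum>i\<in>J. \<tau>' i *\<^sub>R x i)"
        using extend[OF *(1)] by blast
      have "(\<Sum>i\<in>J. \<tau>' i *\<^sub>R x i) = (\<Sum>i\<in>J - S. \<tau>' i *\<^sub>R x i) + (\<Sum>i\<in>S. \<tau>' i *\<^sub>R x i)"
        by (rule sum.subset_diff[OF S(1) J(2)])
      also have "(\<Sum>i\<in>S. \<tau>' i *\<^sub>R x i) = \<rho> p *\<^sub>R z' p"
        by (simp add: \<tau>'_def z'_def scaleR_sum_right)
      also have "(\<Sum>i\<in>J - S. \<tau>' i *\<^sub>R x i) = (\<Sum>i\<in>J - S. \<tau> i *\<^sub>R x i)"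
        by (intro sum.cong) (auto simp: \<tau>'_def)
      finally have eq: "(\<Sum>i<Suc t. \<sigma> i *\<^sub>R x i) = (\<Sum>l<Suc p. \<rho> l *\<^sub>R z' l) + (\<Sum>i\<in>J - S. \<tau> i *\<^sub>R x i)"
        unfolding \<sigma>(3) by (simp add: zz)
      have "N1 ((\<Sum>i<Suc t. \<sigma> i *\<^sub>R x i) - (\<Sum>l<Suc p. \<rho> l *\<^sub>R z' l)) \<le> m * d"
        unfolding eq using small[of "J - S" \<tau>] * by simp
      moreover have "\<exists>r\<le>Suc p. N1 ((\<Sum>i<s. \<sigma> i *\<^sub>R x i) - (\<Sum>l<r. \<rho> l *\<^sub>R z' l)) \<le> m * d" if "s \<le> t" for s
        using \<sigma>(2) that zz by (metis le_SucI)
      ultimately have "\<forall>s\<le>Suc t. \<exists>r\<le>Suc p. N1 ((\<Sum>i<s. \<sigma> i *\<^sub>R x i) - (\<Sum>l<r. \<rho> l *\<^sub>R z' l)) \<le> m * d"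
        by (metis le_Suc_eq order_refl)
      then show ?thesis using \<sigma>(1) eq by blast
    qed
    ultimately show ?thesis
      using p z' J by (intro exI[of _ "Suc p"] exI[of _ z'] exI[of _ "J - S"] conjI allI impI) auto
  qed
qed

text \<open>Stage \<open>j\<close> handles vectors with \<open>N0\<close> at most \<open>M j\<close>
  and \<open>N1\<close> at most \<open>d j\<close>, keeps fewer than \<open>m j\<close> waiting
  after each step, costs \<open>m j * d j\<close> in \<open>N1\<close>, and hands at most as many
  merged vectors to stage \<open>Suc j\<close>. The number \<open>h\<close> of remaining stages is
  finite because the last one only has to hold all vectors at once.\<close>

lemma bounded_prefix_signs_stages:
  fixes N0 N1 :: "'a::real_vector \<Rightarrow> real"
  assumes N0: "seminorm N0" and N1: "seminorm N1" and cov: "\<And>j. covers_ball N0 N1 (n j) (\<epsilon> j)"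
    and m: "\<And>j. n j < 2 ^ m j" "\<And>j. m j > 0" and M: "\<And>j. M j > 0" "\<And>j. M (Suc j) = m j * M j"
    and d: "\<And>j. d j \<ge> 0" "\<And>j. d (Suc j) = M (Suc j) * \<epsilon> j"
    and x: "\<And>i. i < t \<Longrightarrow> N0 (x i) \<le> M j" "\<And>i. i < t \<Longrightarrow> N1 (x i) \<le> d j" and t: "t \<le> m (j + h)"
  shows "\<exists>\<sigma>. (\<forall>i. \<bar>\<sigma> i\<bar> = (1::real)) \<and>
    (\<forall>s\<le>t. N1 (\<Sum>i<s. \<sigma> i *\<^sub>R x i) \<le> (\<Sum>l=j..j+h. m l * d l))"
  using x t
proof (induction h arbitrary: j x t)
  case 0
  \<comment> \<open>At the last stage there are at most \<open>m j\<close> vectors, so the triangle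
    inequality suffices and all signs may be \<open>+\<close>.\<close>
  have "N1 (\<Sum>i<s. x i) \<le> m j * d j" if "s \<le> t" for s
  proof -
    have "N1 (\<Sum>i<s. x i) \<le> real (card {..<s}) * d j"
      using 0 that by (intro seminorm_sum_le[OF N1]) auto
    also have "\<dots> \<le> m j * d j" using that 0 d(1) by (simp add: mult_right_mono)
    finally show ?thesis .
  qed
  then show ?case by (intro exI[of _ "\<lambda>_. 1"]) simp
next
  case (Suc h)
  from group_signed_vectors[OF N0 N1 cov[of j] m(1,2) M(1) d(1)[of j], of t x] Suc.prems(1,2)
  have "\<exists>p z I. p \<le> t \<and> (\<forall>l<p. N0 (z l) \<le> m j * M j \<and> N1 (z l) \<le> m j * M j * \<epsilon> j) \<and>
     I \<subseteq> {..<t} \<and> card I < m j \<and>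
     (\<forall>\<rho> \<tau>. (\<forall>i. \<bar>\<rho> i\<bar> = (1::real)) \<longrightarrow> (\<forall>i. \<bar>\<tau> i\<bar> = (1::real)) \<longrightarrow>
       (\<exists>\<sigma>. (\<forall>i. \<bar>\<sigma> i\<bar> = (1::real)) \<and>
          (\<forall>s\<le>t. \<exists>r\<le>p. N1 ((\<Sum>i<s. \<sigma> i *\<^sub>R x i) - (\<Sum>l<r. \<rho> l *\<^sub>R z l)) \<le> m j * d j) \<and>
          (\<Sum>i<t. \<sigma> i *\<^sub>R x i) = (\<Sum>l<p. \<rho> l *\<^sub>R z l) + (\<Sum>i\<in>I. \<tau> i *\<^sub>R x i)))"
    by simp
  then obtain p z I where p: "p \<le> t"
    and z: "\<forall>l<p. N0 (z l) \<le> m j * M j \<and> N1 (z l) \<le> m j * M j * \<epsilon> j"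
    and sgn: "\<forall>\<rho> \<tau>. (\<forall>i. \<bar>\<rho> i\<bar> = (1::real)) \<longrightarrow> (\<forall>i. \<bar>\<tau> i\<bar> = (1::real)) \<longrightarrow>
       (\<exists>\<sigma>. (\<forall>i. \<bar>\<sigma> i\<bar> = (1::real)) \<and>
          (\<forall>s\<le>t. \<exists>r\<le>p. N1 ((\<Sum>i<s. \<sigma> i *\<^sub>R x i) - (\<Sum>l<r. \<rho> l *\<^sub>R z l)) \<le> m j * d j) \<and>
          (\<Sum>i<t. \<sigma> i *\<^sub>R x i) = (\<Sum>l<p. \<rho> l *\<^sub>R z l) + (\<Sum>i\<in>I. \<tau> i *\<^sub>R x i))"
    by (elim exE conjE) (rule that; assumption)
  have z0: "N0 (z l) \<le> M (Suc j)" and z1: "N1 (z l) \<le> d (Suc j)" if "l < p" for l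
    using z that by (auto simp: M d)
  have "\<exists>\<sigma>. (\<forall>i. \<bar>\<sigma> i\<bar> = (1::real)) \<and>
      (\<forall>s\<le>p. N1 (\<Sum>i<s. \<sigma> i *\<^sub>R z i) \<le> (\<Sum>l=Suc j..Suc j+h. m l * d l))"
    by (rule Suc.IH) (use z0 z1 p Suc.prems(3) in auto)
  then obtain \<rho> where \<rho>: "\<forall>i. \<bar>\<rho> i\<bar> = (1::real)"
    "\<And>s. s \<le> p \<Longrightarrow> N1 (\<Sum>i<s. \<rho> i *\<^sub>R z i) \<le> (\<Sum>l=Suc j..Suc j+h. m l * d l)"
    by blast
  \<comment> \<open>Vectors still waiting at the end may take any sign, here \<open>+\<close>; the
    prefix bound holds for every \<open>\<tau>\<close>.\<close>
  obtain \<sigma> where \<sigma>: "\<forall>i. \<bar>\<sigma> i\<bar> = (1::real)"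
    "\<And>s. s \<le> t \<Longrightarrow> \<exists>r\<le>p. N1 ((\<Sum>i<s. \<sigma> i *\<^sub>R x i) - (\<Sum>l<r. \<rho> l *\<^sub>R z l)) \<le> m j * d j"
    using spec[OF spec[OF sgn, of \<rho>], of "\<lambda>_. 1"] \<rho>(1) by auto
  have "N1 (\<Sum>i<s. \<sigma> i *\<^sub>R x i) \<le> (\<Sum>l=j..j+Suc h. m l * d l)" if s: "s \<le> t" for s
  proof -
    obtain r where r: "r \<le> p" "N1 ((\<Sum>i<s. \<sigma> i *\<^sub>R x i) - (\<Sum>l<r. \<rho> l *\<^sub>R z l)) \<le> m j * d j"
      using \<sigma>(2)[OF s] by blast
    have "N1 (\<Sum>i<s. \<sigma> i *\<^sub>R x i) \<le> m j * d j + (\<Sum>l=Suc j..Suc j+h. m l * d l)"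
      using seminorm_add[OF N1, of "(\<Sum>i<s. \<sigma> i *\<^sub>R x i) - (\<Sum>l<r. \<rho> l *\<^sub>R z l)" "\<Sum>l<r. \<rho> l *\<^sub>R z l"]
        r(2) \<rho>(2)[OF r(1)] by simp
    also have "\<dots> = (\<Sum>l=j..j+Suc h. m l * d l)"
      by (simp add: sum.atLeast_Suc_atMost[of j "j + h"])
    finally show ?thesis .
  qed
  then show ?case using \<sigma>(1) by blast
qed

definition bounded_prefix_signs :: "('a::real_vector \<Rightarrow> real) \<Rightarrow> ('a \<Rightarrow> real) \<Rightarrow> real \<Rightarrow> bool" where
  "bounded_prefix_signs N0 N1 R \<longleftrightarrow> (\<forall>t (x :: nat \<Rightarrow> 'a). (\<forall>i<t. N0 (x i) \<le> 1) \<longrightarrow>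
     (\<exists>\<sigma>. (\<forall>i. \<bar>\<sigma> i\<bar> = (1::real)) \<and> (\<forall>s\<le>t. N1 (\<Sum>i<s. \<sigma> i *\<^sub>R x i) \<le> R)))"

text \<open>Since \<open>k (Suc j)\<close> is the square of \<open>k j\<close>, both
  \<open>m j\<close> and \<open>M j\<close> are at most \<open>k j ^ 4\<close>; for \<open>M\<close>
  this reproduces itself because 4 + 4 = 2 * 4. Stage \<open>Suc j\<close> thus costs at most
  \<open>k (Suc j) ^ 8 = k j ^ 16\<close> times the diameter \<open>2 / k j ^ 17\<close>. The
  exponent 17 leaves \<open>2 / k j\<close>, which is summable.\<close>

lemma bounded_prefix_signs_if_covers_ball:
  fixes N0 N1 :: "'a::real_vector \<Rightarrow> real"
  assumes N0: "seminorm N0" and N1: "seminorm N1" and le: "\<And>x. N1 x \<le> c * N0 x" and "c \<ge> 0"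
    and cov: "\<And>k. k \<ge> 1 \<Longrightarrow> covers_ball N0 N1 (2 ^ (C * k ^ 3)) (2 / real k ^ 17)"
  shows "\<exists>R. bounded_prefix_signs N0 N1 R"
proof -
  \<comment> \<open>The base \<open>C + 2\<close> gives both \<open>k j \<ge> C + 1\<close>, which
    absorbs the factor of \<open>m j\<close>, and growth at least like \<open>2 ^ 2 ^ j\<close>. The
    factor \<open>C + 1\<close> in \<open>m\<close> makes the number of subsets strictly exceed the
    number of cells.\<close>
  define k where "k j = (C + 2) ^ (2 ^ j)" for j :: nat
  define m where "m j = (C + 1) * k j ^ 3" for j
  define M where "M j = (\<Prod>i<j. real (m i))" for j
  \<comment> \<open>At stage 0 nothing better than \<open>N1 x \<le> c * N0 x\<close> is known;
    later values come from the pigeonhole bound.\<close>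
  define d where "d j = (case j of 0 \<Rightarrow> c | Suc i \<Rightarrow> M j * (2 / real (k i) ^ 17))" for j
  have kSuc: "k (Suc j) = k j ^ 2" for j by (simp add: k_def power_mult[symmetric] mult.commute)
  have k2: "2 ^ 2 ^ j \<le> k j" for j unfolding k_def by (rule power_mono) auto
  have kj: "2 ^ j \<le> k j" for j
    using k2[of j] power_increasing[of j "2 ^ j" "2::nat"] less_exp[of j] by linarith
  have kpos: "k j > 0" for j by (simp add: k_def)
  have kC: "C + 1 \<le> k j" for j
    using self_le_power[of "C + 2" "2 ^ j"] by (simp add: k_def)
  have mpos: "m j > 0" for j by (simp add: m_def kpos)
  have m4: "m j \<le> k j ^ 4" for j
    using mult_right_mono[OF kC[of j], of "k j ^ 3"] by (simp add: m_def power_Suc[symmetric] del: power_Suc)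
  have mj: "j \<le> m j" for j
  proof -
    have "j \<le> k j" using less_exp[of j] kj[of j] by linarith
    also have "k j \<le> k j ^ 3" using kpos by (intro self_le_power) (auto simp: Suc_le_eq)
    also have "\<dots> \<le> m j" by (simp add: m_def)
    finally show ?thesis .
  qed
  have Mpos: "M j > 0" for j unfolding M_def using mpos by (intro prod_pos) auto
  have MSuc: "M (Suc j) = m j * M j" for j by (simp add: M_def)
  have M4: "M j \<le> real (k j) ^ 4" for j
  proof (induction j)
    case 0
    then show ?case by (simp add: M_def k_def)
  next
    case (Suc j)
    have "M (Suc j) \<le> real (k j) ^ 4 * real (k j) ^ 4"
      unfolding MSuc using Suc Mpos[of j] m4[of j]
      by (intro mult_mono) (auto simp del: of_nat_power simp: of_nat_power[symmetric])
    also have "\<dots> = real (k (Suc j)) ^ 4" by (simp add: kSuc power_mult[symmetric] power_add[symmetric])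
    finally show ?case .
  qed
  have dpos: "d j \<ge> 0" for j
    using \<open>c \<ge> 0\<close> less_imp_le[OF Mpos[of j]] by (auto simp: d_def split: nat.splits)
  have md: "m (Suc j) * d (Suc j) \<le> 2 * (1 / 2) ^ j" for j
  proof -
    have "m (Suc j) * d (Suc j) \<le> real (k (Suc j)) ^ 4 * (real (k (Suc j)) ^ 4 * (2 / real (k j) ^ 17))"
      unfolding d_def using m4[of "Suc j"] M4[of "Suc j"] Mpos[of "Suc j"]
      by (auto intro!: mult_mono divide_right_mono simp del: of_nat_power simp: of_nat_power[symmetric])
    also have "\<dots> = 2 / real (k j)"
      using kpos[of j] by (simp add: kSuc power_mult[symmetric] field_simps eval_nat_numeral)
    also have "\<dots> \<le> 2 / 2 ^ j"
      using of_nat_mono[OF kj[of j], where 'a = real] kpos[of j] by (intro divide_left_mono) auto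
    finally show ?thesis by (simp add: power_one_over)
  qed
  have sum_le: "(\<Sum>l=0..h. m l * d l) \<le> m 0 * c + 4" for h
  proof -
    have "(\<Sum>l=0..h. m l * d l) \<le> (\<Sum>l=0..Suc h. m l * d l)" using dpos by simp
    also have "\<dots> = m 0 * d 0 + (\<Sum>l=0..h. m (Suc l) * d (Suc l))"
      by (subst sum.atLeast_Suc_atMost) (simp_all only: le0 sum.shift_bounds_cl_Suc_ivl)
    also have "\<dots> \<le> m 0 * c + (\<Sum>l=0..h. 2 * (1 / 2) ^ l)"
      using md by (intro add_mono sum_mono) (auto simp: d_def)
    also have "(\<Sum>l=0..h. 2 * (1 / 2 :: real) ^ l) \<le> 4"
    proof -
      have "(\<Sum>l=0..h. 2 * (1 / 2 :: real) ^ l) = 2 * (\<Sum>l<Suc h. (1 / 2) ^ l)"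
        by (simp add: sum_distrib_left atLeast0AtMost lessThan_Suc_atMost del: sum.lessThan_Suc)
      also have "\<dots> \<le> 4" by (subst sum_gp_strict) (simp add: field_simps)
      finally show ?thesis .
    qed
    finally show ?thesis by simp
  qed
  have "\<exists>\<sigma>. (\<forall>i. \<bar>\<sigma> i\<bar> = (1::real)) \<and> (\<forall>s\<le>t. N1 (\<Sum>i<s. \<sigma> i *\<^sub>R x i) \<le> m 0 * c + 4)"
    if x: "\<forall>i<t. N0 (x i) \<le> 1" for t and x :: "nat \<Rightarrow> 'a"
  proof -
    \<comment> \<open>Taking \<open>t\<close> stages is enough, since
      \<open>m t \<ge> t\<close>.\<close>
    have "\<exists>\<sigma>. (\<forall>i. \<bar>\<sigma> i\<bar> = (1::real)) \<and> (\<forall>s\<le>t. N1 (\<Sum>i<s. \<sigma> i *\<^sub>R x i) \<le> (\<Sum>l=0..0+t. m l * d l))"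
    proof (rule bounded_prefix_signs_stages[OF N0 N1, where M = M])
      show "covers_ball N0 N1 (2 ^ (C * k j ^ 3)) (2 / real (k j) ^ 17)" for j
        using kpos[of j] by (intro cov) simp
      show "(2::nat) ^ (C * k j ^ 3) < 2 ^ m j" for j
        using kpos[of j] by (intro power_strict_increasing) (auto simp: m_def)
      show "N0 (x i) \<le> M 0" if "i < t" for i using x that by (simp add: M_def)
      show "N1 (x i) \<le> d 0" if "i < t" for i
        using le[of "x i"] x that mult_left_mono[OF _ \<open>c \<ge> 0\<close>, of "N0 (x i)" 1] by (force simp: d_def)
      show "t \<le> m (0 + t)" using mj by simp
    qed (use mpos Mpos MSuc dpos in \<open>auto simp: d_def\<close>)
    then show ?thesis using order_trans[OF _ sum_le[of t]] unfolding add_0 by blast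
  qed
  then show ?thesis unfolding bounded_prefix_signs_def by blast
qed

subsection \<open>Nuclear maps between seminorms\<close>

text \<open>Retains from a nuclear representation only the estimate it implies. The functionals are
  normalised to the dual unit ball of \<open>N1\<close>, and \<open>\<mu>\<close> carries the
  products of norms.\<close>

definition nuclear_seminorms :: "('a::real_vector \<Rightarrow> real) \<Rightarrow> ('a \<Rightarrow> real) \<Rightarrow> bool" where
  "nuclear_seminorms N1 N2 \<longleftrightarrow> (\<exists>f \<mu>. (\<forall>n. linear (f n)) \<and> (\<forall>n x. \<bar>f n x\<bar> \<le> N1 x) \<and>
     (\<forall>n::nat. 0 \<le> \<mu> n) \<and> summable \<mu> \<and> (\<forall>x. N2 x \<le> (\<Sum>n. \<mu> n * \<bar>f n x\<bar>)))"

section \<open>Semi-inner products and orthonormal systems\<close>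

definition semi_inner :: "('a::real_vector \<Rightarrow> 'a \<Rightarrow> real) \<Rightarrow> bool" where
  "semi_inner ip \<longleftrightarrow> bilinear ip \<and> (\<forall>x y. ip x y = ip y x) \<and> (\<forall>x. 0 \<le> ip x x)"

lemma semi_inner_bilinear: "semi_inner ip \<Longrightarrow> bilinear ip"
  and semi_inner_commute: "semi_inner ip \<Longrightarrow> ip x y = ip y x"
  and semi_inner_ge_0: "semi_inner ip \<Longrightarrow> 0 \<le> ip x x"
  by (auto simp: semi_inner_def)

definition orthonormal :: "('a \<Rightarrow> 'a \<Rightarrow> real) \<Rightarrow> (nat \<Rightarrow> 'a) \<Rightarrow> nat \<Rightarrow> bool" where
  "orthonormal ip e r \<longleftrightarrow> (\<forall>i<r. \<forall>j<r. ip (e i) (e j) = (if i = j then 1 else 0))"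

lemma bilinear_lsum:
  assumes "bilinear ip"
  shows "ip (\<Sum>i\<in>A. c i *\<^sub>R e i) y = (\<Sum>i\<in>A. c i * ip (e i) y)"
proof -
  have "linear (\<lambda>x. ip x y)" using assms by (simp add: bilinear_def)
  from linear_sum[OF this, of "\<lambda>i. c i *\<^sub>R e i" A] show ?thesis
    by (simp add: bilinear_lmul[OF assms])
qed

lemma orthonormal_sum_apply:
  assumes "semi_inner ip" "orthonormal ip e r" "j < r"
  shows "ip (\<Sum>i<r. c i *\<^sub>R e i) (e j) = c j"
proof -
  have "ip (\<Sum>i<r. c i *\<^sub>R e i) (e j) = (\<Sum>i<r. if i = j then c i else 0)"
    unfolding bilinear_lsum[OF semi_inner_bilinear[OF assms(1)]]
    using assms(2,3) by (intro sum.cong) (auto simp: orthonormal_def)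
  also have "\<dots> = c j" using assms(3) by simp
  finally show ?thesis .
qed

lemma orthonormal_norm_sum:
  assumes "semi_inner ip" "orthonormal ip e r"
  shows "ip (\<Sum>i<r. c i *\<^sub>R e i) (\<Sum>i<r. c i *\<^sub>R e i) = (\<Sum>i<r. (c i)\<^sup>2)"
proof -
  have "ip (\<Sum>i<r. c i *\<^sub>R e i) (\<Sum>i<r. c i *\<^sub>R e i) = (\<Sum>i<r. c i * ip (\<Sum>i<r. c i *\<^sub>R e i) (e i))"
    unfolding bilinear_lsum[OF semi_inner_bilinear[OF assms(1)], of c e "{..<r}" "\<Sum>i<r. c i *\<^sub>R e i"]
    by (simp add: semi_inner_commute[OF assms(1), of "e _"])
  also have "\<dots> = (\<Sum>i<r. (c i)\<^sup>2)"
    using orthonormal_sum_apply[OF assms] by (intro sum.cong) (auto simp: power2_eq_square)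
  finally show ?thesis .
qed

lemma orthonormal_projection:
  assumes ip: "semi_inner ip" and e: "orthonormal ip e r"
  defines "P \<equiv> \<lambda>x. \<Sum>i<r. ip x (e i) *\<^sub>R e i"
  shows "j < r \<Longrightarrow> ip (x - P x) (e j) = 0"
    and "ip (x - P x) (x - P x) = ip x x - (\<Sum>i<r. (ip x (e i))\<^sup>2)"
proof -
  note bil = semi_inner_bilinear[OF ip]
  show "ip (x - P x) (e j) = 0" if "j < r"
    using orthonormal_sum_apply[OF ip e that] by (simp add: bilinear_lsub[OF bil] P_def)
  have "ip x (P x) = (\<Sum>i<r. (ip x (e i))\<^sup>2)"
    unfolding semi_inner_commute[OF ip, of x] P_def bilinear_lsum[OF bil]
    by (simp add: semi_inner_commute[OF ip, of "e _" x] power2_eq_square)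
  moreover have "ip (P x) (P x) = (\<Sum>i<r. (ip x (e i))\<^sup>2)"
    unfolding P_def by (rule orthonormal_norm_sum[OF ip e])
  ultimately show "ip (x - P x) (x - P x) = ip x x - (\<Sum>i<r. (ip x (e i))\<^sup>2)"
    by (simp add: bilinear_lsub[OF bil] bilinear_rsub[OF bil] semi_inner_commute[OF ip, of "P x" x])
qed

lemma orthonormal_bessel:
  assumes "semi_inner ip" "orthonormal ip e r"
  shows "(\<Sum>i<r. (ip x (e i))\<^sup>2) \<le> ip x x"
  using semi_inner_ge_0[OF assms(1), of "x - (\<Sum>i<r. ip x (e i) *\<^sub>R e i)"]
  unfolding orthonormal_projection(2)[OF assms] by simp

section \<open>Hilbert seminorms and covering numbers of nuclear maps\<close>

lemma summable_mult_bounded: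
  assumes "summable \<mu>" "\<And>n. 0 \<le> \<mu> n" "\<And>n. \<bar>f n\<bar> \<le> (b::real)"
  shows "summable (\<lambda>n. \<mu> n * f n)"
proof (rule summable_comparison_test')
  show "summable (\<lambda>n. \<mu> n * b)" using assms(1) by (rule summable_mult2)
  show "norm (\<mu> n * f n) \<le> \<mu> n * b" if "n \<ge> 0" for n
    using assms(2,3) by (simp add: abs_mult mult_left_mono)
qed

text \<open>The semi-inner product is the \<open>\<mu>\<close>-weighted sum of
  \<open>f n x * f n y\<close>, possibly degenerate. The inequality
  \<open>\<bar>a\<bar> \<le> 1 + a * a\<close>, summed with weights \<open>\<mu>\<close>, bounds
  \<open>N2\<close> on its unit ball by \<open>suminf \<mu> + 1\<close>; the same constant serves
  both estimates.\<close>

lemma nuclear_seminorms_hilbert: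
  assumes "nuclear_seminorms N1 N2" and N2: "seminorm N2"
  shows "\<exists>ip c. semi_inner ip \<and> (\<forall>x. ip x x \<le> c * (N1 x)\<^sup>2) \<and> (\<forall>x. ip x x \<le> 1 \<longrightarrow> N2 x \<le> c)"
proof -
  obtain f \<mu> where lin: "\<And>n. linear (f n)" and f: "\<And>n x. \<bar>f n x\<bar> \<le> N1 x"
    and \<mu>: "\<And>n::nat. 0 \<le> \<mu> n" "summable \<mu>" and N2f: "\<And>x. N2 x \<le> (\<Sum>n. \<mu> n * \<bar>f n x\<bar>)"
    using assms(1) unfolding nuclear_seminorms_def by blast
  define ip where "ip x y = (\<Sum>n. \<mu> n * (f n x * f n y))" for x y
  have N1: "0 \<le> N1 x" for x using f[of 0 x] by linarith
  have ff: "\<bar>f n x * f n y\<bar> \<le> N1 x * N1 y" for n x y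
    using f N1 by (simp add: abs_mult mult_mono)
  have sm: "summable (\<lambda>n. \<mu> n * (f n x * f n y))" for x y
    by (rule summable_mult_bounded[OF \<mu>(2,1) ff])
  have sm1: "summable (\<lambda>n. \<mu> n * \<bar>f n x\<bar>)" for x
    using f by (intro summable_mult_bounded[OF \<mu>(2,1), where b = "N1 x"]) auto
  have add: "ip (x + y) z = ip x z + ip y z" for x y z
    unfolding ip_def suminf_add[OF sm sm] by (simp add: linear_add[OF lin] algebra_simps)
  have scale: "ip (c *\<^sub>R x) z = c * ip x z" for c x z
    unfolding ip_def suminf_mult[OF sm, symmetric] by (simp add: linear_scale[OF lin] algebra_simps)
  have comm: "ip x y = ip y x" for x y by (simp add: ip_def mult.commute)
  have lin1: "linear (\<lambda>x. ip x z)" for z by (rule linearI) (simp_all add: add scale)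
  then have "linear (ip z)" for z by (subst comm[abs_def]) simp
  moreover have "0 \<le> ip x x" for x unfolding ip_def using \<mu>(1) by (intro suminf_nonneg sm) simp
  ultimately have "semi_inner ip" using lin1 comm by (simp add: semi_inner_def bilinear_def)
  moreover have "ip x x \<le> (suminf \<mu> + 1) * (N1 x)\<^sup>2" for x
  proof -
    have "ip x x \<le> (\<Sum>n. \<mu> n * (N1 x)\<^sup>2)" unfolding ip_def
      using ff[of _ x x] \<mu> sm by (intro suminf_le summable_mult2 mult_left_mono) (auto simp: power2_eq_square abs_le_iff)
    also have "\<dots> = suminf \<mu> * (N1 x)\<^sup>2" by (rule suminf_mult2[OF \<mu>(2), symmetric])
    also have "\<dots> \<le> (suminf \<mu> + 1) * (N1 x)\<^sup>2" by (simp add: mult_right_mono)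
    finally show ?thesis .
  qed
  moreover have "N2 x \<le> suminf \<mu> + 1" if "ip x x \<le> 1" for x
  proof -
    have "N2 x \<le> (\<Sum>n. \<mu> n * \<bar>f n x\<bar>)" by (rule N2f)
    also have "\<dots> \<le> (\<Sum>n. \<mu> n + \<mu> n * (f n x * f n x))"
    proof (intro suminf_le sm1 summable_add \<mu>(2) sm)
      fix n
      have "\<bar>f n x\<bar> \<le> 1 + f n x * f n x"
        using abs_le_square_iff[of 1 "f n x"] by (cases "\<bar>f n x\<bar> \<le> 1")
          (auto simp: power2_eq_square abs_mult[symmetric] intro: add_increasing2 order_trans[OF self_le_power[of "\<bar>f n x\<bar>" 2]])
      then show "\<mu> n * \<bar>f n x\<bar> \<le> \<mu> n + \<mu> n * (f n x * f n x)"
        using mult_left_mono[OF _ \<mu>(1)] by (fastforce simp: algebra_simps)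
    qed
    also have "\<dots> = suminf \<mu> + ip x x" unfolding ip_def by (rule suminf_add[OF \<mu>(2) sm, symmetric])
    finally show ?thesis using that by simp
  qed
  ultimately show ?thesis by blast
qed

text \<open>The nuclear counterpart of the Hilbert--Schmidt norm bound.\<close>

lemma nuclear_seminorms_orthonormal_sum:
  assumes ip: "semi_inner ip" and N2: "seminorm N2" "\<And>x. ip x x \<le> 1 \<Longrightarrow> N2 x \<le> c" "c \<ge> 0"
    and nuc: "nuclear_seminorms N2 N3"
  shows "\<exists>D\<ge>0. \<forall>e r. orthonormal ip e r \<longrightarrow> (\<Sum>i<r. N3 (e i)) \<le> D * sqrt r"
proof -
  note bil = semi_inner_bilinear[OF ip]
  obtain g \<mu> where lin: "\<And>n. linear (g n)" and g: "\<And>n x. \<bar>g n x\<bar> \<le> N2 x"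
    and \<mu>: "\<And>n::nat. 0 \<le> \<mu> n" "summable \<mu>" and N3g: "\<And>x. N3 x \<le> (\<Sum>n. \<mu> n * \<bar>g n x\<bar>)"
    using nuc unfolding nuclear_seminorms_def by blast
  have sm1: "summable (\<lambda>n. \<mu> n * \<bar>g n x\<bar>)" for x
    using g by (intro summable_mult_bounded[OF \<mu>(2,1), where b = "N2 x"]) auto
  have "(\<Sum>i<r. N3 (e i)) \<le> suminf \<mu> * c * sqrt r" if e: "orthonormal ip e r" for e r
  proof -
    have gsum: "(\<Sum>i<r. \<bar>g n (e i)\<bar>) \<le> c * sqrt r" for n
    proof (cases "r = 0")
      case False
      \<comment> \<open>With these signs \<open>g n\<close> adds up the absolute values, while
        orthonormality gives \<open>v\<close> only the length \<open>sqrt r\<close>. This is the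
        gain over the trivial bound \<open>c * r\<close>.\<close>
      define s where "s i = (if g n (e i) \<ge> 0 then 1 else - 1 :: real)" for i
      define v where "v = (\<Sum>i<r. s i *\<^sub>R e i)"
      have "(\<Sum>i<r. \<bar>g n (e i)\<bar>) = g n v"
        unfolding v_def linear_sum[OF lin] by (intro sum.cong) (auto simp: s_def linear_scale[OF lin])
      also have "\<dots> \<le> N2 v" using g[of n v] by linarith
      also have "\<dots> \<le> c * sqrt r"
      proof -
        have "ip v v = r" unfolding v_def orthonormal_norm_sum[OF ip e]
          by (simp add: s_def if_distrib[of "\<lambda>x. x\<^sup>2"] cong: if_cong)
        then have "ip ((1 / sqrt r) *\<^sub>R v) ((1 / sqrt r) *\<^sub>R v) = 1"
          using False by (simp add: bilinear_lmul[OF bil] bilinear_rmul[OF bil] field_simps)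
        then have "N2 ((1 / sqrt r) *\<^sub>R v) \<le> c" by (intro N2(2)) simp
        then show ?thesis using False by (simp add: seminorm_scaleR[OF N2(1)] field_simps)
      qed
      finally show ?thesis .
    qed simp
    have "(\<Sum>i<r. N3 (e i)) \<le> (\<Sum>i<r. \<Sum>n. \<mu> n * \<bar>g n (e i)\<bar>)" by (intro sum_mono N3g)
    also have "\<dots> = (\<Sum>n. \<Sum>i<r. \<mu> n * \<bar>g n (e i)\<bar>)" by (rule suminf_sum[symmetric]) (rule sm1)
    also have "\<dots> \<le> (\<Sum>n. \<mu> n * (c * sqrt r))"
      using gsum \<mu> sm1 unfolding sum_distrib_left[symmetric]
      by (intro suminf_le mult_left_mono summable_mult2) (auto simp: sum_distrib_left intro: summable_sum)
    also have "\<dots> = suminf \<mu> * (c * sqrt r)" by (rule suminf_mult2[OF \<mu>(2), symmetric])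
    finally show ?thesis by simp
  qed
  moreover have "suminf \<mu> * c \<ge> 0" using \<mu> \<open>c \<ge> 0\<close> by (simp add: suminf_nonneg)
  ultimately show ?thesis by blast
qed

text \<open>Take a maximal orthonormal system of vectors on which \<open>N3\<close> exceeds \<open>\<tau>\<close>.\<close>

lemma small_on_orthogonal_complement:
  assumes ip: "semi_inner ip" and N3: "seminorm N3" and null: "\<And>x. ip x x = 0 \<Longrightarrow> N3 x = 0"
    and D: "\<And>e r. orthonormal ip e r \<Longrightarrow> (\<Sum>i<r. N3 (e i)) \<le> D * sqrt r" and "\<tau> > 0" "D \<ge> 0"
  shows "\<exists>e r. orthonormal ip e r \<and> real r \<le> (D / \<tau>)\<^sup>2 \<and>
    (\<forall>x. (\<forall>i<r. ip x (e i) = 0) \<longrightarrow> N3 x \<le> \<tau> * sqrt (ip x x))"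
proof -
  note bil = semi_inner_bilinear[OF ip]
  define Q where "Q r \<longleftrightarrow> (\<exists>e. orthonormal ip e r \<and> (\<forall>i<r. N3 (e i) > \<tau>))" for r
  have bound: "real r \<le> (D / \<tau>)\<^sup>2" if Qr: "Q r" for r
  proof (cases "r = 0")
    case False
    obtain e where e: "orthonormal ip e r" "\<And>i. i < r \<Longrightarrow> N3 (e i) > \<tau>"
      using Qr unfolding Q_def by blast
    \<comment> \<open>A sum of \<open>r\<close> terms above \<open>\<tau>\<close> is at most
      \<open>D * sqrt r\<close>, which bounds \<open>r\<close>; hence a largest system
      exists.\<close>
    have "sqrt r * sqrt r * \<tau> = (\<Sum>i<r. \<tau>)" by simp
    also have "\<dots> \<le> (\<Sum>i<r. N3 (e i))" using e(2) by (intro sum_mono less_imp_le) auto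
    also have "\<dots> \<le> D * sqrt r" by (rule D[OF e(1)])
    finally have "(sqrt r * \<tau>) * sqrt r \<le> D * sqrt r" by (simp only: mult_ac)
    then have "sqrt r * \<tau> \<le> D" using False by (simp add: mult.commute)
    then have "sqrt r \<le> D / \<tau>" using \<open>\<tau> > 0\<close> by (simp add: field_simps)
    then have "(sqrt r)\<^sup>2 \<le> (D / \<tau>)\<^sup>2" by (rule power_mono) simp
    then show ?thesis by simp
  qed simp
  have Q0: "Q 0" by (simp add: Q_def orthonormal_def)
  obtain n :: nat where "(D / \<tau>)\<^sup>2 < real n" using reals_Archimedean2 by blast
  then have "\<forall>r. Q r \<longrightarrow> r < n" using bound by fastforce
  from ex_has_greatest_nat[where f = "\<lambda>r. r", OF Q0 this]
  obtain r where r: "Q r" and max: "\<And>s. Q s \<Longrightarrow> s \<le> r" by blast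
  obtain e where e: "orthonormal ip e r" "\<And>i. i < r \<Longrightarrow> N3 (e i) > \<tau>"
    using r unfolding Q_def by blast
  have "N3 x \<le> \<tau> * sqrt (ip x x)" if x: "\<forall>i<r. ip x (e i) = 0" for x
  proof (cases "ip x x = 0")
    case True
    then show ?thesis using null by simp
  next
    case False
    then have pos: "ip x x > 0" using semi_inner_ge_0[OF ip, of x] by simp
    define y where "y = (1 / sqrt (ip x x)) *\<^sub>R x"
    have y1: "ip y y = 1" unfolding y_def bilinear_lmul[OF bil] bilinear_rmul[OF bil]
      using pos by (simp add: field_simps)
    have ye: "ip y (e i) = 0" "ip (e i) y = 0" if "i < r" for i
      using x that semi_inner_commute[OF ip, of "e i"] by (auto simp: y_def bilinear_lmul[OF bil])
    have "\<not> N3 y > \<tau>"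
    proof
      assume "N3 y > \<tau>"
      then have "\<forall>i<Suc r. N3 ((e(r := y)) i) > \<tau>" using e(2) by (simp add: less_Suc_eq)
      moreover have "orthonormal ip (e(r := y)) (Suc r)"
        using e(1) ye y1 unfolding orthonormal_def by (auto simp: less_Suc_eq)
      ultimately have "Q (Suc r)" unfolding Q_def by blast
      then show False using max by force
    qed
    then show ?thesis using pos by (simp add: y_def seminorm_scaleR[OF N3] field_simps)
  qed
  then show ?thesis using e(1) bound[OF r] by blast
qed

text \<open>The origin of the cubic exponent: a cell is described by \<open>O(k^2)\<close>
  coordinates, each with polynomially many values. Bounding the number of values crudely by
  \<open>2 ^ O(k)\<close> via \<open>n < 2 ^ n\<close> gives \<open>2 ^ O(k^3)\<close>
  cells.\<close>

lemma power_dominated_by_exponential: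
  fixes K k :: nat
  assumes "k \<ge> 1"
  shows "(2 * (2 * k * (16 * K ^ 6 * k\<^sup>2) * K ^ 3) + 1) ^ (16 * K ^ 6 * k\<^sup>2)
    \<le> 2 ^ (16 * K ^ 6 * (64 * K ^ 9 + 1 + 3) * k ^ 3)"
proof -
  have "2 * (2 * k * (16 * K ^ 6 * k\<^sup>2) * K ^ 3) + 1 = 64 * K ^ 9 * k ^ 3 + 1"
    by (simp add: eval_nat_numeral algebra_simps)
  also have "\<dots> \<le> (64 * K ^ 9 + 1) * k ^ 3" using assms by (simp add: algebra_simps)
  also have "\<dots> \<le> 2 ^ (64 * K ^ 9 + 1) * (2 ^ k) ^ 3"
    by (intro mult_mono power_mono less_imp_le less_exp) (use assms in auto)
  also have "\<dots> = 2 ^ (64 * K ^ 9 + 1 + 3 * k)" by (simp add: power_add power_mult[symmetric] mult.commute)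
  also have "\<dots> \<le> 2 ^ ((64 * K ^ 9 + 1 + 3) * k)"
    using mult_left_mono[OF assms, of "64 * K ^ 9 + 1"]
    by (intro power_increasing) (simp_all only: add_mult_distrib, auto)
  finally have "(2 * (2 * k * (16 * K ^ 6 * k\<^sup>2) * K ^ 3) + 1) ^ (16 * K ^ 6 * k\<^sup>2)
      \<le> (2 ^ ((64 * K ^ 9 + 1 + 3) * k)) ^ (16 * K ^ 6 * k\<^sup>2)" by (intro power_mono) auto
  also have "\<dots> = 2 ^ (16 * K ^ 6 * (64 * K ^ 9 + 1 + 3) * k ^ 3)"
    by (simp add: power_mult[symmetric] power2_eq_square power3_eq_cube algebra_simps)
  finally show ?thesis .
qed

text \<open>A vector is split into its part along a finite orthonormal system and the orthogonal
  rest. The rest is small in \<open>N3\<close> for every difference of two ball points; the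
  coordinates are rounded to a grid. Each of the two contributes at most
  \<open>1 / (2 * k)\<close>.\<close>

lemma hilbert_covers_ball:
  fixes N1 N3 :: "'a::real_vector \<Rightarrow> real" and K k :: nat
  assumes ip: "semi_inner ip" and N1: "seminorm N1" and N3: "seminorm N3"
    and ip1: "\<And>x. N1 x \<le> 1 \<Longrightarrow> ip x x \<le> real K ^ 2" and N3K: "\<And>x. ip x x \<le> 1 \<Longrightarrow> N3 x \<le> real K ^ 2"
    and D: "\<And>e r. orthonormal ip e r \<Longrightarrow> (\<Sum>i<r. N3 (e i)) \<le> real K ^ 2 * sqrt r"
    and K: "K \<ge> 1" and k: "k \<ge> 1"
  shows "covers_ball N1 N3 (2 ^ (16 * K ^ 6 * (64 * K ^ 9 + 1 + 3) * k ^ 3)) (1 / real k)"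
proof -
  note bil = semi_inner_bilinear[OF ip]
  have null: "N3 x = 0" if "ip x x = 0" for x
  proof (rule ccontr)
    assume "N3 x \<noteq> 0"
    then have pos: "N3 x > 0" using seminorm_nonneg[OF N3, of x] by simp
    define t where "t = (real K ^ 2 + 1) / N3 x"
    have "ip (t *\<^sub>R x) (t *\<^sub>R x) \<le> 1" using that by (simp add: bilinear_lmul[OF bil] bilinear_rmul[OF bil])
    then have "N3 (t *\<^sub>R x) \<le> real K ^ 2" by (rule N3K)
    then show False using pos by (simp add: seminorm_scaleR[OF N3] t_def)
  qed
  \<comment> \<open>\<open>R\<close> is the dimension bound \<open>(D / \<tau>)\<^sup>2\<close> for
    \<open>D = K ^ 2\<close> and \<open>\<tau> = 1 / (4 * K * k)\<close>. The grid width
    \<open>1 / q\<close> is chosen so that \<open>R\<close> coordinate errors, each multiplied by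
    \<open>N3 (e i) \<le> K ^ 2\<close>, add up to \<open>1 / (2 * k)\<close>. As coordinates are at
    most \<open>K\<close> in absolute value, the rounded ones lie within
    \<open>H = K * q\<close>.\<close>
  define R where "R = 16 * K ^ 6 * k\<^sup>2"
  define q where "q = 2 * k * R * K ^ 2"
  define H where "H = 2 * k * R * K ^ 3"
  have q: "q > 0" using K k by (simp add: q_def R_def)
  obtain e r where e: "orthonormal ip e r" and r: "real r \<le> (real K ^ 2 / (1 / (4 * K * k)))\<^sup>2"
    and small: "\<And>x. (\<forall>i<r. ip x (e i) = 0) \<Longrightarrow> N3 x \<le> 1 / (4 * K * k) * sqrt (ip x x)"
    using small_on_orthogonal_complement[OF ip N3 null D, of "1 / (4 * K * k)"] K k by auto
  have "real r \<le> real R" using r by (simp add: R_def power_mult_distrib power2_eq_square eval_nat_numeral mult_ac)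
  then have rR: "r \<le> R" by simp
  have coef: "\<bar>ip x (e i)\<bar> \<le> K" if "N1 x \<le> 1" "i < r" for x i
  proof -
    have "(ip x (e i))\<^sup>2 \<le> (\<Sum>i<r. (ip x (e i))\<^sup>2)" using that by (intro member_le_sum) auto
    also have "\<dots> \<le> ip x x" by (rule orthonormal_bessel[OF ip e])
    also have "\<dots> \<le> real K ^ 2" by (rule ip1[OF that(1)])
    finally show ?thesis by (simp add: abs_le_square_iff[symmetric])
  qed
  define cell where "cell a = {x. N1 x \<le> 1 \<and> (\<forall>i<r. \<lfloor>ip x (e i) * q\<rfloor> = a i)}" for a
  define I where "I = {..<r} \<rightarrow>\<^sub>E {- int H..int H}"
  have finI: "finite I" unfolding I_def by (intro finite_PiE) auto
  have "card {- int H..int H} = 2 * H + 1" unfolding card_atLeastAtMost_int by linarith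
  then have "card I = (2 * H + 1) ^ r" unfolding I_def by (subst card_funcsetE) auto
  also have "\<dots> \<le> (2 * H + 1) ^ R" using rR by (intro power_increasing) auto
  also have "\<dots> \<le> 2 ^ (16 * K ^ 6 * (64 * K ^ 9 + 1 + 3) * k ^ 3)"
    unfolding H_def R_def by (rule power_dominated_by_exponential[OF k])
  finally have cardI: "card I \<le> 2 ^ (16 * K ^ 6 * (64 * K ^ 9 + 1 + 3) * k ^ 3)" .
  show ?thesis unfolding covers_ball_def
  proof (intro exI[of _ "cell ` I"] conjI ballI)
    show "finite (cell ` I)" using finI by blast
    show "card (cell ` I) \<le> 2 ^ (16 * K ^ 6 * (64 * K ^ 9 + 1 + 3) * k ^ 3)"
      using card_image_le[OF finI, of cell] cardI by linarith
    show "{x. N1 x \<le> 1} \<subseteq> \<Union> (cell ` I)"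
    proof
      fix x assume "x \<in> {x. N1 x \<le> 1}"
      then have x: "N1 x \<le> 1" by simp
      define a where "a = restrict (\<lambda>i. \<lfloor>ip x (e i) * q\<rfloor>) {..<r}"
      have "\<lfloor>ip x (e i) * q\<rfloor> \<in> {- int H..int H}" if "i < r" for i
      proof -
        have "\<bar>ip x (e i) * q\<bar> \<le> K * real q" using coef[OF x that] by (simp add: abs_mult mult_right_mono)
        also have "\<dots> = real H" by (simp add: q_def H_def power2_eq_square power3_eq_cube)
        finally show ?thesis by (simp add: abs_le_iff) linarith
      qed
      then have "a \<in> I" by (auto simp: a_def I_def)
      moreover have "x \<in> cell a" using x by (simp add: cell_def a_def)
      ultimately show "x \<in> \<Union> (cell ` I)" by blast
    qed
    fix E x y assume "E \<in> cell ` I" "x \<in> E" "y \<in> E"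
    then obtain a where x: "N1 x \<le> 1" "\<And>i. i < r \<Longrightarrow> \<lfloor>ip x (e i) * q\<rfloor> = a i"
      and y: "N1 y \<le> 1" "\<And>i. i < r \<Longrightarrow> \<lfloor>ip y (e i) * q\<rfloor> = a i" by (auto simp: cell_def)
    define w where "w = x - y"
    define p where "p = (\<Sum>i<r. ip w (e i) *\<^sub>R e i)"
    have wi: "\<bar>ip w (e i)\<bar> \<le> 1 / q" if "i < r" for i
    proof -
      have "\<bar>ip x (e i) * q - ip y (e i) * q\<bar> \<le> 1"
        using x(2)[OF that] y(2)[OF that] by linarith
      then have "\<bar>ip w (e i)\<bar> * q \<le> 1"
        by (simp add: w_def bilinear_lsub[OF bil] left_diff_distrib[symmetric] abs_mult)
      then show ?thesis using q by (simp add: field_simps)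
    qed
    \<comment> \<open>A difference of two points of the ball lies in twice the ball; this 2 and the
      2 in \<open>1 / (2 * k)\<close> account for the 4 in \<open>\<tau>\<close>.\<close>
    have "N1 ((1 / 2) *\<^sub>R w) \<le> 1"
      using seminorm_diff[OF N1, of x y] x(1) y(1) by (simp add: w_def seminorm_scaleR[OF N1])
    then have "ip ((1 / 2) *\<^sub>R w) ((1 / 2) *\<^sub>R w) \<le> real K ^ 2" by (rule ip1)
    then have ww: "ip w w \<le> (2 * real K)\<^sup>2"
      by (simp add: bilinear_lmul[OF bil] bilinear_rmul[OF bil] power_mult_distrib)
    have "ip (w - p) (w - p) \<le> ip w w"
      unfolding p_def orthonormal_projection(2)[OF ip e] by (simp add: sum_nonneg)
    with ww have "sqrt (ip (w - p) (w - p)) \<le> 2 * K"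
      by (intro real_le_lsqrt) auto
    have "N3 (w - p) \<le> 1 / (4 * K * k) * sqrt (ip (w - p) (w - p))"
      unfolding p_def using orthonormal_projection(1)[OF ip e] by (intro small) auto
    also have "\<dots> \<le> 1 / (4 * K * k) * (2 * K)"
      using \<open>sqrt (ip (w - p) (w - p)) \<le> 2 * K\<close> by (intro mult_left_mono) auto
    also have "\<dots> = 1 / (2 * k)" using K by simp
    finally have 1: "N3 (w - p) \<le> 1 / (2 * k)" .
    have "N3 p \<le> real (card {..<r}) * (1 / q * real K ^ 2)" unfolding p_def
    proof (rule seminorm_sum_le[OF N3])
      fix i assume "i \<in> {..<r}"
      then have "i < r" by simp
      have "N3 (e i) \<le> real K ^ 2" using e \<open>i < r\<close> by (intro N3K) (simp add: orthonormal_def)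
      then show "N3 (ip w (e i) *\<^sub>R e i) \<le> 1 / q * real K ^ 2"
        unfolding seminorm_scaleR[OF N3] using wi[OF \<open>i < r\<close>] seminorm_nonneg[OF N3]
        by (intro mult_mono) auto
    qed
    also have "\<dots> \<le> real R * (1 / q * real K ^ 2)" using rR by (intro mult_right_mono) auto
    also have "\<dots> = 1 / (2 * k)" using K k by (simp add: q_def R_def field_simps)
    finally have "N3 p \<le> 1 / (2 * k)" .
    with 1 have "N3 w \<le> 1 / (2 * k) + 1 / (2 * k)"
      using seminorm_add[OF N3, of "w - p" p] by simp
    then show "N3 (x - y) \<le> 1 / real k" by (simp add: w_def)
  qed
qed

text \<open>Each nuclear step has its own task: the first yields the Hilbert seminorm between
  \<open>N1\<close> and \<open>N2\<close>, the second the estimate of \<open>N3\<close> on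
  orthonormal systems.\<close>

lemma nuclear_pair_covers_ball:
  fixes N1 N2 N3 :: "'a::real_vector \<Rightarrow> real"
  assumes N: "seminorm N1" "seminorm N2" "seminorm N3"
    and nuc: "nuclear_seminorms N1 N2" "nuclear_seminorms N2 N3"
  shows "\<exists>C. \<forall>k\<ge>1. covers_ball N1 N3 (2 ^ (C * k ^ 3)) (1 / real k)"
proof -
  obtain ip c where ip: "semi_inner ip" and c: "\<And>x. ip x x \<le> c * (N1 x)\<^sup>2" "\<And>x. ip x x \<le> 1 \<Longrightarrow> N2 x \<le> c"
    using nuclear_seminorms_hilbert[OF nuc(1) N(2)] by blast
  have c0: "c \<ge> 0" using c(2)[of 0] seminorm_nonneg[OF N(2), of 0] bilinear_lzero[OF semi_inner_bilinear[OF ip]] by simp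
  obtain D where D: "D \<ge> 0" "\<And>e r. orthonormal ip e r \<Longrightarrow> (\<Sum>i<r. N3 (e i)) \<le> D * sqrt r"
    using nuclear_seminorms_orthonormal_sum[OF ip N(2) c(2) c0 nuc(2)] by blast
  obtain g \<mu> where g: "\<And>n x. \<bar>g n x\<bar> \<le> N2 x" and \<mu>: "\<And>n::nat. 0 \<le> \<mu> n" "summable \<mu>"
    and N3g: "\<And>x. N3 x \<le> (\<Sum>n. \<mu> n * \<bar>g n x\<bar>)"
    using nuc(2) unfolding nuclear_seminorms_def by blast
  have N32: "N3 x \<le> suminf \<mu> * N2 x" for x
  proof -
    have "(\<Sum>n. \<mu> n * \<bar>g n x\<bar>) \<le> (\<Sum>n. \<mu> n * N2 x)"
      using g \<mu> by (intro suminf_le mult_left_mono summable_mult2 summable_mult_bounded[where b = "N2 x"]) auto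
    then show ?thesis using N3g[of x] suminf_mult2[OF \<mu>(2), of "N2 x"] by simp
  qed
  \<comment> \<open>One integer replaces all constants. It is used squared so that
    \<open>ip x x \<le> K ^ 2\<close> bounds the coordinates by the integer
    \<open>K\<close>.\<close>
  obtain K :: nat where K: "max (c + D + suminf \<mu> * c) 1 \<le> real K" using real_arch_simple by blast
  have mu0: "suminf \<mu> \<ge> 0" using \<mu> by (simp add: suminf_nonneg)
  have "suminf \<mu> * c \<ge> 0" using mu0 c0 by (rule mult_nonneg_nonneg)
  moreover have "c + D + suminf \<mu> * c \<le> K" using K by simp
  ultimately have Kc: "c \<le> K" "D \<le> K" "suminf \<mu> * c \<le> K" using c0 D(1) by linarith+
  have K1: "K \<ge> 1" using K by simp
  have KK: "real K \<le> real K ^ 2" using K1 by (intro self_le_power) auto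
  have "covers_ball N1 N3 (2 ^ (16 * K ^ 6 * (64 * K ^ 9 + 1 + 3) * k ^ 3)) (1 / real k)" if "k \<ge> 1" for k
  proof (rule hilbert_covers_ball[OF ip N(1,3) _ _ _ K1 that])
    show "ip x x \<le> real K ^ 2" if "N1 x \<le> 1" for x
    proof -
      have "(N1 x)\<^sup>2 \<le> 1" using that seminorm_nonneg[OF N(1), of x] by (simp add: power_le_one)
      then have "c * (N1 x)\<^sup>2 \<le> c" using mult_left_mono[OF _ c0] by fastforce
      then show ?thesis using c(1)[of x] Kc(1) KK by linarith
    qed
    show "N3 x \<le> real K ^ 2" if "ip x x \<le> 1" for x
    proof -
      have "suminf \<mu> * N2 x \<le> suminf \<mu> * c" using c(2)[OF that] mu0 by (rule mult_left_mono)
      then show ?thesis using N32[of x] Kc(3) KK by linarith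
    qed
    show "(\<Sum>i<r. N3 (e i)) \<le> real K ^ 2 * sqrt r" if "orthonormal ip e r" for e r
      using D(2)[OF that] mult_right_mono[of D "real K ^ 2" "sqrt r"] Kc(2) KK by simp
  qed
  then show ?thesis by blast
qed

section \<open>First consequences of a sign bound\<close>

lemma bounded_prefix_signsD:
  fixes x :: "nat \<Rightarrow> 'a::real_vector"
  assumes "bounded_prefix_signs N0 N1 R" "\<And>i. i < t \<Longrightarrow> N0 (x i) \<le> 1"
  obtains \<sigma> where "\<And>i. \<bar>\<sigma> i\<bar> = (1::real)" "\<And>s. s \<le> t \<Longrightarrow> N1 (\<Sum>i<s. \<sigma> i *\<^sub>R x i) \<le> R"
proof -
  have "\<exists>\<sigma>. (\<forall>i. \<bar>\<sigma> i\<bar> = (1::real)) \<and> (\<forall>s\<le>t. N1 (\<Sum>i<s. \<sigma> i *\<^sub>R x i) \<le> R)"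
    using assms(1)[unfolded bounded_prefix_signs_def, THEN spec[of _ t], THEN spec[of _ x]] assms(2)
    by blast
  then obtain \<sigma> where "\<forall>i. \<bar>\<sigma> i\<bar> = (1::real)" "\<forall>s\<le>t. N1 (\<Sum>i<s. \<sigma> i *\<^sub>R x i) \<le> R" by blast
  then show thesis by (intro that[of \<sigma>]) simp_all
qed

text \<open>A sequence of length one has no use for its sign, so the unit ball of \<open>N0\<close>
  lies in \<open>R\<close> times that of \<open>N1\<close>; scaling does the rest, including
  arbitrarily large multiples when \<open>N0 x = 0\<close>.\<close>

lemma bounded_prefix_signs_dominates:
  assumes N: "seminorm N0" "seminorm N1" and R: "bounded_prefix_signs N0 N1 R"
  shows "0 \<le> R" and "N1 x \<le> R * N0 x"
proof -
  have le: "N1 y \<le> R" if y: "N0 y \<le> 1" for y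
  proof -
    obtain \<sigma> where "\<And>i. \<bar>\<sigma> i\<bar> = (1::real)" "\<And>s. s \<le> (1::nat) \<Longrightarrow> N1 (\<Sum>i<s. \<sigma> i *\<^sub>R y) \<le> R"
      using bounded_prefix_signsD[OF R, of 1 "\<lambda>_. y"] y by metis
    from this(2)[of 1] this(1)[of 0] show ?thesis by (simp add: seminorm_scaleR[OF N(2)])
  qed
  show "0 \<le> R" using le[of 0] by (simp add: seminorm_zero[OF N(1)] seminorm_zero[OF N(2)])
  show "N1 x \<le> R * N0 x"
  proof (cases "N0 x = 0")
    case False
    then have "N0 x > 0" using seminorm_nonneg[OF N(1), of x] by simp
    then show ?thesis
      using le[of "(1 / N0 x) *\<^sub>R x"]
      by (simp add: seminorm_scaleR[OF N(1)] seminorm_scaleR[OF N(2)] field_simps)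
  next
    case True
    have "\<not> N1 x > 0"
    proof
      assume pos: "N1 x > 0"
      have "N1 (((R + 1) / N1 x) *\<^sub>R x) \<le> R" by (rule le) (simp add: seminorm_scaleR[OF N(1)] True)
      then show False using pos \<open>0 \<le> R\<close> by (simp add: seminorm_scaleR[OF N(2)])
    qed
    then show ?thesis using True by simp
  qed
qed

subsection \<open>Rounding off coefficients\<close>

text \<open>The binary digits of the coefficients are removed from the last one on: signs for the
  vectors with odd numerator decide whether to round up or down.\<close>

lemma round_dyadic_coefficients:
  fixes x :: "nat \<Rightarrow> 'a::real_vector" and a :: "nat \<Rightarrow> nat"
  assumes N: "seminorm N0" "seminorm N1" and R: "bounded_prefix_signs N0 N1 R"
    and x: "\<And>i. i < t \<Longrightarrow> N0 (x i) \<le> 1" and a: "\<And>i. i < t \<Longrightarrow> a i \<le> 2 ^ b"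
  shows "\<exists>I\<subseteq>{..<t}. N1 ((\<Sum>i<t. (a i / 2 ^ b) *\<^sub>R x i) - (\<Sum>i\<in>I. x i)) \<le> R * (1 - (1 / 2) ^ b)"
  using a
proof (induction b arbitrary: a)
  case 0
  define I where "I = {i \<in> {..<t}. a i = 1}"
  have "(\<Sum>i<t. (a i / 2 ^ 0) *\<^sub>R x i) = (\<Sum>i<t. if a i = 1 then x i else 0)"
    using 0 by (intro sum.cong) (force simp: le_Suc_eq)+
  also have "\<dots> = (\<Sum>i\<in>I. x i)" unfolding I_def by (rule sum.inter_filter[symmetric]) simp
  finally have "N1 ((\<Sum>i<t. (a i / 2 ^ 0) *\<^sub>R x i) - (\<Sum>i\<in>I. x i)) = 0"
    by (simp add: seminorm_zero[OF N(2)])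
  then show ?case by (intro exI[of _ I]) (auto simp: I_def)
next
  case (Suc b)
  \<comment> \<open>Even numerators can be halved exactly. Their vectors become 0, so that the index
    range stays the same.\<close>
  define y where "y i = (if odd (a i) then x i else 0)" for i
  have "N0 (y i) \<le> 1" if "i < t" for i using x[OF that] by (simp add: y_def seminorm_zero[OF N(1)])
  then obtain \<sigma> where \<sigma>: "\<And>i. \<bar>\<sigma> i\<bar> = (1::real)" "\<And>s. s \<le> t \<Longrightarrow> N1 (\<Sum>i<s. \<sigma> i *\<^sub>R y i) \<le> R"
    using bounded_prefix_signsD[OF R, of t y] by metis
  \<comment> \<open>The numerator becomes half of \<open>a i + \<sigma> i\<close> when odd. The
    resulting change of the sum is a signed sum divided by \<open>2 ^ Suc b\<close>, so the errors
    over all digits form a geometric series below \<open>R\<close>.\<close>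
  define a' where "a' i = (if odd (a i) \<and> \<sigma> i = 1 then a i div 2 + 1 else a i div 2)" for i
  have a'_eq: "real (a' i) = (a i + (if odd (a i) then \<sigma> i else 0)) / 2" for i
    using \<sigma>(1)[of i] by (auto simp: a'_def abs_if elim!: oddE evenE split: if_splits)
  have a'_le: "a' i \<le> 2 ^ b" if "i < t" for i
    using Suc.prems[OF that] by (auto simp: a'_def elim!: oddE)
  have "\<exists>I\<subseteq>{..<t}. N1 ((\<Sum>i<t. (a' i / 2 ^ b) *\<^sub>R x i) - (\<Sum>i\<in>I. x i)) \<le> R * (1 - (1 / 2) ^ b)"
    by (rule Suc.IH[OF a'_le])
  then obtain I where I: "I \<subseteq> {..<t}"
    "N1 ((\<Sum>i<t. (a' i / 2 ^ b) *\<^sub>R x i) - (\<Sum>i\<in>I. x i)) \<le> R * (1 - (1 / 2) ^ b)" by blast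
  have "(\<Sum>i<t. (a' i / 2 ^ b) *\<^sub>R x i) - (\<Sum>i<t. (a i / 2 ^ Suc b) *\<^sub>R x i)
      = (\<Sum>i<t. (1 / 2 ^ Suc b) *\<^sub>R (\<sigma> i *\<^sub>R y i))"
    unfolding sum_subtractf[symmetric]
    by (intro sum.cong) (auto simp: a'_eq y_def scaleR_left_diff_distrib[symmetric] field_simps)
  also have "\<dots> = (1 / 2 ^ Suc b) *\<^sub>R (\<Sum>i<t. \<sigma> i *\<^sub>R y i)" by (simp only: scaleR_sum_right)
  finally have "N1 ((\<Sum>i<t. (a i / 2 ^ Suc b) *\<^sub>R x i) - (\<Sum>i<t. (a' i / 2 ^ b) *\<^sub>R x i)) \<le> R / 2 ^ Suc b"
    using \<sigma>(2)[of t] by (subst seminorm_minus_commute[OF N(2)]) (simp add: seminorm_scaleR[OF N(2)] divide_right_mono)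
  then have "N1 ((\<Sum>i<t. (a i / 2 ^ Suc b) *\<^sub>R x i) - (\<Sum>i\<in>I. x i)) \<le> R / 2 ^ Suc b + R * (1 - (1 / 2) ^ b)"
    using I(2) seminorm_add[OF N(2), of "(\<Sum>i<t. (a i / 2 ^ Suc b) *\<^sub>R x i) - (\<Sum>i<t. (a' i / 2 ^ b) *\<^sub>R x i)"
      "(\<Sum>i<t. (a' i / 2 ^ b) *\<^sub>R x i) - (\<Sum>i\<in>I. x i)"] by simp
  also have "\<dots> = R * (1 - (1 / 2) ^ Suc b)" by (simp add: field_simps power_one_over)
  finally show ?case using I(1) by blast
qed

text \<open>After division by \<open>\<delta>\<close> the coefficients are truncated to
  \<open>b\<close> binary digits at a total cost of at most 1, and the dyadic case costs at most
  \<open>R\<close>.\<close>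

lemma round_coefficients:
  fixes u :: "nat \<Rightarrow> 'a::real_vector"
  assumes N: "seminorm N0" "seminorm N1" and R: "bounded_prefix_signs N0 N1 R"
    and u: "\<And>k. k \<in> {m..<n} \<Longrightarrow> N0 (u k) \<le> \<delta>" and "\<delta> > 0"
    and \<tau>: "\<And>k. 0 \<le> \<tau> k \<and> \<tau> k \<le> (1::real)"
  shows "\<exists>I\<subseteq>{m..<n}. N1 ((\<Sum>k\<in>{m..<n}. \<tau> k *\<^sub>R u k) - (\<Sum>k\<in>I. u k)) \<le> (R + 1) * \<delta>"
proof -
  note R0 = bounded_prefix_signs_dominates[OF N R]
  \<comment> \<open>Padding with 0 below \<open>m\<close> lets the index start at 0; indices below
    \<open>m\<close> that the rounding selects are discarded in \<open>J\<close>.\<close>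
  define x where "x k = (if k \<ge> m then (1 / \<delta>) *\<^sub>R u k else 0)" for k
  have x: "N0 (x k) \<le> 1" if "k < n" for k
    using u[of k] that \<open>\<delta> > 0\<close> by (simp add: x_def seminorm_scaleR[OF N(1)] seminorm_zero[OF N(1)])
  \<comment> \<open>Each of the \<open>n\<close> truncations changes the sum by at most
    \<open>R / 2 ^ b\<close>.\<close>
  obtain b where b: "real n * R < 2 ^ b" using real_arch_pow[of 2 "real n * R"] by auto
  define a where "a k = nat \<lfloor>\<tau> k * 2 ^ b\<rfloor>" for k
  have af: "real (a k) \<le> \<tau> k * 2 ^ b" "\<tau> k * 2 ^ b \<le> a k + 1" for k
    using mult_nonneg_nonneg[of "\<tau> k" "2 ^ b"] \<tau>[of k] unfolding a_def by (simp, simp, linarith)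
  have a_le: "a k \<le> 2 ^ b" for k
  proof -
    have "\<tau> k * 2 ^ b \<le> 1 * 2 ^ b" using \<tau>[of k] by (intro mult_right_mono) auto
    then have "real (a k) \<le> 2 ^ b" using af(1)[of k] unfolding mult_1 by (rule order_trans[rotated])
    then have "real (a k) \<le> real (2 ^ b)" unfolding of_nat_power of_nat_numeral .
    then show ?thesis by (simp only: of_nat_le_iff)
  qed
  have "\<exists>I\<subseteq>{..<n}. N1 ((\<Sum>i<n. (a i / 2 ^ b) *\<^sub>R x i) - (\<Sum>i\<in>I. x i)) \<le> R * (1 - (1 / 2) ^ b)"
    by (rule round_dyadic_coefficients[OF N R x a_le])
  then obtain I where I: "I \<subseteq> {..<n}"
    "N1 ((\<Sum>i<n. (a i / 2 ^ b) *\<^sub>R x i) - (\<Sum>i\<in>I. x i)) \<le> R * (1 - (1 / 2) ^ b)" by blast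
  have "N1 ((\<Sum>i<n. \<tau> i *\<^sub>R x i) - (\<Sum>i<n. (a i / 2 ^ b) *\<^sub>R x i)) = N1 (\<Sum>i<n. (\<tau> i - a i / 2 ^ b) *\<^sub>R x i)"
    by (simp add: sum_subtractf[symmetric] scaleR_left_diff_distrib)
  also have "\<dots> \<le> real (card {..<n}) * (1 / 2 ^ b * R)"
  proof (rule seminorm_sum_le[OF N(2)])
    fix i assume "i \<in> {..<n}"
    then have "N1 (x i) \<le> R" using R0(2)[of "x i"] x[of i] mult_left_mono[OF _ R0(1), of "N0 (x i)" 1] by simp
    moreover have "\<bar>\<tau> i * 2 ^ b - a i\<bar> / 2 ^ b \<le> 1 / 2 ^ b" using af[of i] by (intro divide_right_mono) auto
    then have "\<bar>(\<tau> i * 2 ^ b - a i) / 2 ^ b\<bar> \<le> 1 / 2 ^ b" by simp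
    then have "\<bar>\<tau> i - a i / 2 ^ b\<bar> \<le> 1 / 2 ^ b" by (simp add: diff_divide_distrib)
    ultimately show "N1 ((\<tau> i - a i / 2 ^ b) *\<^sub>R x i) \<le> 1 / 2 ^ b * R"
      unfolding seminorm_scaleR[OF N(2)] using seminorm_nonneg[OF N(2)] by (intro mult_mono) auto
  qed
  also have "\<dots> \<le> 1" using b by (simp add: field_simps)
  finally have "N1 ((\<Sum>i<n. \<tau> i *\<^sub>R x i) - (\<Sum>i\<in>I. x i)) \<le> 1 + R * (1 - (1 / 2) ^ b)"
    using I(2) seminorm_add[OF N(2), of "(\<Sum>i<n. \<tau> i *\<^sub>R x i) - (\<Sum>i<n. (a i / 2 ^ b) *\<^sub>R x i)"
      "(\<Sum>i<n. (a i / 2 ^ b) *\<^sub>R x i) - (\<Sum>i\<in>I. x i)"] by simp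
  also have "\<dots> \<le> 1 + R * 1" using R0(1) by (intro add_left_mono mult_left_mono) auto
  finally have le: "N1 ((\<Sum>i<n. \<tau> i *\<^sub>R x i) - (\<Sum>i\<in>I. x i)) \<le> R + 1" by simp
  define J where "J = I \<inter> {m..}"
  have J: "J \<subseteq> {m..<n}" using I(1) by (auto simp: J_def)
  have "finite I" using I(1) finite_subset by blast
  have "(\<Sum>i<n. \<tau> i *\<^sub>R x i) = (\<Sum>i\<in>{m..<n}. \<tau> i *\<^sub>R x i)"
    by (rule sum.mono_neutral_right) (auto simp: x_def)
  also have "\<dots> = (1 / \<delta>) *\<^sub>R (\<Sum>i\<in>{m..<n}. \<tau> i *\<^sub>R u i)"
    unfolding scaleR_sum_right by (intro sum.cong) (auto simp: x_def)
  finally have 1: "(\<Sum>i<n. \<tau> i *\<^sub>R x i) = (1 / \<delta>) *\<^sub>R (\<Sum>i\<in>{m..<n}. \<tau> i *\<^sub>R u i)" .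
  have "(\<Sum>i\<in>I. x i) = (\<Sum>i\<in>J. x i)"
    using \<open>finite I\<close> by (intro sum.mono_neutral_right) (auto simp: x_def J_def)
  also have "\<dots> = (1 / \<delta>) *\<^sub>R (\<Sum>i\<in>J. u i)"
    unfolding scaleR_sum_right by (intro sum.cong) (auto simp: x_def J_def)
  finally have "N1 ((1 / \<delta>) *\<^sub>R ((\<Sum>i\<in>{m..<n}. \<tau> i *\<^sub>R u i) - (\<Sum>i\<in>J. u i))) \<le> R + 1"
    using le unfolding 1 scaleR_right_diff_distrib by simp
  then have "N1 ((\<Sum>i\<in>{m..<n}. \<tau> i *\<^sub>R u i) - (\<Sum>i\<in>J. u i)) \<le> (R + 1) * \<delta>"
    using \<open>\<delta> > 0\<close> unfolding seminorm_scaleR[OF N(2)] by (simp add: field_simps)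
  then show ?thesis using J by blast
qed

subsection \<open>Orderings with small prefix sums\<close>

text \<open>Reduces prefixes of the list of vectors of one sign to prefixes of the original
  ordering.\<close>

lemma take_filter_upt: "\<exists>j\<le>n. take s (filter P [0..<n]) = filter P [0..<j]"
proof (induction n)
  case (Suc n)
  show ?case
  proof (cases "s \<le> length (filter P [0..<n])")
    case True
    then show ?thesis using Suc by (auto intro: le_SucI)
  next
    case False
    then have "take s (filter P [0..<Suc n]) = filter P [0..<Suc n]" by auto
    then show ?thesis by blast
  qed
qed auto

text \<open>An ordering minimising the largest prefix sum is compared with the one that first lists
  the vectors of sign \<open>+\<close> in order and then those of sign \<open>-\<close> in reverse order.\<close>

lemma ordering_with_small_prefix_sums:
  fixes u :: "nat \<Rightarrow> 'a::real_vector"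
  assumes N: "seminorm N0" "seminorm N1" and R: "bounded_prefix_signs N0 N1 R"
    and A: "finite A" and u: "\<And>k. k \<in> A \<Longrightarrow> N0 (u k) \<le> \<delta>" and "\<delta> > 0"
    and T: "N1 (\<Sum>k\<in>A. u k) \<le> T"
  shows "\<exists>L. distinct L \<and> set L = A \<and> (\<forall>s. N1 (sum_list (map u (take s L))) \<le> 2 * T + R * \<delta>)"
proof -
  define w where "w L = Max ((\<lambda>s. N1 (sum_list (map u (take s L)))) ` {..length L})" for L
  define \<L> where "\<L> = {L. distinct L \<and> set L = A}"
  have "finite {L. set L \<subseteq> A \<and> length L \<le> card A}" by (rule finite_lists_length_le[OF A])
  then have "finite \<L>" by (rule finite_subset[rotated]) (auto simp: \<L>_def distinct_card)
  moreover have "\<L> \<noteq> {}" using finite_distinct_list[OF A] by (auto simp: \<L>_def)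
  ultimately obtain L where L: "L \<in> \<L>" and min: "\<And>L'. L' \<in> \<L> \<Longrightarrow> w L \<le> w L'"
    using ex_is_arg_min_if_finite[of \<L> w] by (auto simp: is_arg_min_linorder)
  have wI: "N1 (sum_list (map u (take s L'))) \<le> w L'" for s L'
  proof -
    have "take s L' = take (min s (length L')) L'" by (simp add: min_def)
    then show ?thesis unfolding w_def by (intro Max_ge) auto
  qed
  have wE: "w L' \<le> b" if "\<And>s. N1 (sum_list (map u (take s L'))) \<le> b" for b L'
    unfolding w_def using that by (intro Max.boundedI) auto
  define n where "n = length L"
  have LA: "distinct L" "set L = A" using L by (auto simp: \<L>_def)
  define x where "x i = (1 / \<delta>) *\<^sub>R u (L ! i)" for i
  have "N0 (x i) \<le> 1" if "i < n" for i
    using u[of "L ! i"] that LA \<open>\<delta> > 0\<close> by (auto simp: x_def n_def seminorm_scaleR[OF N(1)])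
  then obtain \<sigma> where \<sigma>: "\<And>i. \<bar>\<sigma> i\<bar> = (1::real)" "\<And>s. s \<le> n \<Longrightarrow> N1 (\<Sum>i<s. \<sigma> i *\<^sub>R x i) \<le> R"
    using bounded_prefix_signsD[OF R, of n x] by metis
  have \<sigma>u: "N1 (\<Sum>i<s. \<sigma> i *\<^sub>R u (L ! i)) \<le> R * \<delta>" if "s \<le> n" for s
  proof -
    have "(\<Sum>i<s. \<sigma> i *\<^sub>R x i) = (1 / \<delta>) *\<^sub>R (\<Sum>i<s. \<sigma> i *\<^sub>R u (L ! i))"
      by (simp add: x_def scaleR_sum_right mult.commute)
    then show ?thesis using \<sigma>(2)[OF that] \<open>\<delta> > 0\<close> by (simp add: seminorm_scaleR[OF N(2)] field_simps)
  qed
  have prefix: "N1 (\<Sum>i<s. u (L ! i)) \<le> w L" if "s \<le> n" for s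
  proof -
    have "take s L = map ((!) L) [0..<s]" using that by (intro nth_equalityI) (auto simp: n_def)
    then have "sum_list (map u (take s L)) = (\<Sum>i<s. u (L ! i))"
      by (simp add: interv_sum_list_conv_sum_set_nat atLeast0LessThan o_def)
    then show ?thesis using wI[of s L] by simp
  qed
  \<comment> \<open>Adding the plain prefix sum and \<open>\<rho>\<close> times the signed one
    doubles the terms of sign \<open>\<rho>\<close> and cancels the others.\<close>
  have half: "N1 (sum_list (map (\<lambda>i. u (L ! i)) (filter (\<lambda>i. \<sigma> i = \<rho>) [0..<j]))) \<le> (w L + R * \<delta>) / 2"
    if j: "j \<le> n" and \<rho>: "\<bar>\<rho>\<bar> = 1" for j \<rho>
  proof -
    let ?s = "sum_list (map (\<lambda>i. u (L ! i)) (filter (\<lambda>i. \<sigma> i = \<rho>) [0..<j]))"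
    have "?s = (\<Sum>i<j. if \<sigma> i = \<rho> then u (L ! i) else 0)"
      by (simp add: sum_list_map_filter' interv_sum_list_conv_sum_set_nat atLeast0LessThan)
    then have "2 *\<^sub>R ?s = (\<Sum>i<j. 2 *\<^sub>R (if \<sigma> i = \<rho> then u (L ! i) else 0))"
      by (simp only: scaleR_sum_right)
    also have "\<dots> = (\<Sum>i<j. u (L ! i) + \<rho> *\<^sub>R (\<sigma> i *\<^sub>R u (L ! i)))"
    proof (rule sum.cong)
      fix i
      have "\<sigma> i * \<rho> = (if \<sigma> i = \<rho> then 1 else - 1)" using \<sigma>(1)[of i] \<rho> by (auto simp: abs_if split: if_splits)
      then show "2 *\<^sub>R (if \<sigma> i = \<rho> then u (L ! i) else 0) = u (L ! i) + \<rho> *\<^sub>R (\<sigma> i *\<^sub>R u (L ! i))"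
        by (simp add: mult.commute scaleR_2 split: if_splits)
    qed simp
    also have "\<dots> = (\<Sum>i<j. u (L ! i)) + \<rho> *\<^sub>R (\<Sum>i<j. \<sigma> i *\<^sub>R u (L ! i))"
      by (simp only: sum.distrib scaleR_sum_right)
    finally have "N1 (2 *\<^sub>R ?s) \<le> w L + R * \<delta>"
      using seminorm_add[OF N(2), of "\<Sum>i<j. u (L ! i)" "\<rho> *\<^sub>R (\<Sum>i<j. \<sigma> i *\<^sub>R u (L ! i))"] prefix[OF j] \<sigma>u[OF j] \<rho>
      by (simp add: seminorm_scaleR[OF N(2)])
    then show ?thesis by (simp add: seminorm_scaleR[OF N(2)])
  qed
  define p where "p = filter (\<lambda>i. \<sigma> i = 1) [0..<n]"
  define q where "q = filter (\<lambda>i. \<sigma> i = - 1) [0..<n]"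
  define L' where "L' = map ((!) L) (p @ rev q)"
  have \<sigma>1: "\<sigma> i = 1 \<or> \<sigma> i = - 1" for i using \<sigma>(1)[of i] by (auto simp: abs_if split: if_splits)
  have "set (p @ rev q) = {..<n}" using \<sigma>1 by (auto simp: p_def q_def)
  moreover have "distinct (p @ rev q)" by (auto simp: p_def q_def)
  moreover have "inj_on ((!) L) {..<n}" using LA(1) by (auto simp: inj_on_def n_def nth_eq_iff_index_eq)
  moreover have "(!) L ` {..<n} = A" using LA(2) by (auto simp: n_def set_conv_nth)
  ultimately have L'A: "distinct L'" "set L' = A"
    unfolding L'_def distinct_map set_map by simp_all
  have T0: "0 \<le> T" using T seminorm_nonneg[OF N(2)] order_trans by blast
  have "w L' \<le> T + (w L + R * \<delta>) / 2"
  proof (rule wE)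
    fix s
    show "N1 (sum_list (map u (take s L'))) \<le> T + (w L + R * \<delta>) / 2"
    proof (cases "s \<le> length p")
      case True
      then have "take s L' = map ((!) L) (take s p)" by (simp add: L'_def take_map)
      moreover obtain j where "j \<le> n" "take s p = filter (\<lambda>i. \<sigma> i = 1) [0..<j]"
        unfolding p_def using take_filter_upt by blast
      ultimately show ?thesis using half[of j 1] T0 by (simp add: o_def, linarith)
    next
      case False
      \<comment> \<open>Because \<open>q\<close> is listed backwards, the part not yet listed is an
        initial segment of \<open>q\<close>. The prefix sum is the total minus that segment.\<close>
      then have "drop s L' = map ((!) L) (rev (take (length q - (s - length p)) q))"
        by (simp add: L'_def drop_map drop_rev)
      moreover obtain j where "j \<le> n" "take (length q - (s - length p)) q = filter (\<lambda>i. \<sigma> i = - 1) [0..<j]"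
        unfolding q_def using take_filter_upt by blast
      ultimately have d: "N1 (sum_list (map u (drop s L'))) \<le> (w L + R * \<delta>) / 2"
        using half[of j "- 1"] by (simp add: o_def rev_map[symmetric] sum_list_rev)
      have "sum_list (map u (take s L')) + sum_list (map u (drop s L')) = sum_list (map u L')"
        by (metis append_take_drop_id map_append sum_list_append)
      also have "\<dots> = (\<Sum>k\<in>A. u k)" using L'A by (simp add: sum_list_distinct_conv_sum_set)
      finally have eq: "sum_list (map u (take s L')) = (\<Sum>k\<in>A. u k) - sum_list (map u (drop s L'))"
        by (simp add: algebra_simps)
      show ?thesis unfolding eq
        using seminorm_diff[OF N(2), of "\<Sum>k\<in>A. u k" "sum_list (map u (drop s L'))"] d T by linarith
    qed
  qed
  \<comment> \<open>With minimality this reads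
    \<open>w L \<le> T + (w L + R * \<delta>) / 2\<close>, which is solved for
    \<open>w L\<close>.\<close>
  then have "2 * w L' \<le> 2 * T + (w L + R * \<delta>)" by (simp only: field_simps)
  moreover have "w L \<le> w L'" using min[of L'] L'A by (simp add: \<L>_def)
  ultimately have "w L \<le> 2 * T + R * \<delta>" by linarith
  then show ?thesis using LA wI order_trans by blast
qed

subsection \<open>Construction of the rearrangement\<close>

lemma finite_sets_with_prescribed_sum:
  fixes u :: "nat \<Rightarrow> 'a::real_vector"
  assumes N: "seminorm N0" "seminorm N1" and R: "bounded_prefix_signs N0 N1 R"
    and S: "(\<lambda>n. N0 ((\<Sum>k<n. u k) - S)) \<longlonglongrightarrow> 0"
    and approx: "\<And>m \<epsilon>. \<epsilon> > 0 \<Longrightarrow> \<exists>n\<ge>m. \<exists>t. (\<forall>k. \<bar>t k\<bar> \<le> (1::real)) \<and> N0 (2 *\<^sub>R x - (\<Sum>k\<in>{m..<n}. t k *\<^sub>R u k)) \<le> \<epsilon>"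
    and "\<epsilon> > 0"
  shows "\<exists>m0. \<forall>m\<ge>m0. \<exists>A. finite A \<and> {..<m} \<subseteq> A \<and> N1 ((\<Sum>k\<in>A. u k) - (S + x)) \<le> \<epsilon>"
proof -
  note R0 = bounded_prefix_signs_dominates[OF N R]
  \<comment> \<open>The errors are \<open>R * \<delta>\<close> from the mean of two partial sums,
    half of that from approximating \<open>2 *\<^sub>R x\<close>, and
    \<open>(R + 1) * (2 * \<delta>)\<close> from rounding; the factor \<open>5 * R + 2\<close>
    covers their total.\<close>
  define \<delta> where "\<delta> = \<epsilon> / (5 * R + 2)"
  have \<delta>: "\<delta> > 0" "\<delta> * (5 * R + 2) = \<epsilon>" using R0(1) \<open>\<epsilon> > 0\<close> by (simp_all add: \<delta>_def)
  obtain m0 where m0: "\<And>n. n \<ge> m0 \<Longrightarrow> N0 ((\<Sum>k<n. u k) - S) \<le> \<delta>"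
  proof -
    have "eventually (\<lambda>n. N0 ((\<Sum>k<n. u k) - S) < \<delta>) sequentially"
      using S \<delta>(1) by (rule order_tendstoD(2))
    then show thesis using that unfolding eventually_sequentially by (meson less_imp_le)
  qed
  have N1le: "N1 y \<le> R * d" if "N0 y \<le> d" for y d
    using R0(2)[of y] mult_left_mono[OF that R0(1)] by linarith
  show ?thesis
  proof (intro exI[of _ m0] allI impI)
    fix m assume m: "m \<ge> m0"
    obtain n t where n: "n \<ge> m" and t: "\<And>k. \<bar>t k\<bar> \<le> (1::real)"
      and tx: "N0 (2 *\<^sub>R x - (\<Sum>k\<in>{m..<n}. t k *\<^sub>R u k)) \<le> \<delta>"
      using approx[OF \<delta>(1), of m] by blast
    define \<tau> where "\<tau> k = (1 + t k) / 2" for k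
    have \<tau>: "0 \<le> \<tau> k \<and> \<tau> k \<le> 1" for k using t[of k] by (auto simp: \<tau>_def abs_le_iff)
    \<comment> \<open>A term is the difference of two consecutive partial sums, both within
      \<open>\<delta>\<close> of \<open>S\<close>; hence the doubled bound.\<close>
    have uk: "N0 (u k) \<le> 2 * \<delta>" if "k \<in> {m..<n}" for k
    proof -
      have "u k = ((\<Sum>i<Suc k. u i) - S) - ((\<Sum>i<k. u i) - S)" by simp
      then have "N0 (u k) \<le> N0 ((\<Sum>i<Suc k. u i) - S) + N0 ((\<Sum>i<k. u i) - S)"
        using seminorm_diff[OF N(1)] by metis
      then show ?thesis using m0[of "Suc k"] m0[of k] that m by auto
    qed
    have \<delta>2: "2 * \<delta> > 0" using \<delta>(1) by simp
    have "\<exists>I\<subseteq>{m..<n}. N1 ((\<Sum>k\<in>{m..<n}. \<tau> k *\<^sub>R u k) - (\<Sum>k\<in>I. u k)) \<le> (R + 1) * (2 * \<delta>)"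
      by (rule round_coefficients[OF N R uk \<delta>2 \<tau>])
    then obtain I where I: "I \<subseteq> {m..<n}"
      "N1 ((\<Sum>k\<in>{m..<n}. \<tau> k *\<^sub>R u k) - (\<Sum>k\<in>I. u k)) \<le> (R + 1) * (2 * \<delta>)" by blast
    define A where "A = {..<m} \<union> I"
    have finI: "finite I" using I(1) finite_subset by blast
    define P where "P = (\<Sum>k\<in>{m..<n}. t k *\<^sub>R u k)"
    have split: "(\<Sum>k<n. u k) = (\<Sum>k<m. u k) + (\<Sum>k\<in>{m..<n}. u k)"
      using sum.atLeastLessThan_concat[of 0 m n u] n by (simp add: atLeast0LessThan)
    have \<tau>u: "(\<Sum>k\<in>{m..<n}. \<tau> k *\<^sub>R u k) = (1 / 2) *\<^sub>R ((\<Sum>k\<in>{m..<n}. u k) + P)"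
      by (simp add: \<tau>_def P_def scaleR_sum_right sum.distrib[symmetric] scaleR_left_distrib scaleR_right_distrib add_divide_distrib)
    have "(\<Sum>k\<in>A. u k) = (\<Sum>k<m. u k) + (\<Sum>k\<in>I. u k)"
      unfolding A_def using I(1) finI by (intro sum.union_disjoint) auto
    then have "(\<Sum>k\<in>A. u k) - (S + x) =
        (1 / 2) *\<^sub>R (((\<Sum>k<m. u k) - S) + ((\<Sum>k<n. u k) - S)) - (1 / 2) *\<^sub>R (2 *\<^sub>R x - P)
        - ((\<Sum>k\<in>{m..<n}. \<tau> k *\<^sub>R u k) - (\<Sum>k\<in>I. u k))"
      unfolding \<tau>u split by (simp add: algebra_simps scaleR_2[symmetric] flip: scaleR_left.add)
    also have "N1 \<dots> \<le> R * \<delta> + R * \<delta> / 2 + (R + 1) * (2 * \<delta>)"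
    proof -
      have 1: "N1 (((\<Sum>k<m. u k) - S) + ((\<Sum>k<n. u k) - S)) \<le> R * \<delta> + R * \<delta>"
        using N1le[OF m0[of m]] N1le[OF m0[of n]] m n seminorm_add[OF N(2)]
        by (meson add_mono order_trans)
      have 2: "N1 (2 *\<^sub>R x - P) \<le> R * \<delta>" using N1le[OF tx] by (simp add: P_def)
      have "N1 (a *\<^sub>R y - a *\<^sub>R z - w) \<le> \<bar>a\<bar> * N1 y + \<bar>a\<bar> * N1 z + N1 w" for a y z w
        using seminorm_diff[OF N(2), of "a *\<^sub>R y - a *\<^sub>R z" w] seminorm_diff[OF N(2), of "a *\<^sub>R y" "a *\<^sub>R z"]
        by (simp add: seminorm_scaleR[OF N(2)])
      from this[of "1 / 2" "((\<Sum>k<m. u k) - S) + ((\<Sum>k<n. u k) - S)" "2 *\<^sub>R x - P" "(\<Sum>k\<in>{m..<n}. \<tau> k *\<^sub>R u k) - (\<Sum>k\<in>I. u k)"]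
      show ?thesis using 1 2 I(2) by simp
    qed
    also have "\<dots> \<le> \<delta> * (5 * R + 2)"
      using mult_nonneg_nonneg[OF R0(1) less_imp_le[OF \<delta>(1)]] by (simp add: algebra_simps)
    finally have "N1 ((\<Sum>k\<in>A. u k) - (S + x)) \<le> \<epsilon>" by (simp add: \<delta>(2))
    then show "\<exists>A. finite A \<and> {..<m} \<subseteq> A \<and> N1 ((\<Sum>k\<in>A. u k) - (S + x)) \<le> \<epsilon>"
      using finI by (intro exI[of _ A]) (auto simp: A_def)
  qed
qed

text \<open>The sets \<open>A j\<close> control the sums at sparse times. Between two such times the
  ordering lemma applies, since the block has a small total and consists of small terms.\<close>

lemma rearrangement_converges:
  fixes u :: "nat \<Rightarrow> 'a::real_vector"
  assumes N: "seminorm N0" "seminorm N1" and R: "bounded_prefix_signs N0 N1 R"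
    and u0: "(\<lambda>n. N0 (u n)) \<longlonglongrightarrow> 0"
    and sets: "\<And>\<epsilon>. \<epsilon> > 0 \<Longrightarrow> \<exists>m0. \<forall>m\<ge>m0. \<exists>A. finite A \<and> {..<m} \<subseteq> A \<and> N1 ((\<Sum>k\<in>A. u k) - y) \<le> \<epsilon>"
  shows "\<exists>\<pi>::nat \<Rightarrow> nat. bij \<pi> \<and> (\<lambda>n. N1 ((\<Sum>k<n. u (\<pi> k)) - y)) \<longlonglongrightarrow> 0"
proof -
  have R0: "0 \<le> R" by (rule bounded_prefix_signs_dominates[OF N R])
  have "\<exists>m\<ge>j. \<forall>k\<ge>m. N0 (u k) \<le> 1 / real (Suc j)" for j
  proof -
    have "eventually (\<lambda>n. N0 (u n) < 1 / real (Suc j)) sequentially"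
      using u0 by (rule order_tendstoD(2)) simp
    then obtain m where "\<forall>k\<ge>m. N0 (u k) < 1 / real (Suc j)" unfolding eventually_sequentially by blast
    then show ?thesis by (intro exI[of _ "max m j"]) (auto intro: less_imp_le)
  qed
  then obtain M where M: "\<And>j. M j \<ge> j" "\<And>j k. k \<ge> M j \<Longrightarrow> N0 (u k) \<le> 1 / real (Suc j)"
    by metis
  \<comment> \<open>Containing \<open>{..<M j}\<close> has two effects: all terms added after
    \<open>A j\<close> are small in \<open>N0\<close>, and, as \<open>M j \<ge> j\<close>, the sets
    exhaust the natural numbers.\<close>
  define Q where "Q j A \<longleftrightarrow> finite A \<and> {..<M j} \<subseteq> A \<and> N1 ((\<Sum>k\<in>A. u k) - y) \<le> 1 / real (Suc j)" for j A
  have ex: "\<exists>A'. Q j A' \<and> A \<subseteq> A'" if A: "finite A" for j A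
  proof -
    obtain m0 where m0: "\<forall>m\<ge>m0. \<exists>A. finite A \<and> {..<m} \<subseteq> A \<and> N1 ((\<Sum>k\<in>A. u k) - y) \<le> 1 / real (Suc j)"
      using sets[of "1 / real (Suc j)"] by auto
    obtain b where b: "\<forall>a\<in>A. a < b" using finite_nat_set_iff_bounded A by blast
    define m where "m = max m0 (max b (M j))"
    obtain A' where A': "finite A'" "{..<m} \<subseteq> A'" "N1 ((\<Sum>k\<in>A'. u k) - y) \<le> 1 / real (Suc j)"
      using m0 unfolding m_def by (meson max.cobounded1)
    have "{..<M j} \<subseteq> {..<m}" "A \<subseteq> {..<m}" using b by (auto simp: m_def)
    from this[THEN subset_trans, OF A'(2)] show ?thesis using A'(1,3) by (intro exI[of _ A']) (simp add: Q_def)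
  qed
  have "\<exists>f. \<forall>n. Q n (f n) \<and> f n \<subseteq> f (Suc n)"
  proof (rule dependent_nat_choice)
    show "\<exists>x. Q 0 x" using ex[of "{}" 0] by auto
    show "\<exists>y. Q (Suc n) y \<and> x \<subseteq> y" if "Q n x" for x n using that by (intro ex) (simp add: Q_def)
  qed
  then obtain A where A: "\<And>j. Q j (A j)" "\<And>j. A j \<subseteq> A (Suc j)" by blast
  have finA: "finite (A j)" and MA: "{..<M j} \<subseteq> A j" and Ay: "N1 ((\<Sum>k\<in>A j. u k) - y) \<le> 1 / real (Suc j)" for j
    using A(1)[of j] by (auto simp: Q_def)
  have "\<exists>L. distinct L \<and> set L = A (Suc j) - A j \<and>
      (\<forall>s. N1 (sum_list (map u (take s L))) \<le> 2 * (2 / real (Suc j)) + R * (1 / real (Suc j)))" for j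
  proof (rule ordering_with_small_prefix_sums[OF N R])
    show "N0 (u k) \<le> 1 / real (Suc j)" if "k \<in> A (Suc j) - A j" for k
      using that MA[of j] by (intro M(2)) (auto simp: not_less[symmetric])
    have "(\<Sum>k\<in>A (Suc j) - A j. u k) = ((\<Sum>k\<in>A (Suc j). u k) - y) - ((\<Sum>k\<in>A j. u k) - y)"
      by (simp add: sum_diff finA A(2))
    then have "N1 (\<Sum>k\<in>A (Suc j) - A j. u k) \<le> 1 / real (Suc (Suc j)) + 1 / real (Suc j)"
      using seminorm_diff[OF N(2), of "(\<Sum>k\<in>A (Suc j). u k) - y" "(\<Sum>k\<in>A j. u k) - y"] Ay[of j] Ay[of "Suc j"] by simp
    also have "\<dots> \<le> 1 / real (Suc j) + 1 / real (Suc j)" by (intro add_right_mono divide_left_mono) auto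
    finally show "N1 (\<Sum>k\<in>A (Suc j) - A j. u k) \<le> 2 / real (Suc j)" by simp
  qed (use finA in auto)
  then obtain l where l: "\<And>j. distinct (l j)" "\<And>j. set (l j) = A (Suc j) - A j"
    "\<And>j s. N1 (sum_list (map u (take s (l j)))) \<le> 2 * (2 / real (Suc j)) + R * (1 / real (Suc j))"
    by metis
  obtain l0 where l0: "distinct l0" "set l0 = A 0" using finite_distinct_list[OF finA[of 0]] by blast
  define L where "L j = l0 @ concat (map l [0..<j])" for j
  have LSuc: "L (Suc j) = L j @ l j" for j by (simp add: L_def)
  have L: "distinct (L j)" "set (L j) = A j" for j
  proof (induction j)
    case (Suc j)
    case 1
    show ?case using Suc l(1,2)[of j] by (auto simp: LSuc)
    case 2
    show ?case using Suc l(2)[of j] A(2)[of j] by (auto simp: LSuc)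
  qed (use l0 in \<open>auto simp: L_def\<close>)
  have len: "j \<le> length (L j)" for j
  proof -
    have "j \<le> card {..<M j}" using M(1) by simp
    also have "\<dots> \<le> card (A j)" by (rule card_mono[OF finA MA])
    also have "\<dots> = length (L j)" using L[of j] distinct_card by metis
    finally show ?thesis .
  qed
  have ext: "\<exists>zs. L (i + d) = L i @ zs" for i d
    by (induction d) (auto simp: LSuc)
  have nth_eq: "L i ! n = L j ! n" if "i \<le> j" "n < length (L i)" for i j n
    using ext[of i "j - i"] that by (auto simp: nth_append)
  \<comment> \<open>\<open>L (Suc n)\<close> has at least \<open>Suc n\<close> entries, so
    \<open>n\<close> is a valid index; the lists extend each other, so every sufficiently long list
    gives the same entry.\<close>
  define \<pi> where "\<pi> n = L (Suc n) ! n" for n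
  have \<pi>: "\<pi> n = L j ! n" if "n < length (L j)" for n j
  proof (cases "Suc n \<le> j")
    case True
    then show ?thesis using len[of "Suc n"] unfolding \<pi>_def by (intro nth_eq) auto
  next
    case False
    then show ?thesis using that unfolding \<pi>_def by (intro nth_eq[symmetric]) auto
  qed
  have "inj \<pi>"
  proof (rule injI)
    fix a b assume ab: "\<pi> a = \<pi> b"
    define j where "j = Suc (max a b)"
    have "a < length (L j)" "b < length (L j)" using len[of j] by (auto simp: j_def)
    then show "a = b" using ab \<pi>[of a j] \<pi>[of b j] L(1)[of j] by (simp add: nth_eq_iff_index_eq)
  qed
  moreover have "surj \<pi>"
  proof -
    have "\<exists>i. \<pi> i = k" for k
    proof -
      have "k \<in> A (Suc k)" using MA[of "Suc k"] M(1)[of "Suc k"] by auto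
      then obtain i where "i < length (L (Suc k))" "L (Suc k) ! i = k"
        using L(2)[of "Suc k"] by (metis in_set_conv_nth)
      then show ?thesis using \<pi> by metis
    qed
    then show ?thesis by (metis surjI)
  qed
  ultimately have "bij \<pi>" by (simp add: bij_def)
  have sum_eq: "(\<Sum>k<n. u (\<pi> k)) = sum_list (map u (take n (L j)))" if "n \<le> length (L j)" for n j
  proof -
    have "take n (L j) = map \<pi> [0..<n]" using that by (intro nth_equalityI) (auto simp: \<pi>[of _ j])
    then show ?thesis by (simp add: interv_sum_list_conv_sum_set_nat atLeast0LessThan o_def)
  qed
  have sumL: "sum_list (map u (L j)) = (\<Sum>k\<in>A j. u k)" for j
    using L[of j] by (simp add: sum_list_distinct_conv_sum_set)
  \<comment> \<open>The 5 is 1 for the sum over \<open>A j\<close> and 4 for twice the block total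
    \<open>2 / Suc j\<close>; \<open>R\<close> comes from the size of the single terms.\<close>
  have block: "N1 ((\<Sum>k<n. u (\<pi> k)) - y) \<le> (5 + R) / real (Suc J)"
    if "J \<le> j" "length (L J) \<le> n" "n \<le> length (L j)" for J j n
    using that
  proof (induction j arbitrary: n rule: dec_induct)
    case base
    then have "N1 ((\<Sum>k<n. u (\<pi> k)) - y) \<le> 1 / real (Suc J)"
      using sum_eq[of n J] sumL[of J] Ay[of J] by simp
    also have "\<dots> \<le> (5 + R) / real (Suc J)" using R0 by (intro divide_right_mono) auto
    finally show ?case .
  next
    case (step j)
    show ?case
    proof (cases "n \<le> length (L j)")
      case True
      then show ?thesis using step by blast
    next
      case False
      define s where "s = n - length (L j)"
      have "(\<Sum>k<n. u (\<pi> k)) = sum_list (map u (L j)) + sum_list (map u (take s (l j)))"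
        using False sum_eq[OF step.prems(2)] by (simp add: LSuc s_def)
      then have "N1 ((\<Sum>k<n. u (\<pi> k)) - y) \<le> N1 ((\<Sum>k\<in>A j. u k) - y) + N1 (sum_list (map u (take s (l j))))"
        using seminorm_add[OF N(2), of "(\<Sum>k\<in>A j. u k) - y" "sum_list (map u (take s (l j)))"]
        by (simp add: sumL algebra_simps)
      also have "\<dots> \<le> 1 / real (Suc j) + (2 * (2 / real (Suc j)) + R * (1 / real (Suc j)))"
        by (intro add_mono Ay l(3))
      also have "\<dots> = (5 + R) / real (Suc j)" by (simp add: add_divide_distrib)
      also have "\<dots> \<le> (5 + R) / real (Suc J)" using R0 step.hyps by (intro divide_left_mono) auto
      finally show ?thesis .
    qed
  qed
  have "(\<lambda>n. N1 ((\<Sum>k<n. u (\<pi> k)) - y)) \<longlonglongrightarrow> 0"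
  proof (rule LIMSEQ_I)
    fix r :: real assume "r > 0"
    obtain J :: nat where J: "(5 + R) / r < real J" using reals_Archimedean2 by blast
    then have "(5 + R) / real (Suc J) < r"
      using \<open>r > 0\<close> by (simp add: field_simps)
    then have "norm (N1 ((\<Sum>k<n. u (\<pi> k)) - y) - 0) < r" if "n \<ge> length (L J)" for n
      using block[of J n n] that len[of J] len[of n] seminorm_nonneg[OF N(2), of "(\<Sum>k<n. u (\<pi> k)) - y"] by simp
    then show "\<exists>no. \<forall>n\<ge>no. norm (N1 ((\<Sum>k<n. u (\<pi> k)) - y) - 0) < r" by blast
  qed
  then show ?thesis using \<open>bij \<pi>\<close> by blast
qed

subsection \<open>Gauges of disks\<close>

lemma absolutely_convexD:
  "absolutely_convex B \<Longrightarrow> x \<in> B \<Longrightarrow> y \<in> B \<Longrightarrow> \<bar>a\<bar> + \<bar>b\<bar> \<le> 1 \<Longrightarrow> a *\<^sub>R x + b *\<^sub>R y \<in> B"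
  by (simp add: absolutely_convex_def)

lemma absolutely_convex_scaleR: "absolutely_convex B \<Longrightarrow> x \<in> B \<Longrightarrow> \<bar>c\<bar> \<le> 1 \<Longrightarrow> c *\<^sub>R x \<in> B"
  using absolutely_convexD[of B x x c 0] by simp

lemma absolutely_convex_zero: "absolutely_convex B \<Longrightarrow> 0 \<in> B"
  using absolutely_convex_scaleR[of B _ 0] by (auto simp: absolutely_convex_def)

lemma scaled_disk_mono:
  assumes "absolutely_convex B" "x \<in> scaleR s ` B" "\<bar>s\<bar> \<le> t" "t > 0"
  shows "x \<in> scaleR t ` B"
proof -
  obtain b where b: "b \<in> B" "x = s *\<^sub>R b" using assms(2) by blast
  have "(s / t) *\<^sub>R b \<in> B" using assms b by (intro absolutely_convex_scaleR) auto
  moreover have "x = t *\<^sub>R ((s / t) *\<^sub>R b)" using b assms by simp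
  ultimately show ?thesis by blast
qed

lemma scaled_disk_add:
  assumes "absolutely_convex B" "x \<in> scaleR s ` B" "y \<in> scaleR t ` B" "s > 0" "t > 0"
  shows "x + y \<in> scaleR (s + t) ` B"
proof -
  obtain b c where b: "b \<in> B" "x = s *\<^sub>R b" "c \<in> B" "y = t *\<^sub>R c" using assms(2,3) by blast
  have "(s / (s + t)) *\<^sub>R b + (t / (s + t)) *\<^sub>R c \<in> B"
    using assms b by (intro absolutely_convexD) (auto simp: add_divide_distrib[symmetric])
  moreover have "x + y = (s + t) *\<^sub>R ((s / (s + t)) *\<^sub>R b + (t / (s + t)) *\<^sub>R c)"
    using b assms by (simp add: scaleR_add_right)
  ultimately show ?thesis by blast
qed

lemma scaled_disk_scaleR:
  assumes "absolutely_convex B" "x \<in> scaleR s ` B"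
  shows "c *\<^sub>R x \<in> scaleR (\<bar>c\<bar> * s) ` B"
proof -
  obtain b where b: "b \<in> B" "x = s *\<^sub>R b" using assms(2) by blast
  have "sgn c *\<^sub>R b \<in> B" using assms b by (intro absolutely_convex_scaleR) (auto simp: sgn_if)
  moreover have "c *\<^sub>R x = (\<bar>c\<bar> * s) *\<^sub>R (sgn c *\<^sub>R b)" using b by (simp add: sgn_if)
  ultimately show ?thesis by blast
qed

lemma span_disk:
  assumes B: "absolutely_convex B"
  shows "span B = {x. \<exists>t>0. x \<in> scaleR t ` B}"
proof
  have "subspace {x. \<exists>t>0. x \<in> scaleR t ` B}"
  proof (rule subspaceI)
    show "0 \<in> {x. \<exists>t>0. x \<in> scaleR t ` B}"
      using absolutely_convex_zero[OF B] by (force intro: exI[of _ 1])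
    show "x + y \<in> {x. \<exists>t>0. x \<in> scaleR t ` B}"
      if xy: "x \<in> {x. \<exists>t>0. x \<in> scaleR t ` B}" "y \<in> {x. \<exists>t>0. x \<in> scaleR t ` B}" for x y
    proof -
      obtain s t where "s > 0" "x \<in> scaleR s ` B" "t > 0" "y \<in> scaleR t ` B" using xy by blast
      then have "s + t > 0" "x + y \<in> scaleR (s + t) ` B" by (auto intro: scaled_disk_add[OF B])
      then show ?thesis by blast
    qed
    show "c *\<^sub>R x \<in> {x. \<exists>t>0. x \<in> scaleR t ` B}" if x: "x \<in> {x. \<exists>t>0. x \<in> scaleR t ` B}" for c x
    proof -
      obtain t where t: "t > 0" "x \<in> scaleR t ` B" using x by blast
      have "c *\<^sub>R x \<in> scaleR (\<bar>c\<bar> * t + 1) ` B"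
        using t by (intro scaled_disk_mono[OF B scaled_disk_scaleR[OF B t(2)]]) (auto intro: add_nonneg_pos)
      moreover have "\<bar>c\<bar> * t + 1 > 0" using t by (intro add_nonneg_pos) auto
      ultimately show ?thesis by blast
    qed
  qed
  moreover have "B \<subseteq> {x. \<exists>t>0. x \<in> scaleR t ` B}" by (force intro: exI[of _ 1])
  ultimately show "span B \<subseteq> {x. \<exists>t>0. x \<in> scaleR t ` B}" by (rule span_minimal[rotated])
  show "{x. \<exists>t>0. x \<in> scaleR t ` B} \<subseteq> span B" by (auto intro: span_base span_scale)
qed

lemma gauge_set_bdd_below: "bdd_below {t. 0 < t \<and> x \<in> scaleR t ` B}"
  by (rule bdd_belowI[of _ 0]) auto

lemma gauge_nonneg: "absolutely_convex B \<Longrightarrow> x \<in> span B \<Longrightarrow> 0 \<le> minkowski_gauge B x"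
  unfolding minkowski_gauge_def by (rule cInf_greatest) (auto simp: span_disk)

lemma gauge_le: "0 < t \<Longrightarrow> x \<in> scaleR t ` B \<Longrightarrow> minkowski_gauge B x \<le> t"
  unfolding minkowski_gauge_def by (rule cInf_lower[OF _ gauge_set_bdd_below]) auto

lemma gauge_lessD:
  assumes B: "absolutely_convex B" and "x \<in> span B" "minkowski_gauge B x < t"
  shows "x \<in> scaleR t ` B"
proof -
  have "{t. 0 < t \<and> x \<in> scaleR t ` B} \<noteq> {}" using assms(2) by (auto simp: span_disk[OF B])
  then obtain s where "s \<in> {t. 0 < t \<and> x \<in> scaleR t ` B}" "s < t"
    using cInf_lessD assms(3) unfolding minkowski_gauge_def by meson
  then have s: "0 < s" "x \<in> scaleR s ` B" "s < t" by blast+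
  show ?thesis using s(1,3) by (intro scaled_disk_mono[OF B s(2)]) linarith+
qed

lemma gauge_add:
  assumes B: "absolutely_convex B" and x: "x \<in> span B" and y: "y \<in> span B"
  shows "minkowski_gauge B (x + y) \<le> minkowski_gauge B x + minkowski_gauge B y"
proof (rule field_le_epsilon)
  fix e :: real assume e: "e > 0"
  let ?s = "minkowski_gauge B x + e / 2" and ?t = "minkowski_gauge B y + e / 2"
  have pos: "?s > 0" "?t > 0" using gauge_nonneg[OF B] x y e by (auto intro: add_nonneg_pos)
  have "x + y \<in> scaleR (?s + ?t) ` B"
    using e pos by (intro scaled_disk_add[OF B] gauge_lessD[OF B] x y) auto
  then show "minkowski_gauge B (x + y) \<le> minkowski_gauge B x + minkowski_gauge B y + e"
    using gauge_le[of "?s + ?t" "x + y" B] pos by simp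
qed

lemma gauge_scaleR:
  assumes B: "absolutely_convex B" and x: "x \<in> span B"
  shows "minkowski_gauge B (c *\<^sub>R x) = \<bar>c\<bar> * minkowski_gauge B x"
proof (rule antisym)
  have le: "minkowski_gauge B (c *\<^sub>R x) \<le> \<bar>c\<bar> * minkowski_gauge B x" if x: "x \<in> span B" for c x
  proof (rule field_le_epsilon)
    fix e :: real assume e: "e > 0"
    \<comment> \<open>The denominator \<open>\<bar>c\<bar> + 1\<close> keeps the enlargement
      positive and finite also for \<open>c = 0\<close>, and its multiple by
      \<open>\<bar>c\<bar>\<close> below \<open>e\<close>.\<close>
    let ?t = "minkowski_gauge B x + e / (\<bar>c\<bar> + 1)"
    have c: "0 < \<bar>c\<bar> + 1" by simp
    have "x \<in> scaleR ?t ` B" using e c by (intro gauge_lessD[OF B x]) auto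
    then have cx: "c *\<^sub>R x \<in> scaleR (\<bar>c\<bar> * ?t) ` B" by (rule scaled_disk_scaleR[OF B])
    have "\<bar>c\<bar> * ?t < \<bar>c\<bar> * minkowski_gauge B x + e"
      using e c by (simp add: distrib_left field_simps)
    moreover have "0 \<le> \<bar>c\<bar> * ?t" using gauge_nonneg[OF B x] e c by (intro mult_nonneg_nonneg add_nonneg_nonneg) auto
    ultimately have "\<bar>\<bar>c\<bar> * ?t\<bar> \<le> \<bar>c\<bar> * minkowski_gauge B x + e" "0 < \<bar>c\<bar> * minkowski_gauge B x + e" by linarith+
    then show "minkowski_gauge B (c *\<^sub>R x) \<le> \<bar>c\<bar> * minkowski_gauge B x + e"
      by (intro gauge_le scaled_disk_mono[OF B cx])
  qed
  show "minkowski_gauge B (c *\<^sub>R x) \<le> \<bar>c\<bar> * minkowski_gauge B x" by (rule le[OF x])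
  show "\<bar>c\<bar> * minkowski_gauge B x \<le> minkowski_gauge B (c *\<^sub>R x)"
  proof (cases "c = 0")
    case False
    have "minkowski_gauge B ((1 / c) *\<^sub>R (c *\<^sub>R x)) \<le> \<bar>1 / c\<bar> * minkowski_gauge B (c *\<^sub>R x)"
      by (intro le span_scale x)
    then show ?thesis using False by (simp add: field_simps)
  qed (use gauge_nonneg[OF B span_zero] in simp)
qed

text \<open>Off the span the gauge is an infimum over the empty set. Composition with
  \<open>P\<close> avoids such values, and for a projection it agrees with the gauge on the
  span.\<close>

lemma seminorm_gauge:
  assumes "absolutely_convex B" "linear P" "range P \<subseteq> span B"
  shows "seminorm (\<lambda>x. minkowski_gauge B (P x))"
proof -
  have "P x \<in> span B" for x using assms(3) by blast
  then show ?thesis unfolding seminorm_def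
    by (simp add: linear_add[OF assms(2)] linear_scale[OF assms(2)] gauge_scaleR[OF assms(1)] gauge_add[OF assms(1)])
qed

lemma gauge_antimono:
  assumes "absolutely_convex B" "B \<subseteq> C" "x \<in> span B"
  shows "minkowski_gauge C x \<le> minkowski_gauge B x"
  unfolding minkowski_gauge_def
  using assms by (intro cInf_superset_mono gauge_set_bdd_below) (auto simp: span_disk)

lemma ex_span_projection:
  fixes B :: "'a::real_vector set"
  shows "\<exists>P. linear P \<and> range P \<subseteq> span B \<and> (\<forall>x\<in>span B. P x = x)"
  using linear_exists_left_inverse_on[OF linear_id subspace_span, of B] by auto

lemma disk_dual_linear_comp:
  assumes "f \<in> disk_dual B" "linear P" "range P \<subseteq> span B"
  shows "linear (\<lambda>x. f (P x))"
  using assms by (intro linearI) (auto simp: disk_dual_def linear_add linear_scale range_subsetD)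

text \<open>The constant in \<open>disk_dual\<close> makes the supremum finite; it is also needed
  where the gauge vanishes, since such vectors cannot be normalised.\<close>

lemma disk_dual_bound:
  assumes B: "absolutely_convex B" and f: "f \<in> disk_dual B" and x: "x \<in> span B"
  shows "\<bar>f x\<bar> \<le> disk_dual_norm B f * minkowski_gauge B x" and "0 \<le> disk_dual_norm B f"
proof -
  obtain K where K: "\<And>x. x \<in> span B \<Longrightarrow> \<bar>f x\<bar> \<le> K * minkowski_gauge B x"
    using f unfolding disk_dual_def by blast
  have scale: "f (c *\<^sub>R y) = c * f y" if "y \<in> span B" for c y using f that by (simp add: disk_dual_def)
  have "\<bar>f y\<bar> \<le> \<bar>K\<bar>" if "y \<in> span B" "minkowski_gauge B y \<le> 1" for y
  proof -
    have "\<bar>f y\<bar> \<le> \<bar>K\<bar> * minkowski_gauge B y"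
      using K[OF that(1)] gauge_nonneg[OF B that(1)] by (meson abs_ge_self mult_right_mono order_trans)
    also have "\<dots> \<le> \<bar>K\<bar> * 1" using that(2) by (intro mult_left_mono) auto
    finally show ?thesis by simp
  qed
  then have bdd: "bdd_above ((\<lambda>x. \<bar>f x\<bar>) ` {x \<in> span B. minkowski_gauge B x \<le> 1})"
    by (intro bdd_aboveI2) auto
  have le: "\<bar>f y\<bar> \<le> disk_dual_norm B f" if "y \<in> span B" "minkowski_gauge B y \<le> 1" for y
    unfolding disk_dual_norm_def using that by (intro cSUP_upper bdd) auto
  have "minkowski_gauge B 0 = 0" using gauge_scaleR[OF B span_zero, of 0] by simp
  then show "0 \<le> disk_dual_norm B f" using le[of 0] span_zero by (metis abs_ge_zero order_trans zero_le_one)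
  show "\<bar>f x\<bar> \<le> disk_dual_norm B f * minkowski_gauge B x"
  proof (cases "minkowski_gauge B x = 0")
    case True
    then show ?thesis using K[OF x] by simp
  next
    case False
    then have pos: "minkowski_gauge B x > 0" using gauge_nonneg[OF B x] by simp
    have "\<bar>f ((1 / minkowski_gauge B x) *\<^sub>R x)\<bar> \<le> disk_dual_norm B f"
      using pos by (intro le span_scale x) (simp add: gauge_scaleR[OF B x])
    then show ?thesis using pos by (simp add: scale[OF x] abs_mult field_simps)
  qed
qed

subsection \<open>Bounded disks in locally convex spaces\<close>

lemma tendsto_scaleR_locally_convex:
  fixes g :: "'b \<Rightarrow> 'a::locally_convex_space"
  assumes "(f \<longlongrightarrow> a) F" "(g \<longlongrightarrow> b) F"
  shows "((\<lambda>x. f x *\<^sub>R g x) \<longlongrightarrow> a *\<^sub>R b) F"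
  using filterlim_compose[OF tendsto_scaleR_nhds filterlim_Pair[OF assms]] by simp

lemma continuous_on_scaleR_locally_convex:
  fixes g :: "'b::topological_space \<Rightarrow> 'a::locally_convex_space"
  assumes "continuous_on S g"
  shows "continuous_on S (\<lambda>x. c *\<^sub>R g x)"
  using assms unfolding continuous_on_def by (auto intro: tendsto_scaleR_locally_convex)

lemma open_zero_add:
  fixes U :: "'a::locally_convex_space set"
  assumes "open U" "0 \<in> U"
  shows "\<exists>V. open V \<and> 0 \<in> V \<and> (\<forall>x\<in>V. \<forall>y\<in>V. x + y \<in> U)"
proof -
  have "open ((\<lambda>p::'a \<times> 'a. fst p + snd p) -` U)"
    using assms(1) by (intro open_vimage continuous_intros)
  moreover have "(0, 0) \<in> (\<lambda>p::'a \<times> 'a. fst p + snd p) -` U" using assms(2) by simp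
  ultimately obtain A B where "open A" "open B" "(0, 0) \<in> A \<times> B" "A \<times> B \<subseteq> (\<lambda>p. fst p + snd p) -` U"
    by (rule open_prod_elim)
  then show ?thesis by (intro exI[of _ "A \<inter> B"]) auto
qed

text \<open>If \<open>B\<close> lies in \<open>t\<close> times a neighbourhood \<open>V\<close>,
  then gauge below \<open>1 / t\<close> means membership in \<open>V\<close>.\<close>

lemma disk_convergence_imp_tendsto:
  fixes B :: "'a::locally_convex_space set"
  assumes B: "absolutely_convex B" "tvs_bounded B" and conv: "converges_in_disk_to B s x"
  shows "s \<longlonglongrightarrow> x"
proof (rule topological_tendstoI)
  fix U assume U: "open U" "x \<in> U"
  define V where "V = (\<lambda>y. x + y) -` U"
  have "open V" unfolding V_def using U(1) by (intro open_vimage continuous_intros)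
  moreover have "0 \<in> V" using U(2) by (simp add: V_def)
  ultimately obtain r where r: "r > 0" "\<And>t. t > r \<Longrightarrow> B \<subseteq> scaleR t ` V"
    using B(2) unfolding tvs_bounded_def by blast
  define t where "t = r + 1"
  have t: "t > 0" "B \<subseteq> scaleR t ` V" using r(1) r(2)[of t] by (simp_all add: t_def)
  have sp: "s n - x \<in> span B" for n
    using conv unfolding converges_in_disk_to_def by (intro span_diff) auto
  have "(\<lambda>n. minkowski_gauge B (s n - x)) \<longlonglongrightarrow> 0" using conv by (simp add: converges_in_disk_to_def)
  then have "\<forall>\<^sub>F n in sequentially. minkowski_gauge B (s n - x) < 1 / t"
    using t(1) by (intro order_tendstoD(2)) auto
  then show "\<forall>\<^sub>F n in sequentially. s n \<in> U"
  proof eventually_elim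
    case (elim n)
    then obtain b where "b \<in> B" "s n - x = (1 / t) *\<^sub>R b" using gauge_lessD[OF B(1) sp] by blast
    moreover obtain v where "v \<in> V" "b = t *\<^sub>R v" using t(2) \<open>b \<in> B\<close> by blast
    ultimately have "s n - x \<in> V" using t(1) by simp
    then show ?case by (simp add: V_def)
  qed
qed

text \<open>\<open>Gamma_perp_loc\<close> ranges over all bounded disks, whereas co-nuclearity
  speaks of closed ones; passing to the closure bridges the two.\<close>

lemma closure_closed_disk:
  fixes B :: "'a::locally_convex_space set"
  assumes B: "absolutely_convex B" "tvs_bounded B"
  shows "closure B \<in> closed_disks"
proof -
  have "a *\<^sub>R x + b *\<^sub>R y \<in> closure B"
    if "x \<in> closure B" "y \<in> closure B" "\<bar>a\<bar> + \<bar>b\<bar> \<le> 1" for x y a b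
  proof -
    let ?h = "\<lambda>p::'a \<times> 'a. a *\<^sub>R fst p + b *\<^sub>R snd p"
    have "?h ` closure (B \<times> B) \<subseteq> closure B"
    proof (rule image_closure_subset)
      show "continuous_on (closure (B \<times> B)) ?h"
        by (intro continuous_intros continuous_on_scaleR_locally_convex)
      show "?h ` (B \<times> B) \<subseteq> closure B"
        using absolutely_convexD[OF B(1) _ _ that(3)] closure_subset[of B] by auto
    qed simp
    moreover have "(x, y) \<in> closure (B \<times> B)" using that by (simp add: closure_Times)
    ultimately have "?h (x, y) \<in> closure B" by blast
    then show ?thesis by simp
  qed
  moreover have "closure B \<noteq> {}" using absolutely_convex_zero[OF B(1)] by auto
  ultimately have "absolutely_convex (closure B)" unfolding absolutely_convex_def by blast
  moreover have "tvs_bounded (closure B)" unfolding tvs_bounded_def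
  proof (intro allI impI, elim conjE)
    fix U :: "'a set" assume U: "open U" "0 \<in> U"
    obtain V where V: "open V" "0 \<in> V" "\<forall>x\<in>V. \<forall>y\<in>V. x + y \<in> U"
      using open_zero_add[OF U] by blast
    obtain s where s: "s > 0" "\<And>t. t > s \<Longrightarrow> B \<subseteq> scaleR t ` V"
      using B(2) V(1,2) unfolding tvs_bounded_def by blast
    have "closure B \<subseteq> scaleR t ` U" if t: "t > s" for t
    proof
      fix z assume z: "z \<in> closure B"
      have t0: "t > 0" using s(1) t by simp
      \<comment> \<open>A neighbourhood of \<open>z\<close> in which a point \<open>w\<close> of
        \<open>B\<close> is found; the error \<open>z - w\<close>, divided by \<open>t\<close>, then
        still lies in \<open>V\<close>.\<close>
      define W where "W = (\<lambda>w. (1 / t) *\<^sub>R (z - w)) -` V"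
      have "open W" unfolding W_def
        using V(1) by (intro open_vimage continuous_intros continuous_on_scaleR_locally_convex)
      moreover have "z \<in> W" using V(2) by (simp add: W_def)
      ultimately obtain w where w: "w \<in> B" "w \<in> W"
        using z by (metis IntE all_not_in_conv closure_iff_nhds_not_empty order_refl)
      obtain v where v: "v \<in> V" "w = t *\<^sub>R v" using s(2)[OF t] w(1) by blast
      have "v + (1 / t) *\<^sub>R (z - w) \<in> U" using V(3) v(1) w(2) by (simp add: W_def)
      moreover have "z = t *\<^sub>R (v + (1 / t) *\<^sub>R (z - w))" using t0 v(2) by (simp add: scaleR_add_right)
      ultimately show "z \<in> scaleR t ` U" by blast
    qed
    then show "\<exists>s>0. \<forall>t>s. closure B \<subseteq> scaleR t ` U" using s(1) by blast
  qed
  ultimately show ?thesis by (simp add: closed_disks_def)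
qed

lemma ex_disk_containing_both:
  fixes B C :: "'a::locally_convex_space set"
  assumes B: "absolutely_convex B" "tvs_bounded B" and C: "absolutely_convex C" "tvs_bounded C"
  shows "\<exists>D. absolutely_convex D \<and> tvs_bounded D \<and> B \<subseteq> D \<and> C \<subseteq> D"
proof (intro exI conjI)
  let ?D = "{b + c | b c. b \<in> B \<and> c \<in> C}"
  show "B \<subseteq> ?D" using absolutely_convex_zero[OF C(1)] by force
  show "C \<subseteq> ?D" using absolutely_convex_zero[OF B(1)] by force
  show "absolutely_convex ?D" unfolding absolutely_convex_def
  proof (intro conjI ballI allI impI)
    show "?D \<noteq> {}" using absolutely_convex_zero[OF B(1)] absolutely_convex_zero[OF C(1)] by blast
    fix x y a b assume "x \<in> ?D" "y \<in> ?D" and ab: "\<bar>a\<bar> + \<bar>b\<bar> \<le> (1::real)"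
    then obtain p q r s where *: "p \<in> B" "q \<in> C" "x = p + q" "r \<in> B" "s \<in> C" "y = r + s" by blast
    have "a *\<^sub>R x + b *\<^sub>R y = (a *\<^sub>R p + b *\<^sub>R r) + (a *\<^sub>R q + b *\<^sub>R s)"
      using * by (simp add: algebra_simps)
    moreover have "a *\<^sub>R p + b *\<^sub>R r \<in> B" "a *\<^sub>R q + b *\<^sub>R s \<in> C"
      using * ab absolutely_convexD[OF B(1)] absolutely_convexD[OF C(1)] by blast+
    ultimately show "a *\<^sub>R x + b *\<^sub>R y \<in> ?D" by blast
  qed
  show "tvs_bounded ?D" unfolding tvs_bounded_def
  proof (intro allI impI, elim conjE)
    fix U :: "'a set" assume U: "open U" "0 \<in> U"
    obtain V where V: "open V" "0 \<in> V" "\<forall>x\<in>V. \<forall>y\<in>V. x + y \<in> U"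
      using open_zero_add[OF U] by blast
    obtain r s where r: "r > 0" "\<And>t. t > r \<Longrightarrow> B \<subseteq> scaleR t ` V"
      and s: "s > 0" "\<And>t. t > s \<Longrightarrow> C \<subseteq> scaleR t ` V"
      using B(2) C(2) V(1,2) unfolding tvs_bounded_def by metis
    have "?D \<subseteq> scaleR t ` U" if t: "t > max r s" for t
    proof
      fix x assume "x \<in> ?D"
      then obtain b c where "b \<in> B" "c \<in> C" "x = b + c" by blast
      moreover have "b \<in> scaleR t ` V" "c \<in> scaleR t ` V"
        using r(2)[of t] s(2)[of t] \<open>b \<in> B\<close> \<open>c \<in> C\<close> t by auto
      then obtain v w where "v \<in> V" "b = t *\<^sub>R v" "w \<in> V" "c = t *\<^sub>R w" by blast
      ultimately have "v + w \<in> U" "x = t *\<^sub>R (v + w)" using V(3) by (auto simp: scaleR_add_right)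
      then show "x \<in> scaleR t ` U" by blast
    qed
    then show "\<exists>s>0. \<forall>t>s. ?D \<subseteq> scaleR t ` U" using r(1) by (intro exI[of _ "max r s"]) auto
  qed
qed

section \<open>Approximation by late combinations with bounded coefficients\<close>

text \<open>Otherwise Hahn--Banach separates \<open>x\<close> from the admissible combinations. The
  separating functional is at most 1 on all of them, so choosing the signs of the coefficients shows
  that \<open>\<bar>f (u k)\<bar>\<close> is summable; then \<open>f x = 0\<close>, contradicting
  separation.\<close>

lemma approximable_by_bounded_combinations:
  fixes u :: "nat \<Rightarrow> 'a::real_vector"
  assumes N: "seminorm N"
    and ann: "\<And>f. linear f \<Longrightarrow> (\<exists>K. \<forall>y. \<bar>f y\<bar> \<le> K * N y) \<Longrightarrow> summable (\<lambda>k. \<bar>f (u k)\<bar>) \<Longrightarrow> f x = 0"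
    and "\<epsilon> > 0"
  shows "\<exists>n\<ge>m. \<exists>t. (\<forall>k. \<bar>t k\<bar> \<le> (1::real)) \<and> N (x - (\<Sum>k\<in>{m..<n}. t k *\<^sub>R u k)) \<le> \<epsilon>"
proof (rule ccontr)
  assume contra: "\<not> ?thesis"
  \<comment> \<open>\<open>p\<close> is the gauge of the set of all \<open>\<Sum>k\<in>{m..<n}. t k *\<^sub>R u k\<close> with \<open>\<bar>t k\<bar> \<le> 1\<close>, enlarged by
    the \<open>\<epsilon>\<close>-ball of \<open>N\<close>.\<close>
  define Z where "Z s = {\<Sum>k\<in>{m..<n}. t k *\<^sub>R u k | n t. n \<ge> m \<and> (\<forall>k. \<bar>t k\<bar> \<le> (s::real))}" for s
  define G where "G y = {s + N (y - z) / \<epsilon> | s z. s \<ge> 0 \<and> z \<in> Z s}" for y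
  define p where "p y = Inf (G y)" for y
  have Gpos: "0 \<le> g" if "g \<in> G y" for g y
    using that \<open>\<epsilon> > 0\<close> seminorm_nonneg[OF N] by (auto simp: G_def)
  then have bdd: "bdd_below (G y)" for y by (rule bdd_belowI)
  have Z0: "0 \<in> Z 0" unfolding Z_def by (intro CollectI exI[of _ m] exI[of _ "\<lambda>_. 0"]) auto
  have GN: "N y / \<epsilon> \<in> G y" for y unfolding G_def using Z0 by (intro CollectI exI[of _ 0]) auto
  then have Gne: "G y \<noteq> {}" for y by blast
  have ple: "p y \<le> g" if "g \<in> G y" for g y unfolding p_def by (rule cInf_lower[OF that bdd])
  have pge: "b \<le> p y" if "\<And>g. g \<in> G y \<Longrightarrow> b \<le> g" for b y unfolding p_def by (rule cInf_greatest[OF Gne that])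
  have Zadd: "z + z' \<in> Z (s + s')" if zz': "z \<in> Z s" "z' \<in> Z s'" for z z' s s'
  proof -
    obtain n t where z: "n \<ge> m" "\<forall>k. \<bar>t k\<bar> \<le> s" "z = (\<Sum>k\<in>{m..<n}. t k *\<^sub>R u k)"
      using zz'(1) unfolding Z_def by blast
    obtain n' t' where z': "n' \<ge> m" "\<forall>k. \<bar>t' k\<bar> \<le> s'" "z' = (\<Sum>k\<in>{m..<n'}. t' k *\<^sub>R u k)"
      using zz'(2) unfolding Z_def by blast
    have s0: "0 \<le> s" "0 \<le> s'" using z(2) z'(2) abs_ge_zero order_trans by blast+
    \<comment> \<open>Both combinations are padded with zero coefficients to the longer range, which
      keeps the bound \<open>s + s'\<close> at every index.\<close>
    define r where "r k = (if k < n then t k else 0) + (if k < n' then t' k else 0)" for k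
    have "z = (\<Sum>k\<in>{m..<max n n'}. (if k < n then t k else 0) *\<^sub>R u k)"
      unfolding z(3) by (rule sum.mono_neutral_cong_left) auto
    moreover have "z' = (\<Sum>k\<in>{m..<max n n'}. (if k < n' then t' k else 0) *\<^sub>R u k)"
      unfolding z'(3) by (rule sum.mono_neutral_cong_left) auto
    ultimately have "z + z' = (\<Sum>k\<in>{m..<max n n'}. r k *\<^sub>R u k)"
      by (simp add: r_def sum.distrib[symmetric] scaleR_left_distrib)
    moreover have "\<bar>r k\<bar> \<le> s + s'" for k
      using spec[OF z(2), of k] spec[OF z'(2), of k] s0 unfolding r_def by auto
    moreover have "m \<le> max n n'" using z(1) by simp
    ultimately show ?thesis unfolding Z_def by blast
  qed
  have Zscale: "c *\<^sub>R z \<in> Z (c * s)" if z: "z \<in> Z s" and c: "c \<ge> 0" for c z s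
  proof -
    obtain n t where z: "n \<ge> m" "\<forall>k. \<bar>t k\<bar> \<le> s" "z = (\<Sum>k\<in>{m..<n}. t k *\<^sub>R u k)"
      using z unfolding Z_def by blast
    have "c *\<^sub>R z = (\<Sum>k\<in>{m..<n}. (c * t k) *\<^sub>R u k)" by (simp add: z(3) scaleR_sum_right)
    moreover have "\<forall>k. \<bar>c * t k\<bar> \<le> c * s" using z(2) c by (simp add: abs_mult mult_left_mono)
    ultimately show ?thesis unfolding Z_def using z(1) by (intro CollectI exI[of _ n] exI[of _ "\<lambda>k. c * t k"]) simp
  qed
  have padd: "p (x + y) \<le> p x + p y" for x y
  proof -
    have 1: "p (x + y) \<le> g + h" if gh: "g \<in> G x" "h \<in> G y" for g h
    proof -
      obtain s z where g: "g = s + N (x - z) / \<epsilon>" "s \<ge> 0" "z \<in> Z s" using gh(1) unfolding G_def by blast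
      obtain s' z' where h: "h = s' + N (y - z') / \<epsilon>" "s' \<ge> 0" "z' \<in> Z s'" using gh(2) unfolding G_def by blast
      have "(s + s') + N ((x + y) - (z + z')) / \<epsilon> \<in> G (x + y)"
        unfolding G_def using g h Zadd[OF g(3) h(3)] by (intro CollectI exI[of _ "s + s'"] exI[of _ "z + z'"]) simp
      then have "p (x + y) \<le> (s + s') + N ((x + y) - (z + z')) / \<epsilon>" by (rule ple)
      also have "N ((x + y) - (z + z')) \<le> N (x - z) + N (y - z')"
        using seminorm_add[OF N, of "x - z" "y - z'"] by (simp add: algebra_simps)
      then have "(s + s') + N ((x + y) - (z + z')) / \<epsilon> \<le> (s + s') + (N (x - z) + N (y - z')) / \<epsilon>"
        using \<open>\<epsilon> > 0\<close> by (intro add_left_mono divide_right_mono) auto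
      finally show ?thesis by (simp add: g(1) h(1) add_divide_distrib)
    qed
    have "p (x + y) - g \<le> p y" if "g \<in> G x" for g
      by (rule pge) (use 1[OF that] in force)
    then have "p (x + y) - p y \<le> p x" by (intro pge) force
    then show ?thesis by simp
  qed
  have pscale_le: "p (c *\<^sub>R y) \<le> c * g" if c: "c \<ge> 0" "g \<in> G y" for c y g
  proof -
    obtain s z where g: "g = s + N (y - z) / \<epsilon>" "s \<ge> 0" "z \<in> Z s" using c(2) unfolding G_def by blast
    have "c * s + N (c *\<^sub>R y - c *\<^sub>R z) / \<epsilon> \<in> G (c *\<^sub>R y)"
      unfolding G_def using g c(1) Zscale[OF g(3) c(1)]
      by (intro CollectI exI[of _ "c * s"] exI[of _ "c *\<^sub>R z"]) simp
    then have "p (c *\<^sub>R y) \<le> c * s + N (c *\<^sub>R y - c *\<^sub>R z) / \<epsilon>" by (rule ple)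
    also have "N (c *\<^sub>R y - c *\<^sub>R z) = c * N (y - z)"
      using c(1) seminorm_scaleR[OF N, of c "y - z"] by (simp add: scaleR_right_diff_distrib)
    finally show ?thesis by (simp add: g(1) distrib_left)
  qed
  have p0: "p 0 = 0"
  proof (rule antisym)
    show "p 0 \<le> 0" using ple[OF GN, of 0] by (simp add: seminorm_zero[OF N])
    show "0 \<le> p 0" by (rule pge) (rule Gpos)
  qed
  have pscale_pos: "p (c *\<^sub>R y) \<le> c * p y" if "c > 0" for c y
  proof -
    have "p (c *\<^sub>R y) / c \<le> p y"
      by (rule pge) (use pscale_le[of c _ y] that in \<open>simp add: divide_le_eq mult.commute\<close>)
    then show ?thesis using that by (simp add: divide_le_eq mult.commute)
  qed
  have "p (c *\<^sub>R y) = c * p y" if "c \<ge> 0" for c y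
  proof (cases "c = 0")
    case False
    then have c: "c > 0" using that by simp
    have "p ((1 / c) *\<^sub>R (c *\<^sub>R y)) \<le> (1 / c) * p (c *\<^sub>R y)" using c by (intro pscale_pos) simp
    then have "c * p y \<le> p (c *\<^sub>R y)" using c by (simp add: field_simps)
    then show ?thesis using pscale_pos[OF c, of y] by simp
  qed (simp add: p0)
  with padd have "sublinear p" by (simp add: sublinear_def)
  then obtain f where f: "linear f" "\<And>y. f y \<le> p y" "f x = p x" using hahn_banach_sublinear by blast
  have "f y \<le> (1 / \<epsilon>) * N y" for y using f(2)[of y] ple[OF GN, of y] by simp
  from this this[of "- _"] have "\<bar>f y\<bar> \<le> (1 / \<epsilon>) * N y" for y
    by (simp add: abs_le_iff linear_neg[OF f(1)] seminorm_minus[OF N])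
  then have bounded: "\<exists>K. \<forall>y. \<bar>f y\<bar> \<le> K * N y" by blast
  have "summable (\<lambda>k. \<bar>f (u (k + m))\<bar>)"
  proof (rule bounded_imp_summable)
    fix n
    \<comment> \<open>With these coefficients \<open>f z\<close> is the sum of the absolute values,
      while \<open>z\<close> itself is admissible and so \<open>p z \<le> 1\<close>.\<close>
    define t where "t k = (if f (u k) \<ge> 0 then 1 else - 1 :: real)" for k
    define z where "z = (\<Sum>k\<in>{m..<m + Suc n}. t k *\<^sub>R u k)"
    have "(\<Sum>k\<le>n. \<bar>f (u (k + m))\<bar>) = (\<Sum>k\<in>{m..<m + Suc n}. \<bar>f (u k)\<bar>)"
      using sum.shift_bounds_nat_ivl[of "\<lambda>k. \<bar>f (u k)\<bar>" 0 m "Suc n"]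
      by (simp add: atLeast0LessThan lessThan_Suc_atMost add.commute del: sum.op_ivl_Suc)
    also have "\<dots> = f z"
      unfolding z_def linear_sum[OF f(1)] by (intro sum.cong) (auto simp: t_def linear_scale[OF f(1)])
    also have "\<dots> \<le> p z" by (rule f(2))
    also have "\<dots> \<le> 1"
    proof (rule ple)
      have "z \<in> Z 1" unfolding Z_def z_def by (intro CollectI exI[of _ "m + Suc n"] exI[of _ t]) (auto simp: t_def)
      then show "1 \<in> G z" unfolding G_def by (intro CollectI exI[of _ 1] exI[of _ z]) (simp add: seminorm_zero[OF N])
    qed
    finally show "(\<Sum>k\<le>n. \<bar>f (u (k + m))\<bar>) \<le> 1" .
  qed simp
  then have "summable (\<lambda>k. \<bar>f (u k)\<bar>)" by (simp only: summable_iff_shift[of "\<lambda>k. \<bar>f (u k)\<bar>"])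
  then have "p x = 0" using ann[OF f(1) bounded] f(3) by simp
  \<comment> \<open>A representation of cost below 1 would have both summands below 1, hence be one
    of the approximations assumed not to exist.\<close>
  have "1 \<le> p x"
  proof (rule pge, rule ccontr)
    fix g assume g: "g \<in> G x" "\<not> 1 \<le> g"
    then obtain s z where sz: "g = s + N (x - z) / \<epsilon>" "s \<ge> 0" "z \<in> Z s" unfolding G_def by blast
    obtain n t where z: "n \<ge> m" "\<forall>k. \<bar>t k\<bar> \<le> s" "z = (\<Sum>k\<in>{m..<n}. t k *\<^sub>R u k)"
      using sz(3) unfolding Z_def by blast
    have "N (x - z) / \<epsilon> \<ge> 0" using seminorm_nonneg[OF N] \<open>\<epsilon> > 0\<close> by simp
    then have "s \<le> 1" "N (x - z) / \<epsilon> \<le> 1" using g(2) sz(1,2) by linarith+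
    then have "\<forall>k. \<bar>t k\<bar> \<le> 1" "N (x - z) \<le> \<epsilon>" using z(2) \<open>\<epsilon> > 0\<close> by (auto intro: order_trans simp: field_simps)
    then show False using contra z(1,3) by blast
  qed
  with \<open>p x = 0\<close> show False by simp
qed

subsection \<open>Nuclear embeddings of disks\<close>

lemma nuclear_seminorms_gauge:
  assumes B: "absolutely_convex B" and C: "absolutely_convex C" and "B \<subseteq> C"
    and nuc: "nuclear_between_disks B C (\<lambda>x. x)"
    and P: "linear P" "range P \<subseteq> span B"
  shows "nuclear_seminorms (\<lambda>x. minkowski_gauge B (P x)) (\<lambda>x. minkowski_gauge C (P x))"
proof -
  obtain f y where f: "\<And>n. f n \<in> disk_dual B" and y: "\<And>n. y n \<in> span C"
    and sm: "summable (\<lambda>n::nat. disk_dual_norm B (f n) * minkowski_gauge C (y n))"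
    and conv: "\<And>x. x \<in> span B \<Longrightarrow> converges_in_disk_to C (\<lambda>N. \<Sum>n<N. f n x *\<^sub>R y n) x"
    using nuc unfolding nuclear_between_disks_def by blast
  define a where "a n = disk_dual_norm B (f n)" for n
  define \<mu> where "\<mu> n = a n * minkowski_gauge C (y n)" for n
  \<comment> \<open>If \<open>a n = 0\<close>, division yields 0; this is consistent because
    \<open>f n\<close> then vanishes on \<open>span B\<close>.\<close>
  define g where "g n x = (1 / a n) * f n (P x)" for n x
  have PB: "P x \<in> span B" for x using P(2) by blast
  have fa: "\<bar>f n (P x)\<bar> \<le> a n * minkowski_gauge B (P x)" and a0: "a n \<ge> 0" for n x
    unfolding a_def by (rule disk_dual_bound[OF B f PB])+
  have N0: "0 \<le> minkowski_gauge B (P x)" for x by (rule gauge_nonneg[OF B PB])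
  have \<mu>0: "0 \<le> \<mu> n" for n unfolding \<mu>_def by (intro mult_nonneg_nonneg a0 gauge_nonneg[OF C y])
  have g: "\<bar>g n x\<bar> \<le> minkowski_gauge B (P x)" for n x
    using fa[of n x] a0[of n] N0[of x] by (cases "a n = 0") (auto simp: g_def abs_mult field_simps)
  have fg: "a n * \<bar>g n x\<bar> = \<bar>f n (P x)\<bar>" for n x
    using fa[of n x] a0[of n] by (cases "a n = 0") (auto simp: g_def abs_mult)
  have lin: "linear (g n)" for n
    using linear_compose[OF disk_dual_linear_comp[OF f P] linear_scale_self[of "1 / a n"]]
    by (simp add: g_def[abs_def] o_def)
  have sm\<mu>: "summable \<mu>" using sm by (simp add: \<mu>_def[abs_def] a_def)
  have "minkowski_gauge C (P x) \<le> (\<Sum>n. \<mu> n * \<bar>g n x\<bar>)" for x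
  proof -
    obtain Q where Q: "linear Q" "range Q \<subseteq> span C" "\<And>z. z \<in> span C \<Longrightarrow> Q z = z"
      using ex_span_projection[of C] by blast
    \<comment> \<open>Extends the gauge of \<open>C\<close> to a seminorm on the whole space, so
      that the triangle inequality holds without side conditions.\<close>
    define N where "N z = minkowski_gauge C (Q z)" for z
    have N: "seminorm N" unfolding N_def[abs_def] by (rule seminorm_gauge[OF C Q(1,2)])
    have NC: "N z = minkowski_gauge C z" if "z \<in> span C" for z using Q(3)[OF that] by (simp add: N_def)
    have PC: "P x \<in> span C" using PB[of x] span_mono[OF \<open>B \<subseteq> C\<close>] by blast
    have smg: "summable (\<lambda>n. \<mu> n * \<bar>g n x\<bar>)"
      by (rule summable_mult_bounded[OF sm\<mu> \<mu>0, where b = "minkowski_gauge B (P x)"]) (use g in simp)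
    define s where "s M = (\<Sum>n<M. f n (P x) *\<^sub>R y n)" for M
    have sC: "s M \<in> span C" for M unfolding s_def by (intro span_sum span_scale y)
    have "(\<lambda>M. minkowski_gauge C (s M - P x)) \<longlonglongrightarrow> 0"
      using conv[OF PB[of x]] by (simp add: converges_in_disk_to_def s_def)
    then have lim: "(\<lambda>M. N (s M - P x)) \<longlonglongrightarrow> 0" using sC PC by (simp add: NC span_diff)
    have "N (P x) - (\<Sum>n. \<mu> n * \<bar>g n x\<bar>) \<le> N (s M - P x)" for M
    proof -
      have "N (s M) \<le> (\<Sum>n<M. N (f n (P x) *\<^sub>R y n))" unfolding s_def by (rule seminorm_sum[OF N])
      also have "\<dots> = (\<Sum>n<M. \<mu> n * \<bar>g n x\<bar>)"
        by (intro sum.cong) (auto simp: seminorm_scaleR[OF N] NC[OF y] \<mu>_def fg[symmetric])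
      also have "\<dots> \<le> (\<Sum>n. \<mu> n * \<bar>g n x\<bar>)" by (rule sum_le_suminf[OF smg]) (auto intro: mult_nonneg_nonneg \<mu>0)
      finally show ?thesis using seminorm_diff[OF N, of "s M" "s M - P x"] by simp
    qed
    then have "N (P x) - (\<Sum>n. \<mu> n * \<bar>g n x\<bar>) \<le> 0" by (intro LIMSEQ_le_const[OF lim]) blast
    then show ?thesis by (simp add: NC[OF PC])
  qed
  then show ?thesis unfolding nuclear_seminorms_def using lin g \<mu>0 sm\<mu> by blast
qed

text \<open>Every further factor \<open>1 / k\<close> costs two nuclear embeddings. The constant in
  the exponent grows with \<open>s\<close>, but the power \<open>k ^ 3\<close> does not, and
  \<open>P\<close> remains the same map.\<close>

lemma co_nuclear_covers_ball:
  fixes B :: "'a::locally_convex_space set"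
  assumes "co_nuclear TYPE('a)" and B: "B \<in> closed_disks" and P: "linear P" "range P \<subseteq> span B"
  shows "\<exists>D\<in>closed_disks. B \<subseteq> D \<and> (\<exists>C. \<forall>k\<ge>1. covers_ball (\<lambda>x. minkowski_gauge B (P x))
    (\<lambda>x. minkowski_gauge D (P x)) (2 ^ (C * k ^ 3)) (2 / real k ^ s))"
proof (induction s)
  case 0
  have N: "seminorm (\<lambda>x. minkowski_gauge B (P x))" using B P by (intro seminorm_gauge) (auto simp: closed_disks_def)
  \<comment> \<open>The unit ball itself is a single cell of diameter 2, which explains the
    numerator.\<close>
  have "covers_ball (\<lambda>x. minkowski_gauge B (P x)) (\<lambda>x. minkowski_gauge B (P x)) 1 2"
    unfolding covers_ball_def
  proof (intro exI[of _ "{{x. minkowski_gauge B (P x) \<le> 1}}"] conjI ballI)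
    fix A x y assume "A \<in> {{x. minkowski_gauge B (P x) \<le> 1}}" "x \<in> A" "y \<in> A"
    then show "minkowski_gauge B (P (x - y)) \<le> 2" using seminorm_diff[OF N, of x y] by auto
  qed auto
  then show ?case using B by (intro bexI[of _ B] conjI exI[of _ 0]) auto
next
  case (Suc s)
  then obtain D C where D: "D \<in> closed_disks" "B \<subseteq> D"
    and C: "\<And>k. k \<ge> 1 \<Longrightarrow> covers_ball (\<lambda>x. minkowski_gauge B (P x))
      (\<lambda>x. minkowski_gauge D (P x)) (2 ^ (C * k ^ 3)) (2 / real k ^ s)" by blast
  obtain D1 where D1: "D1 \<in> closed_disks" "D \<subseteq> D1" "nuclear_between_disks D D1 (\<lambda>x. x)"
    using assms(1) D(1) unfolding co_nuclear_def by blast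
  obtain D2 where D2: "D2 \<in> closed_disks" "D1 \<subseteq> D2" "nuclear_between_disks D1 D2 (\<lambda>x. x)"
    using assms(1) D1(1) unfolding co_nuclear_def by blast
  have ac: "absolutely_convex D" "absolutely_convex D1" "absolutely_convex D2"
    using D(1) D1(1) D2(1) by (simp_all add: closed_disks_def)
  have P': "range P \<subseteq> span D" "range P \<subseteq> span D1" "range P \<subseteq> span D2"
    using P(2) span_mono[OF D(2)] span_mono[OF D1(2)] span_mono[OF D2(2)] by blast+
  note sn = seminorm_gauge[OF ac(1) P(1) P'(1)] seminorm_gauge[OF ac(2) P(1) P'(2)] seminorm_gauge[OF ac(3) P(1) P'(3)]
  obtain C' where C': "\<And>k. k \<ge> 1 \<Longrightarrow> covers_ball (\<lambda>x. minkowski_gauge D (P x))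
      (\<lambda>x. minkowski_gauge D2 (P x)) (2 ^ (C' * k ^ 3)) (1 / real k)"
    using nuclear_pair_covers_ball[OF sn nuclear_seminorms_gauge[OF ac(1,2) D1(2,3) P(1) P'(1)]
      nuclear_seminorms_gauge[OF ac(2,3) D2(2,3) P(1) P'(2)]] by blast
  have "covers_ball (\<lambda>x. minkowski_gauge B (P x)) (\<lambda>x. minkowski_gauge D2 (P x))
      (2 ^ ((C + C') * k ^ 3)) (2 / real k ^ Suc s)" if "k \<ge> 1" for k
    using covers_ball_comp[OF sn(1,3) C[OF that] C'[OF that]] that
    by (simp add: power_add[symmetric] distrib_right mult.commute add.commute)
  moreover have "B \<subseteq> D2" using D(2) D1(2) D2(2) by blast
  ultimately show ?case using D2(1) by blast
qed

lemma co_nuclear_bounded_prefix_signs: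
  fixes B :: "'a::locally_convex_space set"
  assumes "co_nuclear TYPE('a)" and B: "B \<in> closed_disks" and P: "linear P" "range P \<subseteq> span B"
  shows "\<exists>D\<in>closed_disks. B \<subseteq> D \<and>
    (\<exists>R. bounded_prefix_signs (\<lambda>x. minkowski_gauge B (P x)) (\<lambda>x. minkowski_gauge D (P x)) R)"
proof -
  obtain D C where D: "D \<in> closed_disks" "B \<subseteq> D"
    and C: "\<And>k. k \<ge> 1 \<Longrightarrow> covers_ball (\<lambda>x. minkowski_gauge B (P x))
      (\<lambda>x. minkowski_gauge D (P x)) (2 ^ (C * k ^ 3)) (2 / real k ^ 17)"
    using co_nuclear_covers_ball[OF assms, of 17] by blast
  have ac: "absolutely_convex B" "absolutely_convex D" using B D(1) by (simp_all add: closed_disks_def)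
  have PD: "range P \<subseteq> span D" using P(2) span_mono[OF D(2)] by blast
  have "\<exists>R. bounded_prefix_signs (\<lambda>x. minkowski_gauge B (P x)) (\<lambda>x. minkowski_gauge D (P x)) R"
  proof (rule bounded_prefix_signs_if_covers_ball[where c = 1])
    show "minkowski_gauge D (P x) \<le> 1 * minkowski_gauge B (P x)" for x
      using gauge_antimono[OF ac(1) D(2), of "P x"] P(2) by auto
  qed (use seminorm_gauge[OF ac(1) P] seminorm_gauge[OF ac(2) P(1) PD] C in auto)
  then show ?thesis using D by blast
qed

subsection \<open>The domain of sums\<close>

lemma disk_dual_add: "f \<in> disk_dual B \<Longrightarrow> x \<in> span B \<Longrightarrow> y \<in> span B \<Longrightarrow> f (x + y) = f x + f y"
  and disk_dual_scaleR: "f \<in> disk_dual B \<Longrightarrow> x \<in> span B \<Longrightarrow> f (c *\<^sub>R x) = c * f x"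
  by (simp_all add: disk_dual_def)

lemma Gamma_perp_span: "x \<in> Gamma_perp B u \<Longrightarrow> x \<in> span B"
  and Gamma_perp_annihilated:
    "x \<in> Gamma_perp B u \<Longrightarrow> f \<in> disk_dual B \<Longrightarrow> summable (\<lambda>k. \<bar>f (u k)\<bar>) \<Longrightarrow> f x = 0"
  by (simp_all add: Gamma_perp_def)

lemma Gamma_perpI:
  assumes "x \<in> span B" "\<And>f. f \<in> disk_dual B \<Longrightarrow> summable (\<lambda>k. \<bar>f (u k)\<bar>) \<Longrightarrow> f x = 0"
  shows "x \<in> Gamma_perp B u"
  using assms by (simp add: Gamma_perp_def)

text \<open>A larger disk has the smaller gauge, hence fewer bounded functionals, hence fewer
  conditions on \<open>x\<close>.\<close>

lemma Gamma_perp_mono: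
  assumes B: "absolutely_convex B" and "B \<subseteq> C"
  shows "Gamma_perp B u \<subseteq> Gamma_perp C u"
proof
  fix x assume x: "x \<in> Gamma_perp B u"
  have sp: "span B \<subseteq> span C" by (rule span_mono[OF \<open>B \<subseteq> C\<close>])
  have dual: "f \<in> disk_dual B" if f: "f \<in> disk_dual C" for f
  proof -
    obtain K where K: "\<And>x. x \<in> span C \<Longrightarrow> \<bar>f x\<bar> \<le> K * minkowski_gauge C x"
      using f unfolding disk_dual_def by blast
    have "\<bar>f x\<bar> \<le> \<bar>K\<bar> * minkowski_gauge B x" if x: "x \<in> span B" for x
    proof -
      \<comment> \<open>Only \<open>B\<close> is known to be absolutely convex; the infimum for
        \<open>C\<close> is over a nonempty set because the one for \<open>B\<close> is.\<close>
      have "0 \<le> minkowski_gauge C x"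
        unfolding minkowski_gauge_def using x \<open>B \<subseteq> C\<close> by (intro cInf_greatest) (auto simp: span_disk[OF B])
      then have "\<bar>f x\<bar> \<le> \<bar>K\<bar> * minkowski_gauge C x"
        using K[of x] x sp by (meson abs_ge_self mult_right_mono order_trans subsetD)
      also have "\<dots> \<le> \<bar>K\<bar> * minkowski_gauge B x"
        by (intro mult_left_mono gauge_antimono[OF B \<open>B \<subseteq> C\<close> x]) simp
      finally show ?thesis .
    qed
    then show ?thesis using f sp unfolding disk_dual_def by blast
  qed
  show "x \<in> Gamma_perp C u"
    using Gamma_perp_span[OF x] sp by (intro Gamma_perpI Gamma_perp_annihilated[OF x] dual) auto
qed

lemma subspace_Gamma_perp: "subspace (Gamma_perp B u)"
proof (rule subspaceI)
  show "0 \<in> Gamma_perp B u"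
  proof (rule Gamma_perpI[OF span_zero])
    show "f 0 = 0" if "f \<in> disk_dual B" for f
      using disk_dual_scaleR[OF that span_zero, of 0] by simp
  qed
  show "x + y \<in> Gamma_perp B u" if x: "x \<in> Gamma_perp B u" and y: "y \<in> Gamma_perp B u" for x y
    using Gamma_perp_span[OF x] Gamma_perp_span[OF y]
    by (intro Gamma_perpI span_add)
      (simp_all add: disk_dual_add Gamma_perp_annihilated[OF x] Gamma_perp_annihilated[OF y])
  show "c *\<^sub>R x \<in> Gamma_perp B u" if x: "x \<in> Gamma_perp B u" for c x
    using Gamma_perp_span[OF x]
    by (intro Gamma_perpI span_scale) (simp_all add: disk_dual_scaleR Gamma_perp_annihilated[OF x])
qed

text \<open>The union is directed: two disks lie in a common bounded disk, and the annihilators grow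
  with the disk.\<close>

lemma subspace_Gamma_perp_loc:
  fixes B0 :: "'a::locally_convex_space set"
  assumes B0: "B0 \<in> closed_disks"
  shows "subspace (Gamma_perp_loc B0 u)"
proof (rule subspaceI)
  have mem: "x \<in> Gamma_perp_loc B0 u \<longleftrightarrow> (\<exists>B. absolutely_convex B \<and> tvs_bounded B \<and> B0 \<subseteq> B \<and> x \<in> Gamma_perp B u)" for x
    by (auto simp: Gamma_perp_loc_def)
  show "0 \<in> Gamma_perp_loc B0 u"
    unfolding mem using B0 subspace_0[OF subspace_Gamma_perp] by (auto simp: closed_disks_def)
  show "c *\<^sub>R x \<in> Gamma_perp_loc B0 u" if "x \<in> Gamma_perp_loc B0 u" for c x
    using that subspace_scale[OF subspace_Gamma_perp] unfolding mem by blast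
  show "x + y \<in> Gamma_perp_loc B0 u" if "x \<in> Gamma_perp_loc B0 u" "y \<in> Gamma_perp_loc B0 u" for x y
  proof -
    obtain B where B: "absolutely_convex B" "tvs_bounded B" "B0 \<subseteq> B" "x \<in> Gamma_perp B u"
      using \<open>x \<in> Gamma_perp_loc B0 u\<close> unfolding mem by blast
    obtain C where C: "absolutely_convex C" "tvs_bounded C" "B0 \<subseteq> C" "y \<in> Gamma_perp C u"
      using \<open>y \<in> Gamma_perp_loc B0 u\<close> unfolding mem by blast
    obtain D where D: "absolutely_convex D" "tvs_bounded D" "B \<subseteq> D" "C \<subseteq> D"
      using ex_disk_containing_both[OF B(1,2) C(1,2)] by blast
    have "x \<in> Gamma_perp D u" "y \<in> Gamma_perp D u"
      using B(4) C(4) Gamma_perp_mono[OF B(1) D(3)] Gamma_perp_mono[OF C(1) D(4)] by blast+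
    then have "x + y \<in> Gamma_perp D u" by (rule subspace_add[OF subspace_Gamma_perp])
    then show ?thesis unfolding mem using D B(3) by blast
  qed
qed

lemma converges_in_disk_to_mono:
  assumes B: "absolutely_convex B" and C: "absolutely_convex C" and "B \<subseteq> C" and conv: "converges_in_disk_to B s x"
  shows "converges_in_disk_to C s x"
proof -
  have sp: "span B \<subseteq> span C" by (rule span_mono[OF \<open>B \<subseteq> C\<close>])
  have s: "s n \<in> span B" "x \<in> span B" for n using conv by (auto simp: converges_in_disk_to_def)
  have "(\<lambda>n. minkowski_gauge C (s n - x)) \<longlonglongrightarrow> 0"
  proof (rule tendsto_sandwich[OF _ _ tendsto_const])
    show "(\<lambda>n. minkowski_gauge B (s n - x)) \<longlonglongrightarrow> 0" using conv by (simp add: converges_in_disk_to_def)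
    show "\<forall>\<^sub>F n in sequentially. 0 \<le> minkowski_gauge C (s n - x)"
      using s sp by (intro always_eventually allI gauge_nonneg[OF C] span_diff) auto
    show "\<forall>\<^sub>F n in sequentially. minkowski_gauge C (s n - x) \<le> minkowski_gauge B (s n - x)"
      using s by (intro always_eventually allI gauge_antimono[OF B \<open>B \<subseteq> C\<close>] span_diff) auto
  qed
  then show ?thesis using s sp unfolding converges_in_disk_to_def by blast
qed

lemma disk_dual_sums:
  assumes B: "absolutely_convex B" and f: "f \<in> disk_dual B" and v: "\<And>k. v k \<in> span B"
    and conv: "converges_in_disk_to B (\<lambda>n. \<Sum>k<n. v k) y"
  shows "(\<lambda>k. f (v k)) sums f y"
proof -
  obtain P where P: "linear P" "range P \<subseteq> span B" "\<And>x. x \<in> span B \<Longrightarrow> P x = x"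
    using ex_span_projection[of B] by blast
  \<comment> \<open>\<open>f\<close> is linear only on \<open>span B\<close>; \<open>h\<close> is
    linear everywhere and agrees with it there.\<close>
  define h where "h x = f (P x)" for x
  have h: "linear h" unfolding h_def[abs_def] by (rule disk_dual_linear_comp[OF f P(1,2)])
  have hf: "h x = f x" if "x \<in> span B" for x using P(3)[OF that] by (simp add: h_def)
  have y: "y \<in> span B" using conv by (simp add: converges_in_disk_to_def)
  let ?s = "\<lambda>n. \<Sum>k<n. v k"
  have s: "?s n \<in> span B" for n by (intro span_sum v)
  have "(\<lambda>n. disk_dual_norm B f * minkowski_gauge B (?s n - y)) \<longlonglongrightarrow> disk_dual_norm B f * 0"
    using conv by (intro tendsto_mult_left) (simp add: converges_in_disk_to_def)
  then have "(\<lambda>n. disk_dual_norm B f * minkowski_gauge B (?s n - y)) \<longlonglongrightarrow> 0" by simp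
  then have "(\<lambda>n. h (?s n - y)) \<longlonglongrightarrow> 0"
  proof (rule Lim_null_comparison[rotated])
    show "\<forall>\<^sub>F n in sequentially. norm (h (?s n - y)) \<le> disk_dual_norm B f * minkowski_gauge B (?s n - y)"
      using disk_dual_bound(1)[OF B f span_diff[OF s y]] hf[OF span_diff[OF s y]] by simp
  qed
  then have "(\<lambda>n. h (?s n)) \<longlonglongrightarrow> h y" by (simp add: linear_diff[OF h] LIM_zero_iff)
  moreover have "h (?s n) = (\<Sum>k<n. f (v k))" for n by (simp add: linear_sum[OF h] hf v)
  ultimately show ?thesis by (simp add: sums_def hf y)
qed

lemma sums_rearranged_real:
  fixes a :: "nat \<Rightarrow> real"
  assumes "summable (\<lambda>k. \<bar>a k\<bar>)" "bij \<pi>" "a sums s" "(\<lambda>k. a (\<pi> k)) sums t"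
  shows "s = t"
proof -
  have s: "(a has_sum s) UNIV" using assms(1,3) by (intro norm_summable_imp_has_sum) auto
  then have "((\<lambda>k. a (\<pi> k)) has_sum s) UNIV"
    using has_sum_reindex_bij_betw[of \<pi> UNIV UNIV a s] assms(2) by simp
  then have "(\<lambda>k. a (\<pi> k)) sums s" by (rule has_sum_imp_sums)
  then show ?thesis using assms(4) sums_unique2 by blast
qed

lemma series_terms_in_span:
  assumes "converges_in_disk_to B (\<lambda>n. \<Sum>k<n. u k) y"
  shows "u k \<in> span B"
proof -
  have "(\<Sum>i<n. u i) \<in> span B" for n using assms by (auto simp: converges_in_disk_to_def)
  from span_diff[OF this[of "Suc k"] this[of k]] show ?thesis by simp
qed

text \<open>In a common disk both series converge, so a functional of the disk dual maps them to a
  real series and its rearrangement. If that series converges absolutely, the two sums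
  agree.\<close>

lemma rearranged_sum_in_translate:
  fixes u :: "nat \<Rightarrow> 'a::locally_convex_space"
  assumes loc: "\<forall>s::nat \<Rightarrow> 'a. convergent s \<longrightarrow> converges_locally s"
    and B0: "B0 \<in> closed_disks" and S: "converges_in_disk_to B0 (\<lambda>n. \<Sum>k<n. u k) S"
    and \<pi>: "bij \<pi>" "(\<lambda>k. u (\<pi> k)) sums y"
  shows "y - S \<in> Gamma_perp_loc B0 u"
proof -
  have "convergent (\<lambda>n. \<Sum>k<n. u (\<pi> k))" using \<pi>(2) by (auto simp: sums_def convergent_def)
  then obtain B1 y' where B1: "B1 \<in> closed_disks" and y': "converges_in_disk_to B1 (\<lambda>n. \<Sum>k<n. u (\<pi> k)) y'"
    using loc unfolding converges_locally_def by blast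
  have d0: "absolutely_convex B0" "tvs_bounded B0" and d1: "absolutely_convex B1" "tvs_bounded B1"
    using B0 B1 by (auto simp: closed_disks_def)
  \<comment> \<open>The limit in the disk is also a limit in the space, where limits are
    unique.\<close>
  have "y' = y" using disk_convergence_imp_tendsto[OF d1 y'] \<pi>(2) unfolding sums_def by (rule LIMSEQ_unique)
  obtain B where B: "absolutely_convex B" "tvs_bounded B" "B0 \<subseteq> B" "B1 \<subseteq> B"
    using ex_disk_containing_both[OF d0 d1] by blast
  have convS: "converges_in_disk_to B (\<lambda>n. \<Sum>k<n. u k) S"
    by (rule converges_in_disk_to_mono[OF d0(1) B(1,3) S])
  have convy: "converges_in_disk_to B (\<lambda>n. \<Sum>k<n. u (\<pi> k)) y"
    using converges_in_disk_to_mono[OF d1(1) B(1,4) y'] \<open>y' = y\<close> by simp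
  have sp: "S \<in> span B" "y \<in> span B" using convS convy by (auto simp: converges_in_disk_to_def)
  have "f (y - S) = 0" if f: "f \<in> disk_dual B" and sm: "summable (\<lambda>k. \<bar>f (u k)\<bar>)" for f
  proof -
    have u: "u k \<in> span B" for k by (rule series_terms_in_span[OF convS])
    have "f S = f y"
      by (rule sums_rearranged_real[OF sm \<pi>(1) disk_dual_sums[OF B(1) f u convS] disk_dual_sums[OF B(1) f u convy]])
    moreover have "f ((y - S) + S) = f (y - S) + f S"
      by (intro disk_dual_add[OF f] span_diff sp)
    ultimately show ?thesis by simp
  qed
  then have "y - S \<in> Gamma_perp B u" by (intro Gamma_perpI span_diff sp)
  then show ?thesis using B unfolding Gamma_perp_loc_def by blast
qed

lemma translate_in_domain_of_sums:
  fixes u :: "nat \<Rightarrow> 'a::locally_convex_space"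
  assumes nuc: "co_nuclear TYPE('a)"
    and B0: "B0 \<in> closed_disks" and S: "converges_in_disk_to B0 (\<lambda>n. \<Sum>k<n. u k) S"
    and x: "x \<in> Gamma_perp_loc B0 u"
  shows "S + x \<in> domain_of_sums u"
proof -
  obtain B' where B': "absolutely_convex B'" "tvs_bounded B'" "B0 \<subseteq> B'" "x \<in> Gamma_perp B' u"
    using x unfolding Gamma_perp_loc_def by blast
  define B where "B = closure B'"
  have B: "B \<in> closed_disks" unfolding B_def by (rule closure_closed_disk[OF B'(1,2)])
  then have ac: "absolutely_convex B" by (simp add: closed_disks_def)
  have B'B: "B' \<subseteq> B" unfolding B_def by (rule closure_subset)
  have xB: "x \<in> Gamma_perp B u" using Gamma_perp_mono[OF B'(1) B'B] B'(4) by blast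
  have conv: "converges_in_disk_to B (\<lambda>n. \<Sum>k<n. u k) S"
    using B0 B'(3) B'B by (intro converges_in_disk_to_mono[OF _ ac _ S]) (auto simp: closed_disks_def)
  have u: "u k \<in> span B" for k by (rule series_terms_in_span[OF conv])
  have sp: "S \<in> span B" "x \<in> span B" using conv xB by (auto simp: converges_in_disk_to_def Gamma_perp_def)
  obtain P where P: "linear P" "range P \<subseteq> span B" "\<And>x. x \<in> span B \<Longrightarrow> P x = x"
    using ex_span_projection[of B] by blast
  define N0 where "N0 z = minkowski_gauge B (P z)" for z
  obtain D R where D: "D \<in> closed_disks" "B \<subseteq> D"
    and R: "bounded_prefix_signs N0 (\<lambda>x. minkowski_gauge D (P x)) R"
    using co_nuclear_bounded_prefix_signs[OF nuc B P(1,2)] unfolding N0_def[abs_def] by blast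
  define N1 where "N1 z = minkowski_gauge D (P z)" for z
  have acD: "absolutely_convex D" "tvs_bounded D" using D(1) by (auto simp: closed_disks_def)
  have BD: "span B \<subseteq> span D" by (rule span_mono[OF D(2)])
  have N0: "seminorm N0" unfolding N0_def[abs_def] by (rule seminorm_gauge[OF ac P(1,2)])
  have N1: "seminorm N1" unfolding N1_def[abs_def] using P(2) BD by (intro seminorm_gauge[OF acD(1) P(1)]) blast
  have R: "bounded_prefix_signs N0 N1 R" using R by (simp add: N1_def[abs_def])
  have "P ((\<Sum>k<n. u k) - S) = (\<Sum>k<n. u k) - S" for n by (intro P(3) span_diff span_sum u sp)
  then have lim: "(\<lambda>n. N0 ((\<Sum>k<n. u k) - S)) \<longlonglongrightarrow> 0"
    using conv by (simp add: N0_def converges_in_disk_to_def)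
  have "(\<lambda>n. N0 (u n)) \<longlonglongrightarrow> 0"
  proof (rule Lim_null_comparison)
    show "\<forall>\<^sub>F n in sequentially. norm (N0 (u n)) \<le> N0 ((\<Sum>k<Suc n. u k) - S) + N0 ((\<Sum>k<n. u k) - S)"
    proof (intro always_eventually allI)
      fix n
      show "norm (N0 (u n)) \<le> N0 ((\<Sum>k<Suc n. u k) - S) + N0 ((\<Sum>k<n. u k) - S)"
        using seminorm_diff[OF N0, of "(\<Sum>k<Suc n. u k) - S" "(\<Sum>k<n. u k) - S"] seminorm_nonneg[OF N0, of "u n"] by simp
    qed
    show "(\<lambda>n. N0 ((\<Sum>k<Suc n. u k) - S) + N0 ((\<Sum>k<n. u k) - S)) \<longlonglongrightarrow> 0"
      using tendsto_add[OF LIMSEQ_Suc[OF lim] lim] by simp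
  qed
  moreover have approx: "\<exists>n\<ge>m. \<exists>t. (\<forall>k. \<bar>t k\<bar> \<le> (1::real)) \<and> N0 (2 *\<^sub>R x - (\<Sum>k\<in>{m..<n}. t k *\<^sub>R u k)) \<le> \<epsilon>"
    if "\<epsilon> > 0" for m \<epsilon>
  proof (rule approximable_by_bounded_combinations[OF N0 _ that])
    fix f :: "'a \<Rightarrow> real" assume f: "linear f" "\<exists>K. \<forall>y. \<bar>f y\<bar> \<le> K * N0 y" "summable (\<lambda>k. \<bar>f (u k)\<bar>)"
    then obtain K where K: "\<And>y. \<bar>f y\<bar> \<le> K * N0 y" by blast
    have "\<bar>f y\<bar> \<le> K * minkowski_gauge B y" if "y \<in> span B" for y
      using K[of y] P(3)[OF that] by (simp add: N0_def)
    then have "f \<in> disk_dual B"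
      unfolding disk_dual_def using linear_add[OF f(1)] linear_scale[OF f(1)] by auto
    then have "f x = 0" using f(3) by (rule Gamma_perp_annihilated[OF xB])
    then show "f (2 *\<^sub>R x) = 0" by (simp add: linear_scale[OF f(1)])
  qed
  ultimately obtain \<pi> :: "nat \<Rightarrow> nat" where \<pi>: "bij \<pi>" "(\<lambda>n. N1 ((\<Sum>k<n. u (\<pi> k)) - (S + x))) \<longlonglongrightarrow> 0"
    using rearrangement_converges[OF N0 N1 R _ finite_sets_with_prescribed_sum[OF N0 N1 R lim approx]] by blast
  have sum_span: "(\<Sum>k<n. u (\<pi> k)) \<in> span B" for n by (intro span_sum u)
  have "converges_in_disk_to D (\<lambda>n. \<Sum>k<n. u (\<pi> k)) (S + x)"
    unfolding converges_in_disk_to_def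
  proof (intro conjI)
    show "(\<lambda>n. minkowski_gauge D ((\<Sum>k<n. u (\<pi> k)) - (S + x))) \<longlonglongrightarrow> 0"
      using \<pi>(2) P(3)[OF span_diff[OF sum_span span_add[OF sp]]] by (simp add: N1_def)
  qed (use sum_span span_add[OF sp] BD in auto)
  then have "(\<lambda>k. u (\<pi> k)) sums (S + x)"
    unfolding sums_def by (rule disk_convergence_imp_tendsto[OF acD])
  then show ?thesis using \<pi>(1) unfolding domain_of_sums_def by blast
qed

theorem theorem2p6:
  fixes u :: "nat \<Rightarrow> 'a::locally_convex_space"
  assumes "complete (UNIV :: 'a set)"
    and "co_nuclear TYPE('a)"
    and "\<forall>s::nat \<Rightarrow> 'a. convergent s \<longrightarrow> converges_locally s"
    and "summable u"
  shows "affine (domain_of_sums u) \<and>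
    (\<forall>B0\<in>closed_disks. series_converges_in_disk B0 u \<longrightarrow>
       domain_of_sums u = (\<lambda>x. suminf u + x) ` Gamma_perp_loc B0 u)"
proof -
  have eq: "domain_of_sums u = (\<lambda>x. suminf u + x) ` Gamma_perp_loc B0 u"
    if B0: "B0 \<in> closed_disks" and conv: "series_converges_in_disk B0 u" for B0
  proof -
    obtain S where S: "converges_in_disk_to B0 (\<lambda>n. \<Sum>k<n. u k) S"
      using conv unfolding series_converges_in_disk_def by blast
    have "u sums S" unfolding sums_def
      using B0 by (intro disk_convergence_imp_tendsto[OF _ _ S]) (auto simp: closed_disks_def)
    then have S_eq: "S = suminf u" by (rule sums_unique)
    show ?thesis
    proof
      show "domain_of_sums u \<subseteq> (\<lambda>x. suminf u + x) ` Gamma_perp_loc B0 u"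
      proof
        fix y assume "y \<in> domain_of_sums u"
        then obtain \<pi> where "bij \<pi>" "(\<lambda>k. u (\<pi> k)) sums y" unfolding domain_of_sums_def by blast
        then have "y - S \<in> Gamma_perp_loc B0 u" by (rule rearranged_sum_in_translate[OF assms(3) B0 S])
        then show "y \<in> (\<lambda>x. suminf u + x) ` Gamma_perp_loc B0 u"
          unfolding S_eq by (intro image_eqI[of _ _ "y - suminf u"]) simp_all
      qed
      show "(\<lambda>x. suminf u + x) ` Gamma_perp_loc B0 u \<subseteq> domain_of_sums u"
        using translate_in_domain_of_sums[OF assms(2) B0 S] unfolding S_eq by blast
    qed
  qed
  \<comment> \<open>The affine claim mentions no disk, so one admissible disk is chosen to describe
    the domain of sums.\<close>
  obtain B0 where B0: "B0 \<in> closed_disks" "series_converges_in_disk B0 u"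
    using ex_disk_series_converges[OF assms(3,4)] by blast
  have "affine (domain_of_sums u)" unfolding eq[OF B0]
    using subspace_imp_affine[OF subspace_Gamma_perp_loc[OF B0(1)]] by (simp add: affine_translation[symmetric])
  then show ?thesis using eq by blast
qed

end
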